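(* For $a_1,\dots,a_4,b_1,b_2$ and $n\in\mathbb{N}$ let $N(a_1,a_2,a_3,a_4,b_1,b_2;n)$ be the number of $(x_1,\dots,x_8)\in\mathbb{Z}^8$ with $n=\sum_{i=1}^4a_ix_i^2+b_1(x_5^2+x_5x_6+x_6^2)+b_2(x_7^2+x_7x_8+x_8^2)$. Let $(a_1,a_2,a_3,a_4)\in\{(1,1,1,1),(1,1,2,2),(1,1,3,3),(2,2,2,2),(2,2,3,3),(3,3,3,3)\}$ and $(b_1,b_2)\in\{(1,1),(1,2),(1,4),(2,2),(2,4),(4,4)\}$. Then for every $n\in\mathbb{N}$, $$N(a_1,a_2,a_3,a_4,b_1,b_2;n)=\sum_{i=1}^{16}\alpha_iA_i(n),$$ where $A_i(n)$ are the Fourier coefficients of the functions $f_i$ described in the context and $(\alpha_1,\dots,\alpha_{16})$ is the vector assigned to $(a_1a_2a_3a_4,b_1b_2)$ in the table in the context.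
   Context: $q=e^{2\pi iz}$, $\eta(z)=q^{1/24}\prod_{n\ge1}(1-q^n)$, $E_4(z)=1+240\sum_{n\ge1}\sigma_3(n)q^n$ with $\sigma_3(n)=\sum_{d\mid n}d^3$. Put $f_{4,6}(z)=\eta^2(z)\eta^2(2z)\eta^2(3z)\eta^2(6z)$, $f_{4,8}(z)=\eta^4(2z)\eta^4(4z)$, $f_{4,12}(z)=\eta^{-1}(z)\eta^{2}(2z)\eta^{3}(3z)\eta^{3}(4z)\eta^{2}(6z)\eta^{-1}(12z)-\eta^{3}(z)\eta^{2}(2z)\eta^{-1}(3z)\eta^{-1}(4z)\eta^{2}(6z)\eta^{3}(12z)$, $f_{4,24}(z)=\eta^{-4}(z)\eta^{11}(2z)\eta^{-4}(3z)\eta^{-3}(4z)\eta^{11}(6z)\eta^{-3}(12z)=\sum a_{4,24}(n)q^n$. Set $f_1=E_4(z)$, $f_2=E_4(2z)$, $f_3=E_4(3z)$, $f_4=E_4(4z)$, $f_5=E_4(6z)$, $f_6=E_4(8z)$, $f_7=E_4(12z)$, $f_8=E_4(24z)$, $f_9=f_{4,6}(z)$, $f_{10}=f_{4,6}(2z)$, $f_{11}=f_{4,6}(4z)$, $f_{12}=f_{4,8}(z)$, $f_{13}=f_{4,8}(3z)$, $f_{14}=f_{4,12}(z)$, $f_{15}=f_{4,12}(2z)$, $f_{16}=\sum_{n\ \mathrm{odd}}a_{4,24}(n)q^n$; and $f_i(z)=\sum_{n\ge0}A_i(n)q^n$. Table of $(\alpha_1,\dots,\alpha_{16})$: (1111,11):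 7/75, -7/100, -9/25, -28/75, 27/100, 0, 36/25, 0, -72/5, -288/5, 0, 0, 0, 12, 0, 0. (1111,12): 13/300, -13/200, 9/100, 26/75, -27/200, 0, 18/25, 0, 48/5, 96/5, 0, 0, 0, -6, 0, 0. (1111,14): 7/300, 0, -9/100, -28/75, 0, 0, 36/25, 0, -18/5, 72/5, 0, 0, 0, 12, 0, 0. (1111,22): 7/300, 0, -9/100, -28/75, 0, 0, 36/25, 0, 12/5, -48/5, 0, 0, 0, 0, 0, 0. (1111,24): 13/1200, -13/400, 9/400, 26/75, -27/400, 0, 18/25, 0, 12/5, 96/5, 0, 0, 0, 3, 0, 0. (1111,44): 7/1200, 7/400, -9/400, -28/75, -27/400, 0, 36/25, 0, 18/5, 72/5, 0, 0, 0, 3, 0, 0. (1122,11): 7/150, -7/150, -9/50, 7/300, 9/50, -28/75, -9/100, 36/25, -36/5, -48, -768/5, -3, -81, 6, 36, 9. (1122,12): 13/600, -13/600, 9/200, -13/600, -9/200, 26/75, -9/200, 18/25, 24/5, 12, 96/5, 15/2, 81/2, -3, -6, -9/2. (1122,14): 7/600, -7/600, -9/200, 7/300, 9/200, -28/75, -9/100, 36/25, -9/5, 6, -48/5, -3/2, -81/2, 6, 0, 9/2. (1122,22): 7/600, -7/600, -9/200, 7/300, 9/200, -28/75, -9/100, 36/25, 6/5, -12, -288/5, 0, 0, 0, 12, 0. (1122,24): 13/2400, -13/2400, 9/800, -13/600, -9/800, 26/75, -9/200, 18/25, 6/5, 12, 96/5, 0, 0, 3/2, -6, 0. (1122,44):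 7/2400, -7/2400, -9/800, 7/300, 9/800, -28/75, -9/100, 36/25, 9/5, 6, -48/5, 0, 0, 3/2, 0, 0. (1133,11): 2/75, -1/30, 6/25, 8/75, -3/10, 0, 24/25, 0, 48/5, 288/5, 0, 0, 0, 0, 0, 0. (1133,12): 1/60, -1/120, -3/20, -2/15, 3/40, 0, 6/5, 0, 0, 0, 0, 0, 0, 6, 0, 0. (1133,14): 1/150, -1/75, 3/50, 8/75, -3/25, 0, 24/25, 0, 42/5, 168/5, 0, 0, 0, 0, 0, 0. (1133,22): 1/150, -1/75, 3/50, 8/75, -3/25, 0, 24/25, 0, 12/5, 48/5, 0, 0, 0, 0, 0, 0. (1133,24): 1/240, 1/240, -3/80, -2/15, -3/80, 0, 6/5, 0, 0, 0, 0, 0, 0, 3, 0, 0. (1133,44): 1/600, -1/120, 3/200, 8/75, -3/40, 0, 24/25, 0, 18/5, 48/5, 0, 0, 0, 0, 0, 0. (2222,11): 7/400, 91/1200, -27/400, -7/100, -117/400, -28/75, 27/100, 36/25, -36/5, -312/5, -768/5, -3, -81, 9, 36, 9. (2222,12): 13/800, -247/2400, 27/800, 13/200, -171/800, 26/75, 27/200, 18/25, 18/5, 84/5, 96/5, 15/2, 81/2, -9/2, -6, -9/2. (2222,14): 7/800, -133/2400, -27/800, 7/100, 171/800, -28/75, -27/100, 36/25, -18/5, -24/5, -48/5, -3/2, -81/2, 9/2, 0, 9/2. (2222,22): 0, 7/75, 0, -7/100, -9/25, -28/75, 27/100, 36/25, 0, -72/5, -288/5, 0, 0, 0, 12, 0.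 (2222,24): 0, 13/300, 0, -13/200, 9/100, 26/75, -27/200, 18/25, 0, 48/5, 96/5, 0, 0, 0, -6, 0. (2222,44): 0, 7/300, 0, 0, -9/100, -28/75, 0, 36/25, 0, 12/5, -48/5, 0, 0, 0, 0, 0. (2233,11): 1/75, -1/75, 3/25, -1/150, -3/25, 8/75, -3/50, 24/25, 24/5, 48, 768/5, 10, 18, 0, -24, -6. (2233,12): 1/120, -1/120, -3/40, 1/120, 3/40, -2/15, -3/40, 6/5, 0, -12, -96, -7/2, -9/2, 3, 6, 9/2. (2233,14): 1/300, -1/300, 3/100, -1/150, -3/100, 8/75, -3/50, 24/25, 21/5, 18, 48/5, 5/2, 63/2, 0, -12, -3/2. (2233,22): 1/300, -1/300, 3/100, -1/150, -3/100, 8/75, -3/50, 24/25, 6/5, 12, 288/5, 1, -9, 0, 0, -3. (2233,24): 1/480, -1/480, -3/160, 1/120, 3/160, -2/15, -3/40, 6/5, 0, 0, 0, -2, -18, 3/2, 6, 0. (2233,44): 1/1200, -1/1200, 3/400, -1/150, -3/400, 8/75, -3/50, 24/25, 9/5, 6, 48/5, -1/2, 9/2, 0, 0, -3/2. (3333,11): 1/75, -1/100, -7/25, -4/75, 21/100, 0, 28/25, 0, 24/5, 96/5, 0, 0, 0, 4, 0, 0. (3333,12): 1/300, -1/200, 13/100, 2/75, -39/200, 0, 26/25, 0, 16/5, 32/5, 0, 0, 0, 2, 0, 0. (3333,14): 1/300, 0, -7/100, -4/75, 0, 0, 28/25, 0, 6/5, -24/5, 0, 0, 0, 4, 0, 0.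 (3333,22): 1/300, 0, -7/100, -4/75, 0, 0, 28/25, 0, -4/5, 16/5, 0, 0, 0, 0, 0, 0. (3333,24): 1/1200, -1/400, 13/400, 2/75, -39/400, 0, 26/25, 0, 4/5, 32/5, 0, 0, 0, -1, 0, 0. (3333,44): 1/1200, 1/400, -7/400, -4/75, -21/400, 0, 28/25, 0, -6/5, -24/5, 0, 0, 0, 1, 0, 0. *)

theory Defs
  imports "HOL-Computational_Algebra.Formal_Power_Series"
begin

text \<open>Truncation-free Euler product: coefficient m of prod_{n>=1} (1 - q^(k n)),
  computed from the finite product over n = 1..m (factors with n > m do not affect
  coefficient m when k >= 1).\<close>
definition euler_prod :: "nat \<Rightarrow> rat fps" where
  "euler_prod k = Abs_fps (\<lambda>m. fps_nth (\<Prod>n\<in>{1..m}. (1 - fps_X ^ (k * n))) m)"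

definition eta_part :: "nat \<Rightarrow> int \<Rightarrow> rat fps" where
  "eta_part k e = (if 0 \<le> e then euler_prod k ^ nat e else inverse (euler_prod k) ^ nat (- e))"

text \<open>Eta quotient prod eta(k z)^e, with eta(kz) = q^(k/24) prod (1-q^(kn)); the total
  q-power (sum k e)/24 is an integer for all quotients used below.\<close>
definition eta_quot :: "(nat \<times> int) list \<Rightarrow> rat fps" where
  "eta_quot ps = fps_X ^ nat ((\<Sum>(k, e)\<leftarrow>ps. int k * e) div 24)
      * (\<Prod>(k, e)\<leftarrow>ps. eta_part k e)"

text \<open>f(z) \<mapsto> f(kz).\<close>
definition rescale :: "nat \<Rightarrow> rat fps \<Rightarrow> rat fps" where
  "rescale k f = Abs_fps (\<lambda>n. if k dvd n then fps_nth f (n div k) else 0)"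

definition sigma3 :: "nat \<Rightarrow> nat" where
  "sigma3 n = (\<Sum>d\<in>{d. d dvd n}. d ^ 3)"

definition E4 :: "rat fps" where
  "E4 = Abs_fps (\<lambda>n. if n = 0 then 1 else 240 * of_nat (sigma3 n))"

definition f46 :: "rat fps" where
  "f46 = eta_quot [(1,2),(2,2),(3,2),(6,2)]"

definition f48 :: "rat fps" where
  "f48 = eta_quot [(2,4),(4,4)]"

definition f412 :: "rat fps" where
  "f412 = eta_quot [(1,-1),(2,2),(3,3),(4,3),(6,2),(12,-1)]
        - eta_quot [(1,3),(2,2),(3,-1),(4,-1),(6,2),(12,3)]"

definition f424 :: "rat fps" where
  "f424 = eta_quot [(1,-4),(2,11),(3,-4),(4,-3),(6,11),(12,-3)]"

definition odd_part :: "rat fps \<Rightarrow> rat fps" where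
  "odd_part f = Abs_fps (\<lambda>n. if odd n then fps_nth f n else 0)"

definition fs :: "rat fps list" where
  "fs = [rescale 1 E4, rescale 2 E4, rescale 3 E4, rescale 4 E4, rescale 6 E4,
         rescale 8 E4, rescale 12 E4, rescale 24 E4,
         f46, rescale 2 f46, rescale 4 f46, f48, rescale 3 f48, f412, rescale 2 f412,
         odd_part f424]"

definition A :: "nat \<Rightarrow> nat \<Rightarrow> rat" where
  "A i n = fps_nth (fs ! (i - 1)) n"

definition N :: "int \<Rightarrow> int \<Rightarrow> int \<Rightarrow> int \<Rightarrow> int \<Rightarrow> int \<Rightarrow> nat \<Rightarrow> nat" where
  "N a1 a2 a3 a4 b1 b2 n = card ({(x1, x2, x3, x4, x5, x6, x7, x8).
      int n = a1 * x1^2 + a2 * x2^2 + a3 * x3^2 + a4 * x4^2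
              + b1 * (x5^2 + x5 * x6 + x6^2) + b2 * (x7^2 + x7 * x8 + x8^2)
      } :: (int\<times>int\<times>int\<times>int\<times>int\<times>int\<times>int\<times>int) set)"

definition alpha_table :: "(((int \<times> int \<times> int \<times> int) \<times> (int \<times> int)) \<times> rat list) list" where
  "alpha_table = [
    (((1,1,1,1), (1,1)), [(7/75), (-7/100), (-9/25), (-28/75), (27/100), (0), (36/25), (0), (-72/5), (-288/5), (0), (0), (0), (12), (0), (0)]),
    (((1,1,1,1), (1,2)), [(13/300), (-13/200), (9/100), (26/75), (-27/200), (0), (18/25), (0), (48/5), (96/5), (0), (0), (0), (-6), (0), (0)]),
    (((1,1,1,1), (1,4)), [(7/300), (0), (-9/100), (-28/75), (0), (0), (36/25), (0), (-18/5), (72/5), (0), (0), (0), (12), (0), (0)]),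
    (((1,1,1,1), (2,2)), [(7/300), (0), (-9/100), (-28/75), (0), (0), (36/25), (0), (12/5), (-48/5), (0), (0), (0), (0), (0), (0)]),
    (((1,1,1,1), (2,4)), [(13/1200), (-13/400), (9/400), (26/75), (-27/400), (0), (18/25), (0), (12/5), (96/5), (0), (0), (0), (3), (0), (0)]),
    (((1,1,1,1), (4,4)), [(7/1200), (7/400), (-9/400), (-28/75), (-27/400), (0), (36/25), (0), (18/5), (72/5), (0), (0), (0), (3), (0), (0)]),
    (((1,1,2,2), (1,1)), [(7/150), (-7/150), (-9/50), (7/300), (9/50), (-28/75), (-9/100), (36/25), (-36/5), (-48), (-768/5), (-3), (-81), (6), (36), (9)]),
    (((1,1,2,2), (1,2)), [(13/600), (-13/600), (9/200), (-13/600), (-9/200), (26/75), (-9/200), (18/25), (24/5), (12), (96/5), (15/2), (81/2), (-3), (-6), (-9/2)]),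
    (((1,1,2,2), (1,4)), [(7/600), (-7/600), (-9/200), (7/300), (9/200), (-28/75), (-9/100), (36/25), (-9/5), (6), (-48/5), (-3/2), (-81/2), (6), (0), (9/2)]),
    (((1,1,2,2), (2,2)), [(7/600), (-7/600), (-9/200), (7/300), (9/200), (-28/75), (-9/100), (36/25), (6/5), (-12), (-288/5), (0), (0), (0), (12), (0)]),
    (((1,1,2,2), (2,4)), [(13/2400), (-13/2400), (9/800), (-13/600), (-9/800), (26/75), (-9/200), (18/25), (6/5), (12), (96/5), (0), (0), (3/2), (-6), (0)]),
    (((1,1,2,2), (4,4)), [(7/2400), (-7/2400), (-9/800), (7/300), (9/800), (-28/75), (-9/100), (36/25), (9/5), (6), (-48/5), (0), (0), (3/2), (0), (0)]),
    (((1,1,3,3), (1,1)), [(2/75), (-1/30), (6/25), (8/75), (-3/10), (0), (24/25), (0), (48/5), (288/5), (0), (0), (0), (0), (0), (0)]),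
    (((1,1,3,3), (1,2)), [(1/60), (-1/120), (-3/20), (-2/15), (3/40), (0), (6/5), (0), (0), (0), (0), (0), (0), (6), (0), (0)]),
    (((1,1,3,3), (1,4)), [(1/150), (-1/75), (3/50), (8/75), (-3/25), (0), (24/25), (0), (42/5), (168/5), (0), (0), (0), (0), (0), (0)]),
    (((1,1,3,3), (2,2)), [(1/150), (-1/75), (3/50), (8/75), (-3/25), (0), (24/25), (0), (12/5), (48/5), (0), (0), (0), (0), (0), (0)]),
    (((1,1,3,3), (2,4)), [(1/240), (1/240), (-3/80), (-2/15), (-3/80), (0), (6/5), (0), (0), (0), (0), (0), (0), (3), (0), (0)]),
    (((1,1,3,3), (4,4)), [(1/600), (-1/120), (3/200), (8/75), (-3/40), (0), (24/25), (0), (18/5), (48/5), (0), (0), (0), (0), (0), (0)]),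
    (((2,2,2,2), (1,1)), [(7/400), (91/1200), (-27/400), (-7/100), (-117/400), (-28/75), (27/100), (36/25), (-36/5), (-312/5), (-768/5), (-3), (-81), (9), (36), (9)]),
    (((2,2,2,2), (1,2)), [(13/800), (-247/2400), (27/800), (13/200), (-171/800), (26/75), (27/200), (18/25), (18/5), (84/5), (96/5), (15/2), (81/2), (-9/2), (-6), (-9/2)]),
    (((2,2,2,2), (1,4)), [(7/800), (-133/2400), (-27/800), (7/100), (171/800), (-28/75), (-27/100), (36/25), (-18/5), (-24/5), (-48/5), (-3/2), (-81/2), (9/2), (0), (9/2)]),
    (((2,2,2,2), (2,2)), [(0), (7/75), (0), (-7/100), (-9/25), (-28/75), (27/100), (36/25), (0), (-72/5), (-288/5), (0), (0), (0), (12), (0)]),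
    (((2,2,2,2), (2,4)), [(0), (13/300), (0), (-13/200), (9/100), (26/75), (-27/200), (18/25), (0), (48/5), (96/5), (0), (0), (0), (-6), (0)]),
    (((2,2,2,2), (4,4)), [(0), (7/300), (0), (0), (-9/100), (-28/75), (0), (36/25), (0), (12/5), (-48/5), (0), (0), (0), (0), (0)]),
    (((2,2,3,3), (1,1)), [(1/75), (-1/75), (3/25), (-1/150), (-3/25), (8/75), (-3/50), (24/25), (24/5), (48), (768/5), (10), (18), (0), (-24), (-6)]),
    (((2,2,3,3), (1,2)), [(1/120), (-1/120), (-3/40), (1/120), (3/40), (-2/15), (-3/40), (6/5), (0), (-12), (-96), (-7/2), (-9/2), (3), (6), (9/2)]),
    (((2,2,3,3), (1,4)), [(1/300), (-1/300), (3/100), (-1/150), (-3/100), (8/75), (-3/50), (24/25), (21/5), (18), (48/5), (5/2), (63/2), (0), (-12), (-3/2)]),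
    (((2,2,3,3), (2,2)), [(1/300), (-1/300), (3/100), (-1/150), (-3/100), (8/75), (-3/50), (24/25), (6/5), (12), (288/5), (1), (-9), (0), (0), (-3)]),
    (((2,2,3,3), (2,4)), [(1/480), (-1/480), (-3/160), (1/120), (3/160), (-2/15), (-3/40), (6/5), (0), (0), (0), (-2), (-18), (3/2), (6), (0)]),
    (((2,2,3,3), (4,4)), [(1/1200), (-1/1200), (3/400), (-1/150), (-3/400), (8/75), (-3/50), (24/25), (9/5), (6), (48/5), (-1/2), (9/2), (0), (0), (-3/2)]),
    (((3,3,3,3), (1,1)), [(1/75), (-1/100), (-7/25), (-4/75), (21/100), (0), (28/25), (0), (24/5), (96/5), (0), (0), (0), (4), (0), (0)]),
    (((3,3,3,3), (1,2)), [(1/300), (-1/200), (13/100), (2/75), (-39/200), (0), (26/25), (0), (16/5), (32/5), (0), (0), (0), (2), (0), (0)]),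
    (((3,3,3,3), (1,4)), [(1/300), (0), (-7/100), (-4/75), (0), (0), (28/25), (0), (6/5), (-24/5), (0), (0), (0), (4), (0), (0)]),
    (((3,3,3,3), (2,2)), [(1/300), (0), (-7/100), (-4/75), (0), (0), (28/25), (0), (-4/5), (16/5), (0), (0), (0), (0), (0), (0)]),
    (((3,3,3,3), (2,4)), [(1/1200), (-1/400), (13/400), (2/75), (-39/400), (0), (26/25), (0), (4/5), (32/5), (0), (0), (0), (-1), (0), (0)]),
    (((3,3,3,3), (4,4)), [(1/1200), (1/400), (-7/400), (-4/75), (-21/400), (0), (28/25), (0), (-6/5), (-24/5), (0), (0), (0), (1), (0), (0)])
  ]"

definition alpha :: "int \<times> int \<times> int \<times> int \<Rightarrow> int \<times> int \<Rightarrow> nat \<Rightarrow> rat" where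
  "alpha as bs i = the (map_of alpha_table (as, bs)) ! (i - 1)"

end

theory Submission
  imports Defs
begin

text \<open>
  Everything is done with formal power series in \<open>q\<close>. Write \<open>X, Y, Z, W\<close> for
  \<open>\<phi>(q)\<^sup>2, \<phi>(-q)\<^sup>2, \<phi>(q\<^sup>3)\<^sup>2, \<phi>(-q\<^sup>3)\<^sup>2\<close>, where \<open>\<phi>(q)\<close> is the sum of
  \<open>q ^ (x\<^sup>2)\<close> over the integers \<open>x\<close>. These four forms of weight 1 embed the modular curve of level 24
  as an intersection of the two quadrics \<open>Y (X + Z) = W (3 Z - X)\<close> and
  \<open>(3 Z - X) (X + Z) = (3 W - Y) (Y + W)\<close>, and every form of weight 4 occurring in the theorem is a
  quartic in them, so that each of the 36 identities is a congruence modulo the two quadrics.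

  The Eisenstein series enter through Ramanujan's equation \<open>12 q dE\<^sub>2/dq = E\<^sub>2\<^sup>2 - E\<^sub>4\<close>, which is
  an elementary convolution identity. Gauss' product formulas for theta series make \<open>E\<^sub>2\<close> a logarithmic
  derivative; the transformation \<open>q \<mapsto> q\<^sup>2\<close> acts on \<open>(X, Y)\<close> as the arithmetic-geometric mean, and
  a series with vanishing constant term that is invariant under \<open>q \<mapsto> q\<^sup>2\<close> is zero. The two quadrics
  follow from the modular equation of degree 3 (a lattice identity) and its derivative.
\<close>

section \<open>Substitutions and the Euler derivation\<close>

text \<open>The customary proof compares finitely many coefficients inside a finite-dimensional
  space of modular forms. Here every identity has to be derived, and the tool is that
  \<open>rat fps\<close> is an integral domain: nonzero factors may be cancelled, and of two series
  with equal squares one coefficient selects the sign. The second point shapes the argument, because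
  several forms that occur are only square roots of polynomials in X, Y, Z, W. The hexagonal theta
  series is linear in phi(q) phi(q^3) and phi(-q) phi(-q^3), whose squares are XZ and YW; the
  substitution q -> q^2 replaces Y by the root of XY; and eta quotients with odd exponents can be
  translated only after squaring. Products of two such roots are quadratics again, which suffices
  because hexagonal forms always occur in pairs.\<close>

lemma rescale_nth: "fps_nth (rescale k f) n = (if k dvd n then fps_nth f (n div k) else 0)"
  by (simp add: rescale_def)

lemma rescale_eq_compose:
  assumes "k > 0"
  shows "rescale k f = f oo fps_X ^ k"
proof (rule fps_ext)
  fix n
  have "fps_nth (f oo fps_X ^ k) n = (\<Sum>i=0..n. if i = n div k \<and> k dvd n then fps_nth f i else 0)"
    unfolding fps_compose_nth using assms
    by (intro sum.cong refl) (auto simp flip: power_mult elim!: dvdE)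
  also have "\<dots> = fps_nth (rescale k f) n"
    by (auto simp: rescale_nth)
  finally show "fps_nth (rescale k f) n = fps_nth (f oo fps_X ^ k) n" ..
qed

lemma rescale_add [simp]: "rescale k (f + g) = rescale k f + rescale k g"
  and rescale_diff [simp]: "rescale k (f - g) = rescale k f - rescale k g"
  by (auto intro!: fps_ext simp: rescale_nth)

lemma rescale_mult:
  assumes "k > 0"
  shows "rescale k (f * g) = rescale k f * rescale k g"
  using assms by (simp add: rescale_eq_compose fps_compose_mult_distrib)

lemma rescale_const: "k > 0 \<Longrightarrow> rescale k (fps_const c) = fps_const c"
  by (simp add: rescale_eq_compose)

lemma rescale_1 [simp]: "k > 0 \<Longrightarrow> rescale k 1 = 1"
  by (simp add: rescale_eq_compose)

lemma rescale_numeral [simp]: "k > 0 \<Longrightarrow> rescale k (numeral m) = numeral m"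
  by (simp add: fps_numeral_fps_const rescale_const)

lemma rescale_power:
  assumes "k > 0"
  shows "rescale k (f ^ m) = rescale k f ^ m"
  using assms by (induction m) (simp_all add: rescale_mult)

lemma rescale_X_power: "k > 0 \<Longrightarrow> rescale k (fps_X ^ m) = fps_X ^ (k * m)"
  by (simp add: rescale_eq_compose fps_X_power_compose power_mult)

lemma rescale_X: "k > 0 \<Longrightarrow> rescale k fps_X = fps_X ^ k"
  by (simp add: rescale_eq_compose)

lemma rescale_rescale:
  assumes "k > 0" "l > 0"
  shows "rescale k (rescale l f) = rescale (k * l) f"
proof (rule fps_ext)
  fix n
  show "fps_nth (rescale k (rescale l f)) n = fps_nth (rescale (k * l) f) n"
  proof (cases "k dvd n")
    case True
    then obtain m where "n = k * m" by blast
    then show ?thesis using assms by (simp add: rescale_nth)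
  next
    case False
    then have "\<not> k * l dvd n" by (meson dvd_mult_left)
    with False show ?thesis by (simp add: rescale_nth)
  qed
qed

lemmas rescale_hom = rescale_mult rescale_power rescale_rescale rescale_X_power rescale_X

text \<open>The involution q -> -q. It exchanges X with Y and Z with W, so applying it to a proved
  identity yields the conjugate identity for free.\<close>

definition negq :: "rat fps \<Rightarrow> rat fps" where
  "negq f = f oo (- fps_X)"

lemma negq_nth: "fps_nth (negq f) n = (- 1) ^ n * fps_nth f n"
  by (simp add: negq_def fps_compose_uminus')

lemma negq_add [simp]: "negq (f + g) = negq f + negq g"
  and negq_diff [simp]: "negq (f - g) = negq f - negq g"
  by (auto intro!: fps_ext simp: negq_nth algebra_simps)

lemma negq_mult [simp]: "negq (f * g) = negq f * negq g"
  by (simp add: negq_def fps_compose_mult_distrib)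

lemma negq_1 [simp]: "negq 1 = 1"
  by (simp add: negq_def)

lemma negq_numeral [simp]: "negq (numeral m) = numeral m"
  by (simp add: negq_def fps_numeral_fps_const)

lemma negq_power [simp]: "negq (f ^ m) = negq f ^ m"
  by (induction m) simp_all

lemma negq_negq [simp]: "negq (negq f) = f"
  by (rule fps_ext) (simp add: negq_nth flip: mult.assoc power_mult_distrib)

lemma negq_rescale_even: "even k \<Longrightarrow> negq (rescale k f) = rescale k f"
  by (rule fps_ext) (auto simp: negq_nth rescale_nth)

lemma negq_rescale_odd: "odd k \<Longrightarrow> negq (rescale k f) = rescale k (negq f)"
  by (rule fps_ext) (auto simp: negq_nth rescale_nth power_mult elim!: dvdE)

definition DD :: "rat fps \<Rightarrow> rat fps" where
  "DD f = fps_X * fps_deriv f"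

lemma DD_nth: "fps_nth (DD f) n = of_nat n * fps_nth f n"
  by (cases n) (simp_all add: DD_def)

lemma DD_add [simp]: "DD (f + g) = DD f + DD g"
  and DD_diff [simp]: "DD (f - g) = DD f - DD g"
  and DD_mult: "DD (f * g) = DD f * g + f * DD g"
  and DD_1 [simp]: "DD 1 = 0"
  and DD_numeral [simp]: "DD (numeral m) = 0"
  by (simp_all add: DD_def algebra_simps fps_numeral_fps_const)

lemma DD_power2: "DD (f ^ 2) = 2 * f * DD f"
  by (simp add: power2_eq_square DD_mult)

lemma DD_power4: "DD (f ^ 4) = 4 * f ^ 3 * DD f"
  by (simp add: power4_eq_xxxx power3_eq_cube DD_mult algebra_simps)

lemma DD_rescale: "DD (rescale k f) = of_nat k * rescale k (DD f)"
  by (rule fps_ext) (auto simp: DD_nth rescale_nth simp flip: fps_of_nat elim!: dvdE)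

text \<open>Descent on the exponent: coefficient n is c times coefficient n/2, and it is 0 for odd
  n, where repeated halving ends; exponent 0 is covered by the assumption. The factor c is 1 for the
  weight 2 series below and 4 for the weight 4 one.\<close>

lemma rescale_invariant_eq_0:
  assumes "fps_nth f 0 = 0" "f = fps_const c * rescale 2 f"
  shows "f = 0"
proof (rule fps_ext)
  fix n
  show "fps_nth f n = fps_nth 0 n"
  proof (induction n rule: less_induct)
    case (less n)
    have "fps_nth f n = c * fps_nth (rescale 2 f) n"
      using assms(2) by (metis fps_mult_left_const_nth)
    then show ?case
      using less assms(1) by (cases "n = 0") (auto simp: rescale_nth)
  qed
qed

section \<open>Generating series of weighted lattices\<close>

text \<open>Fibre of the exponent map \<open>e\<close>, unrelated to Fibonacci numbers.\<close>

definition fib :: "'a set \<Rightarrow> ('a \<Rightarrow> nat) \<Rightarrow> nat \<Rightarrow> 'a set" where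
  "fib S e n = {i \<in> S. e i = n}"

text \<open>The formal sum of \<open>w i\<close> q^(\<open>e i\<close>). A sum over an infinite
  fibre is 0 by convention, which is why products and unions are treated under
  \<open>finfib\<close>.\<close>

definition gser :: "'a set \<Rightarrow> ('a \<Rightarrow> nat) \<Rightarrow> ('a \<Rightarrow> rat) \<Rightarrow> rat fps" where
  "gser S e w = Abs_fps (\<lambda>n. \<Sum>i\<in>fib S e n. w i)"

definition finfib :: "'a set \<Rightarrow> ('a \<Rightarrow> nat) \<Rightarrow> bool" where
  "finfib S e \<longleftrightarrow> (\<forall>n. finite (fib S e n))"

lemma gser_nth: "fps_nth (gser S e w) n = (\<Sum>i\<in>fib S e n. w i)"
  by (simp add: gser_def)

lemma gser_cong:
  assumes "\<And>i. i \<in> S \<Longrightarrow> e i = f i" "\<And>i. i \<in> S \<Longrightarrow> w i = v i"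
  shows "gser S e w = gser S f v"
proof -
  have "fib S e n = fib S f n" for n
    using assms(1) by (auto simp: fib_def)
  then show ?thesis
    using assms(2) by (auto simp: gser_def fib_def intro!: arg_cong[where f = Abs_fps] sum.cong)
qed

lemma fib_Times:
  "fib (S \<times> T) (\<lambda>(i, j). e i + f j) n = (\<Union>k\<in>{0..n}. fib S e k \<times> fib T f (n - k))"
  by (auto simp: fib_def)

lemma finfib_Times:
  assumes "finfib S e" "finfib T f"
  shows "finfib (S \<times> T) (\<lambda>(i, j). e i + f j)"
  using assms by (auto simp: finfib_def fib_Times)

lemma gser_mult:
  assumes "finfib S e" "finfib T f"
  shows "gser S e w * gser T f v = gser (S \<times> T) (\<lambda>(i, j). e i + f j) (\<lambda>(i, j). w i * v j)"
proof (rule fps_ext)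
  fix n
  have "fps_nth (gser (S \<times> T) (\<lambda>(i, j). e i + f j) (\<lambda>(i, j). w i * v j)) n
      = (\<Sum>k=0..n. \<Sum>(i, j)\<in>fib S e k \<times> fib T f (n - k). w i * v j)"
    unfolding gser_nth fib_Times using assms
    by (intro sum.UNION_disjoint) (auto simp: finfib_def fib_def)
  also have "\<dots> = fps_nth (gser S e w * gser T f v) n"
    by (simp add: fps_mult_nth gser_nth sum_product sum.cartesian_product)
  finally show "fps_nth (gser S e w * gser T f v) n
      = fps_nth (gser (S \<times> T) (\<lambda>(i, j). e i + f j) (\<lambda>(i, j). w i * v j)) n" ..
qed

lemma gser_reindex:
  assumes h: "bij_betw h S T"
    and "\<And>i. i \<in> S \<Longrightarrow> e i = f (h i)" "\<And>i. i \<in> S \<Longrightarrow> w i = v (h i)"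
  shows "gser S e w = gser T f v"
proof (rule fps_ext)
  fix n
  have "bij_betw h (fib S e n) (fib T f n)"
    using h assms(2) unfolding bij_betw_def fib_def inj_on_def by auto
  then have "(\<Sum>i\<in>fib S e n. v (h i)) = (\<Sum>j\<in>fib T f n. v j)"
    by (rule sum.reindex_bij_betw)
  moreover have "(\<Sum>i\<in>fib S e n. w i) = (\<Sum>i\<in>fib S e n. v (h i))"
    using assms(3) by (intro sum.cong refl) (auto simp: fib_def)
  ultimately show "fps_nth (gser S e w) n = fps_nth (gser T f v) n"
    by (simp add: gser_nth)
qed

lemma gser_Un:
  assumes "finfib S e" "finfib T e" "S \<inter> T = {}"
  shows "gser (S \<union> T) e w = gser S e w + gser T e w"
proof (rule fps_ext)
  fix n
  have "fib (S \<union> T) e n = fib S e n \<union> fib T e n" "fib S e n \<inter> fib T e n = {}"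
    using assms by (auto simp: fib_def)
  then show "fps_nth (gser (S \<union> T) e w) n = fps_nth (gser S e w + gser T e w) n"
    using assms by (simp add: gser_nth finfib_def sum.union_disjoint)
qed

lemma gser_uminus: "gser S e (\<lambda>i. - w i) = - gser S e w"
  by (rule fps_ext) (simp add: gser_nth sum_negf)

lemma finfib_subset:
  assumes "finfib T e" "S \<subseteq> T"
  shows "finfib S e"
proof -
  have "fib S e n \<subseteq> fib T e n" for n
    using assms(2) by (auto simp: fib_def)
  then show ?thesis
    using assms(1) unfolding finfib_def by (meson finite_subset)
qed

lemma rescale_gser:
  assumes "k > 0"
  shows "rescale k (gser S e w) = gser S (\<lambda>i. k * e i) w"
proof (rule fps_ext)
  fix n
  have "fib S (\<lambda>i. k * e i) n = (if k dvd n then fib S e (n div k) else {})"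
    using assms by (auto simp: fib_def)
  then show "fps_nth (rescale k (gser S e w)) n = fps_nth (gser S (\<lambda>i. k * e i) w) n"
    by (simp add: rescale_nth gser_nth)
qed

lemma negq_gser: "negq (gser S e w) = gser S e (\<lambda>i. (- 1) ^ e i * w i)"
  by (rule fps_ext) (auto simp: negq_nth gser_nth sum_distrib_left fib_def intro!: sum.cong)

lemma X_power_gser: "fps_X ^ k * gser S e w = gser S (\<lambda>i. k + e i) w"
proof (rule fps_ext)
  fix n
  have "fib S (\<lambda>i. k + e i) n = (if n < k then {} else fib S e (n - k))"
    by (auto simp: fib_def)
  then show "fps_nth (fps_X ^ k * gser S e w) n = fps_nth (gser S (\<lambda>i. k + e i) w) n"
    by (simp add: fps_X_power_mult_nth gser_nth)
qed

section \<open>Theta series\<close>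

definition phi :: "rat fps" where
  "phi = gser UNIV (\<lambda>x::int. nat (x\<^sup>2)) (\<lambda>_. 1)"

text \<open>The sum is over all integers, so this is twice Ramanujan's \<open>\<psi>\<close>.\<close>

definition Psi :: "rat fps" where
  "Psi = gser UNIV (\<lambda>x::int. nat (x * (x + 1) div 2)) (\<lambda>_. 1)"

definition hex :: "rat fps" where
  "hex = gser UNIV (\<lambda>(x::int, y::int). nat (x\<^sup>2 + x * y + y\<^sup>2)) (\<lambda>_. 1)"

lemma abs_le_square: "\<bar>x\<bar> \<le> x\<^sup>2" for x :: int
  by (metis abs_le_square_iff abs_of_nonneg abs_ge_zero power2_abs power2_eq_square
      mult.commute int_one_le_iff_zero_less mult_le_cancel_left1 abs_eq_0 less_le mult_zero_left)

lemma triangle_nonneg: "0 \<le> x * (x + 1)" for x :: int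
  by (cases "x \<ge> 0") (auto intro: mult_nonpos_nonpos)

lemma two_mult_triangle: "2 * nat (x * (x + 1) div 2) = nat (x * (x + 1))" for x :: int
proof -
  have "even (x * (x + 1))" by simp
  then show ?thesis
    using triangle_nonneg[of x] by (simp add: nat_mult_distrib[symmetric] flip: nat_numeral)
qed

lemma finfib_square: "finfib UNIV (\<lambda>x::int. nat (x\<^sup>2))"
proof -
  have "fib UNIV (\<lambda>x::int. nat (x\<^sup>2)) n \<subseteq> {- int n..int n}" for n
    using abs_le_square by (auto simp: fib_def) (smt (verit) zero_le_power2)+
  then show ?thesis by (auto simp: finfib_def intro: finite_subset)
qed

lemma finfib_triangle: "finfib UNIV (\<lambda>x::int. nat (x * (x + 1) div 2))"
proof -
  have "fib UNIV (\<lambda>x::int. nat (x * (x + 1) div 2)) n \<subseteq> {- (2 * int n + 1)..2 * int n + 1}" for n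
  proof
    fix x :: int assume "x \<in> fib UNIV (\<lambda>x::int. nat (x * (x + 1) div 2)) n"
    then have "x * (x + 1) = 2 * int n"
      using two_mult_triangle[of x] triangle_nonneg[of x] by (simp add: fib_def)
    then have "x\<^sup>2 + x = 2 * int n" by (simp add: power2_eq_square algebra_simps)
    moreover have "\<bar>x + 1\<bar> \<le> (x + 1)\<^sup>2" "\<bar>x\<bar> \<le> x\<^sup>2" by (rule abs_le_square)+
    moreover have "(x + 1)\<^sup>2 = x\<^sup>2 + 2 * x + 1" by (simp add: power2_eq_square algebra_simps)
    ultimately have "- (2 * int n + 1) \<le> x" "x \<le> 2 * int n + 1"
      by linarith+
    then show "x \<in> {- (2 * int n + 1)..2 * int n + 1}"
      by simp
  qed
  then show ?thesis by (auto simp: finfib_def intro: finite_subset)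
qed

lemma hex_nonneg: "0 \<le> x\<^sup>2 + x * y + y\<^sup>2" for x y :: int
proof -
  have "4 * (x\<^sup>2 + x * y + y\<^sup>2) = (2 * x + y)\<^sup>2 + 3 * y\<^sup>2"
    by (simp add: power2_eq_square algebra_simps)
  then show ?thesis by (smt (verit) zero_le_power2)
qed

lemma finfib_hex: "finfib UNIV (\<lambda>(x::int, y::int). nat (x\<^sup>2 + x * y + y\<^sup>2))"
proof -
  have sub: "fib UNIV (\<lambda>(x::int, y::int). nat (x\<^sup>2 + x * y + y\<^sup>2)) n
      \<subseteq> {- (2 * int n)..2 * int n} \<times> {- (2 * int n)..2 * int n}" for n
  proof
    fix p :: "int \<times> int"
    assume *: "p \<in> fib UNIV (\<lambda>(x::int, y::int). nat (x\<^sup>2 + x * y + y\<^sup>2)) n"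
    obtain x y where p: "p = (x, y)" by fastforce
    have n: "x\<^sup>2 + x * y + y\<^sup>2 = int n"
      using * hex_nonneg[of x y] by (auto simp: fib_def p)
    have "4 * int n = (2 * x + y)\<^sup>2 + 3 * y\<^sup>2" "4 * int n = (2 * y + x)\<^sup>2 + 3 * x\<^sup>2"
      by (simp_all add: power2_eq_square algebra_simps flip: n)
    then have "x\<^sup>2 \<le> 2 * int n" "y\<^sup>2 \<le> 2 * int n"
      using zero_le_power2[of "2 * x + y"] zero_le_power2[of "2 * y + x"] by linarith+
    then show "p \<in> {- (2 * int n)..2 * int n} \<times> {- (2 * int n)..2 * int n}"
      using abs_le_square[of x] abs_le_square[of y] by (simp add: p abs_le_iff)
  qed
  show ?thesis unfolding finfib_def by (intro allI finite_subset[OF sub]) auto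
qed

lemma finfib_mult: "finfib S e \<Longrightarrow> k > 0 \<Longrightarrow> finfib S (\<lambda>i. k * e i)"
proof -
  assume *: "finfib S e" "k > 0"
  have "fib S (\<lambda>i. k * e i) n \<subseteq> fib S e (n div k)" for n
    using *(2) by (auto simp: fib_def)
  then show ?thesis using *(1) unfolding finfib_def by (meson finite_subset)
qed

lemma minus_one_power_square: "(- 1) ^ nat (x\<^sup>2) = (if even x then 1 else - 1 :: rat)" for x :: int
  by (simp add: even_nat_iff minus_one_power_iff)

text \<open>\<open>Ev c\<close> and \<open>Od c\<close> split phi(q) phi(q^c) by the parity of x +
  y. For odd c this is the parity of the exponent x^2 + c y^2, so q -> -q fixes the first part and
  negates the second.\<close>

definition Ev :: "nat \<Rightarrow> rat fps" where
  "Ev c = gser {(x::int, y::int). even (x + y)} (\<lambda>(x, y). nat (x\<^sup>2) + c * nat (y\<^sup>2)) (\<lambda>_. 1)"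

definition Od :: "nat \<Rightarrow> rat fps" where
  "Od c = gser {(x::int, y::int). odd (x + y)} (\<lambda>(x, y). nat (x\<^sup>2) + c * nat (y\<^sup>2)) (\<lambda>_. 1)"

lemma phi_rescale_phi:
  assumes "c > 0"
  shows "phi * rescale c phi = Ev c + Od c"
proof -
  let ?e = "\<lambda>(x::int, y::int). nat (x\<^sup>2) + c * nat (y\<^sup>2)"
  have f: "finfib (UNIV \<times> UNIV) ?e"
    by (rule finfib_Times[OF finfib_square finfib_mult[OF finfib_square assms]])
  have "phi * rescale c phi = gser (UNIV \<times> UNIV) ?e (\<lambda>_. 1)"
    unfolding phi_def rescale_gser[OF assms]
    by (subst gser_mult[OF finfib_square finfib_mult[OF finfib_square assms]])
       (auto intro: gser_cong)
  also have "UNIV \<times> UNIV = {(x::int, y::int). even (x + y)} \<union> {(x, y). odd (x + y)}"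
    by auto
  also have "gser \<dots> ?e (\<lambda>_. 1) = Ev c + Od c"
    unfolding Ev_def Od_def by (rule gser_Un) (auto intro: finfib_subset[OF f])
  finally show ?thesis .
qed

lemma negq_phi_rescale_phi:
  assumes "odd c"
  shows "negq (phi * rescale c phi) = Ev c - Od c"
proof -
  have "c > 0" using assms by (rule odd_pos)
  have "negq (Ev c) = Ev c"
    unfolding Ev_def negq_gser using assms
    by (intro gser_cong) (auto simp: power_add power_mult minus_one_power_square)
  moreover have "negq (Od c) = - Od c"
    unfolding Od_def negq_gser gser_uminus[symmetric] using assms
    by (intro gser_cong) (auto simp: power_add power_mult minus_one_power_square)
  ultimately show ?thesis by (simp add: phi_rescale_phi[OF \<open>c > 0\<close>])
qed

lemma gser_square:
  assumes "finfib S e"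
  shows "(gser S e (\<lambda>_. 1))\<^sup>2 = gser (S \<times> S) (\<lambda>(i, j). e i + e j) (\<lambda>_. 1)"
  unfolding power2_eq_square by (subst gser_mult[OF assms assms]) (auto intro: gser_cong)

text \<open>Pairs of equal parity are (u + v, u - v), and their squares add up to 2 u^2 + 2
  v^2.\<close>

lemma Ev_1: "Ev 1 = (rescale 2 phi)\<^sup>2"
proof -
  have "(rescale 2 phi)\<^sup>2 = gser (UNIV \<times> UNIV)
      (\<lambda>(x::int, y::int). 2 * nat (x\<^sup>2) + 2 * nat (y\<^sup>2)) (\<lambda>_. 1)"
    unfolding phi_def
    by (subst rescale_gser, simp, subst gser_square) (auto intro!: finfib_mult finfib_square)
  also have "\<dots> = Ev 1"
    unfolding Ev_def
  proof (rule gser_reindex)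
    show "bij_betw (\<lambda>(u, v). (u + v, u - v)) (UNIV \<times> UNIV) {(x::int, y::int). even (x + y)}"
      by (rule bij_betw_byWitness[where f' = "\<lambda>(x, y). ((x + y) div 2, (x - y) div 2)"], auto, presburger+)
    fix i :: "int \<times> int"
    obtain u v where i: "i = (u, v)" by fastforce
    have "int (2 * nat (u\<^sup>2) + 2 * nat (v\<^sup>2)) = int (nat ((u + v)\<^sup>2) + 1 * nat ((u - v)\<^sup>2))"
      by (simp, simp add: power2_eq_square algebra_simps)
    then show "(case i of (x, y) \<Rightarrow> 2 * nat (x\<^sup>2) + 2 * nat (y\<^sup>2)) =
      (case case i of (u, v) \<Rightarrow> (u + v, u - v) of (x, y) \<Rightarrow> nat (x\<^sup>2) + 1 * nat (y\<^sup>2))"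
      unfolding i by (simp only: of_nat_eq_iff prod.case)
  qed auto
  finally show ?thesis ..
qed

text \<open>Pairs of opposite parity are (u + v + 1, u - v), and the sum of the squares is 1 + 2 u
  (u + 1) + 2 v (v + 1).\<close>

lemma Od_1: "Od 1 = fps_X * (rescale 4 Psi)\<^sup>2"
proof -
  let ?e = "\<lambda>(u::int, v::int). 1 + (4 * nat (u * (u + 1) div 2) + 4 * nat (v * (v + 1) div 2))"
  have "fps_X * (rescale 4 Psi)\<^sup>2 = gser (UNIV \<times> UNIV) ?e (\<lambda>_. 1)"
    unfolding Psi_def
    by (subst rescale_gser, simp, subst gser_square)
       (auto simp: X_power_gser[where k = 1, simplified] intro!: finfib_mult finfib_triangle gser_cong)
  also have "\<dots> = Od 1"
    unfolding Od_def
  proof (rule gser_reindex)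
    show "bij_betw (\<lambda>(u, v). (u + v + 1, u - v)) (UNIV \<times> UNIV) {(x::int, y::int). odd (x + y)}"
      by (rule bij_betw_byWitness[where f' = "\<lambda>(x, y). ((x + y - 1) div 2, (x - y - 1) div 2)"], auto, presburger+)
    fix i :: "int \<times> int"
    obtain u v where i: "i = (u, v)" by fastforce
    have "4 * nat (u * (u + 1) div 2) = 2 * nat (u * (u + 1))"
      "4 * nat (v * (v + 1) div 2) = 2 * nat (v * (v + 1))"
      using two_mult_triangle[of u] two_mult_triangle[of v] by simp_all
    moreover have "int (1 + (2 * nat (u * (u + 1)) + 2 * nat (v * (v + 1))))
        = int (nat ((u + v + 1)\<^sup>2) + 1 * nat ((u - v)\<^sup>2))"
      using triangle_nonneg[of u] triangle_nonneg[of v]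
      by (simp, simp add: power2_eq_square algebra_simps)
    ultimately show "?e i =
      (case case i of (u, v) \<Rightarrow> (u + v + 1, u - v) of (x, y) \<Rightarrow> nat (x\<^sup>2) + 1 * nat (y\<^sup>2))"
      unfolding i by (simp only: of_nat_eq_iff prod.case)
  qed auto
  finally show ?thesis ..
qed

text \<open>With x = v + 2 u and y = v one has x^2 + 3 y^2 = 4 (u^2 + u v + v^2).\<close>

lemma Ev_3: "Ev 3 = rescale 4 hex"
proof -
  have "rescale 4 hex = gser UNIV
      (\<lambda>(x::int, y::int). 4 * nat (x\<^sup>2 + x * y + y\<^sup>2)) (\<lambda>_. 1)"
    unfolding hex_def by (subst rescale_gser) (auto intro: gser_cong)
  also have "\<dots> = Ev 3"
    unfolding Ev_def
  proof (rule gser_reindex)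
    show "bij_betw (\<lambda>(u, v). (v + 2 * u, v)) UNIV {(x::int, y::int). even (x + y)}"
      by (rule bij_betw_byWitness[where f' = "\<lambda>(x, y). ((x - y) div 2, y)"]) auto
    fix i :: "int \<times> int"
    obtain u v where i: "i = (u, v)" by fastforce
    have "int (4 * nat (u\<^sup>2 + u * v + v\<^sup>2)) = int (nat ((v + 2 * u)\<^sup>2) + 3 * nat (v\<^sup>2))"
      using hex_nonneg[of u v] by (simp, simp add: power2_eq_square algebra_simps)
    then show "(case i of (x, y) \<Rightarrow> 4 * nat (x\<^sup>2 + x * y + y\<^sup>2)) =
      (case case i of (u, v) \<Rightarrow> (v + 2 * u, v) of (x, y) \<Rightarrow> nat (x\<^sup>2) + 3 * nat (y\<^sup>2))"
      unfolding i by (simp only: of_nat_eq_iff prod.case)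
  qed auto
  finally show ?thesis ..
qed

abbreviation hexn :: "int \<times> int \<Rightarrow> nat" where
  "hexn \<equiv> \<lambda>(x, y). nat (x\<^sup>2 + x * y + y\<^sup>2)"

text \<open>Completing the square, x^2 + x y + y^2 = (x + y/2)^2 + 3 (y/2)^2. Even y leaves integers
  and hence squares; odd y leaves half-integers, which give the triangular exponents of
  \<open>hex_odd_y\<close>.\<close>

lemma hex_even_y: "gser {(x, y). even y} hexn (\<lambda>_. 1) = phi * rescale 3 phi"
proof -
  let ?e = "\<lambda>(x::int, y::int). nat (x\<^sup>2) + 3 * nat (y\<^sup>2)"
  have "phi * rescale 3 phi = gser (UNIV \<times> UNIV) ?e (\<lambda>_. 1)"
    unfolding phi_def
    by (subst rescale_gser, simp, subst gser_mult)
       (auto intro!: finfib_mult finfib_square gser_cong)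
  also have "\<dots> = gser {(x, y). even y} hexn (\<lambda>_. 1)"
  proof (rule gser_reindex)
    show "bij_betw (\<lambda>(u, v). (u - v, 2 * v)) (UNIV \<times> UNIV) {(x::int, y::int). even y}"
      by (rule bij_betw_byWitness[where f' = "\<lambda>(x, y). (x + y div 2, y div 2)"])
         (auto elim!: evenE)
    fix i :: "int \<times> int"
    obtain u v where i: "i = (u, v)" by fastforce
    have "int (nat (u\<^sup>2) + 3 * nat (v\<^sup>2)) = int (nat ((u - v)\<^sup>2 + (u - v) * (2 * v) + (2 * v)\<^sup>2))"
      using hex_nonneg[of "u - v" "2 * v"] by (simp add: power2_eq_square algebra_simps)
    then show "?e i = hexn (case i of (u, v) \<Rightarrow> (u - v, 2 * v))"
      unfolding i by (simp only: of_nat_eq_iff prod.case)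
  qed auto
  finally show ?thesis ..
qed

lemma hex_odd_y: "gser {(x, y). odd y} hexn (\<lambda>_. 1) = fps_X * rescale 2 Psi * rescale 6 Psi"
proof -
  let ?e = "\<lambda>(u::int, v::int). 1 + (2 * nat (u * (u + 1) div 2) + 6 * nat (v * (v + 1) div 2))"
  have "rescale 2 Psi * rescale 6 Psi = gser (UNIV \<times> UNIV)
      (\<lambda>(u, v). 2 * nat (u * (u + 1) div 2) + 6 * nat (v * (v + 1) div 2)) (\<lambda>_. 1)"
    unfolding Psi_def
    by (subst (1 2) rescale_gser, simp, simp, subst gser_mult)
       (auto intro!: finfib_mult finfib_triangle gser_cong)
  then have "fps_X * rescale 2 Psi * rescale 6 Psi = gser (UNIV \<times> UNIV) ?e (\<lambda>_. 1)"
    by (auto simp: mult.assoc X_power_gser[where k = 1, simplified] intro!: gser_cong)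
  also have "\<dots> = gser {(x, y). odd y} hexn (\<lambda>_. 1)"
  proof (rule gser_reindex)
    show "bij_betw (\<lambda>(u, v). (u - v, 2 * v + 1)) (UNIV \<times> UNIV) {(x::int, y::int). odd y}"
      by (rule bij_betw_byWitness[where f' = "\<lambda>(x, y). (x + y div 2, y div 2)"])
         (auto elim!: oddE)
    fix i :: "int \<times> int"
    obtain u v where i: "i = (u, v)" by fastforce
    have "2 * nat (u * (u + 1) div 2) = nat (u * (u + 1))"
      "6 * nat (v * (v + 1) div 2) = 3 * nat (v * (v + 1))"
      using two_mult_triangle[of u] two_mult_triangle[of v] by simp_all
    moreover have "int (1 + (nat (u * (u + 1)) + 3 * nat (v * (v + 1))))
        = int (nat ((u - v)\<^sup>2 + (u - v) * (2 * v + 1) + (2 * v + 1)\<^sup>2))"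
      using triangle_nonneg[of u] triangle_nonneg[of v] hex_nonneg[of "u - v" "2 * v + 1"]
      by (simp add: power2_eq_square algebra_simps)
    ultimately show "?e i = hexn (case i of (u, v) \<Rightarrow> (u - v, 2 * v + 1))"
      unfolding i by (simp only: of_nat_eq_iff prod.case)
  qed auto
  finally show ?thesis ..
qed

lemma finfib_hex_subset: "finfib S hexn"
  by (rule finfib_subset[OF finfib_hex]) simp

lemma hex_split: "hex = gser {(x, y). even y} hexn (\<lambda>_. 1) + gser {(x, y). odd y} hexn (\<lambda>_. 1)"
proof -
  have "UNIV = {(x::int, y::int). even y} \<union> {(x, y). odd y}" by auto
  then have "hex = gser ({(x, y). even y} \<union> {(x, y). odd y}) hexn (\<lambda>_. 1)"
    unfolding hex_def by simp
  also have "\<dots> = gser {(x, y). even y} hexn (\<lambda>_. 1) + gser {(x, y). odd y} hexn (\<lambda>_. 1)"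
    by (rule gser_Un) (auto intro: finfib_hex_subset)
  finally show ?thesis .
qed

lemma hex_eq: "hex = phi * rescale 3 phi + fps_X * rescale 2 Psi * rescale 6 Psi"
  unfolding hex_split hex_even_y hex_odd_y ..

text \<open>The three nonzero classes modulo 2 of the hexagonal lattice are permuted by its
  rotations, so they have the same generating series.\<close>

lemma Psi_Psi_eq: "fps_X * rescale 2 Psi * rescale 6 Psi = 2 * Od 3"
proof -
  let ?M = "gser {(x::int, y::int). odd x \<and> even y} hexn (\<lambda>_. 1)"
  have ev: "gser {(x, y). even y} hexn (\<lambda>_. 1)
      = gser {(x, y). even x \<and> even y} hexn (\<lambda>_. 1) + ?M"
    by (subst gser_Un[symmetric])
       (auto intro: finfib_hex_subset intro!: arg_cong[where f = "\<lambda>S. gser S _ _"])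
  have "gser {(x::int, y::int). even x \<and> even y} hexn (\<lambda>_. 1) = rescale 4 hex"
    unfolding hex_def rescale_gser[of 4, simplified]
  proof (rule gser_reindex)
    show "bij_betw (\<lambda>(x, y). (x div 2, y div 2)) {(x::int, y::int). even x \<and> even y} UNIV"
      by (rule bij_betw_byWitness[where f' = "\<lambda>(x, y). (2 * x, 2 * y)"]) auto
    show "hexn i = 4 * hexn (case i of (x, y) \<Rightarrow> (x div 2, y div 2))"
      if "i \<in> {(x, y). even x \<and> even y}" for i
    proof -
      have "i = (2 * (fst i div 2), 2 * (snd i div 2))"
        using that by (auto split: prod.splits)
      then obtain u v where i: "i = (2 * u, 2 * v)" by blast
      have "int (nat ((2 * u)\<^sup>2 + 2 * u * (2 * v) + (2 * v)\<^sup>2)) = int (4 * nat (u\<^sup>2 + u * v + v\<^sup>2))"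
        using hex_nonneg[of u v] hex_nonneg[of "2 * u" "2 * v"]
        by (simp add: power2_eq_square algebra_simps)
      then show ?thesis unfolding i of_nat_eq_iff by simp
    qed
  qed auto
  \<comment> \<open>The sublattice of even y and the product phi(q) phi(q^3) have the same series,
    and each contains \<open>rescale 4 hex\<close>: once as the class (0, 0) modulo 2, once as
    \<open>Ev 3\<close>. Cancelling it identifies the class (1, 0) with \<open>Od 3\<close>.\<close>
  then have M: "?M = Od 3"
    using ev hex_even_y phi_rescale_phi[of 3] Ev_3 by simp
  have "gser {(x, y). odd y} hexn (\<lambda>_. 1)
      = gser {(x::int, y::int). even x \<and> odd y} hexn (\<lambda>_. 1)
        + gser {(x::int, y::int). odd x \<and> odd y} hexn (\<lambda>_. 1)"
    by (subst gser_Un[symmetric])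
       (auto intro: finfib_hex_subset intro!: arg_cong[where f = "\<lambda>S. gser S _ _"])
  also have "gser {(x::int, y::int). even x \<and> odd y} hexn (\<lambda>_. 1) = ?M"
    by (rule gser_reindex[where h = "\<lambda>(x, y). (y, x)"],
        rule bij_betw_byWitness[where f' = "\<lambda>(x, y). (y, x)"]) (auto simp: algebra_simps)
  also have "gser {(x::int, y::int). odd x \<and> odd y} hexn (\<lambda>_. 1) = ?M"
    by (rule gser_reindex[where h = "\<lambda>(x, y). (x, - x - y)"],
        rule bij_betw_byWitness[where f' = "\<lambda>(x, y). (x, - x - y)"])
       (auto simp: power2_eq_square algebra_simps)
  finally show ?thesis unfolding hex_odd_y M by simp
qed

lemma fps_eq_uminus_self:
  fixes f :: "rat fps"
  assumes "f = - f"
  shows "f = 0"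
proof (rule fps_ext)
  fix n
  have "fps_nth f n = - fps_nth f n"
    by (subst assms) simp
  then show "fps_nth f n = fps_nth 0 n" by simp
qed

text \<open>The product sums (-1)^y q^(x^2 + y^2). Exchanging x and y negates the terms with x + y
  odd, which therefore cancel; on the rest (x, y) = (u + v, u - v) makes the sign (-1)^u
  (-1)^v.\<close>

lemma phi_negq_phi: "phi * negq phi = (rescale 2 (negq phi))\<^sup>2"
proof -
  let ?w = "\<lambda>x::int. if even x then 1 else - 1 :: rat"
  let ?e = "\<lambda>(x::int, y::int). nat (x\<^sup>2) + nat (y\<^sup>2)"
  let ?G = "\<lambda>S. gser S ?e (\<lambda>(x, y). ?w y)"
  have n: "negq phi = gser UNIV (\<lambda>x::int. nat (x\<^sup>2)) ?w"
    unfolding phi_def negq_gser by (auto intro!: gser_cong simp: minus_one_power_square)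
  have f: "finfib (UNIV \<times> UNIV) ?e"
    by (rule finfib_Times[OF finfib_square finfib_square])
  have "phi * negq phi = ?G (UNIV \<times> UNIV)"
    unfolding n unfolding phi_def
    by (subst gser_mult[OF finfib_square finfib_square]) (auto intro: gser_cong)
  also have "UNIV \<times> UNIV = {(x::int, y::int). even (x + y)} \<union> {(x, y). odd (x + y)}"
    by auto
  also have "?G \<dots> = ?G {(x, y). even (x + y)} + ?G {(x, y). odd (x + y)}"
    by (rule gser_Un) (auto intro: finfib_subset[OF f])
  also have "?G {(x, y). odd (x + y)} = 0"
  proof -
    have "?G {(x, y). odd (x + y)} = gser {(x, y). odd (x + y)} ?e (\<lambda>i. - (case i of (x, y) \<Rightarrow> ?w y))"
      by (rule gser_reindex[where h = "\<lambda>(x, y). (y, x)"],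
          rule bij_betw_byWitness[where f' = "\<lambda>(x, y). (y, x)"]) auto
    then show ?thesis
      unfolding gser_uminus by (rule fps_eq_uminus_self)
  qed
  also have "?G {(x, y). even (x + y)} = (rescale 2 (negq phi))\<^sup>2"
  proof -
    have "(rescale 2 (negq phi))\<^sup>2 = gser (UNIV \<times> UNIV)
        (\<lambda>(x::int, y::int). 2 * nat (x\<^sup>2) + 2 * nat (y\<^sup>2)) (\<lambda>(x, y). ?w x * ?w y)"
      unfolding n rescale_gser[of 2, simplified]
      by (subst power2_eq_square, rule gser_mult) (rule finfib_mult[OF finfib_square], simp)+
    also have "\<dots> = ?G {(x, y). even (x + y)}"
    proof (rule gser_reindex)
      show "bij_betw (\<lambda>(u, v). (u + v, u - v)) (UNIV \<times> UNIV) {(x::int, y::int). even (x + y)}"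
        by (rule bij_betw_byWitness[where f' = "\<lambda>(x, y). ((x + y) div 2, (x - y) div 2)"], auto, presburger+)
      fix i :: "int \<times> int"
      obtain u v where i: "i = (u, v)" by fastforce
      have "int (2 * nat (u\<^sup>2) + 2 * nat (v\<^sup>2)) = int (nat ((u + v)\<^sup>2) + nat ((u - v)\<^sup>2))"
        by (simp, simp add: power2_eq_square algebra_simps)
      then show "(case i of (x, y) \<Rightarrow> 2 * nat (x\<^sup>2) + 2 * nat (y\<^sup>2)) =
          ?e (case i of (u, v) \<Rightarrow> (u + v, u - v))"
        unfolding i by (simp only: of_nat_eq_iff prod.case)
    qed auto
    finally show ?thesis ..
  qed
  finally show ?thesis by simp
qed

section \<open>Euler products and the Gauss identities\<close>

text \<open>Congruence modulo q^M, the substitute for convergence: an infinite product is replaced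
  by a finite one that agrees with it far enough.\<close>

definition ceq :: "nat \<Rightarrow> rat fps \<Rightarrow> rat fps \<Rightarrow> bool" where
  "ceq M f g \<longleftrightarrow> (\<forall>i<M. fps_nth f i = fps_nth g i)"

lemma ceq_refl [simp]: "ceq M f f"
  by (simp add: ceq_def)

lemma ceq_sym: "ceq M f g \<Longrightarrow> ceq M g f"
  by (simp add: ceq_def)

lemma ceq_trans [trans]: "ceq M f g \<Longrightarrow> ceq M g h \<Longrightarrow> ceq M f h"
  by (simp add: ceq_def)

lemma ceq_mult: "ceq M f g \<Longrightarrow> ceq M f' g' \<Longrightarrow> ceq M (f * f') (g * g')"
  by (auto simp: ceq_def fps_mult_nth intro!: sum.cong)

lemma ceq_sum: "(\<And>i. i \<in> S \<Longrightarrow> ceq M (f i) (g i)) \<Longrightarrow> ceq M (sum f S) (sum g S)"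
  by (auto simp: ceq_def fps_sum_nth intro!: sum.cong)

lemma ceq_cancel:
  assumes "ceq M (f * u) (g * u)" "fps_nth u 0 \<noteq> 0"
  shows "ceq M f g"
proof -
  have "ceq M (f * u * inverse u) (g * u * inverse u)"
    by (rule ceq_mult[OF assms(1) ceq_refl])
  then show ?thesis
    using assms(2) by (simp add: mult.assoc inverse_mult_eq_1')
qed

lemma ceq_X_power: "M \<le> k \<Longrightarrow> ceq M (fps_X ^ k * f) (fps_X ^ k * g)"
  by (simp add: ceq_def fps_X_power_mult_nth)

lemma ceq_all_eq: "(\<And>M. ceq M f g) \<Longrightarrow> f = g"
  by (rule fps_ext) (auto simp: ceq_def)

text \<open>The q-Pochhammer symbol (q; q)_n, over an arbitrary ring so that powers of the variable
  can be put for q.\<close>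

definition qfac :: "'a::comm_ring_1 \<Rightarrow> nat \<Rightarrow> 'a" where
  "qfac q n = (\<Prod>i=1..n. 1 - q ^ i)"

lemma qfac_0 [simp]: "qfac q 0 = 1"
  and qfac_Suc: "qfac q (Suc n) = qfac q n * (1 - q ^ Suc n)"
  by (simp_all add: qfac_def)

lemma ceq_qfac:
  assumes "k > 0" "m \<le> n"
  shows "ceq (Suc m) (qfac (fps_X ^ k) n) (qfac (fps_X ^ k) m)"
  using assms(2)
proof (induction n rule: dec_induct)
  case base
  show ?case by simp
next
  case (step n)
  have "m < k * Suc n" using step.hyps assms(1) by (cases k) auto
  then have "fps_nth (qfac (fps_X ^ k) (Suc n)) i = fps_nth (qfac (fps_X ^ k) n) i" if "i < Suc m" for i
    using that by (simp only: qfac_Suc power_mult[symmetric] right_diff_distrib)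
      (simp add: fps_X_power_mult_right_nth del: mult_Suc_right)
  with step.IH show ?case unfolding ceq_def by metis
qed

lemma ceq_euler:
  assumes "k > 0" "M \<le> Suc n"
  shows "ceq M (euler_prod k) (qfac (fps_X ^ k) n)"
  unfolding ceq_def
proof (intro allI impI)
  fix i assume "i < M"
  have "fps_nth (euler_prod k) i = fps_nth (qfac (fps_X ^ k) i) i"
    by (simp add: euler_prod_def qfac_def power_mult)
  also have "\<dots> = fps_nth (qfac (fps_X ^ k) n) i"
    using ceq_qfac[OF assms(1), of i n] \<open>i < M\<close> assms(2) by (simp add: ceq_def)
  finally show "fps_nth (euler_prod k) i = fps_nth (qfac (fps_X ^ k) n) i" .
qed

lemma euler_nth_0 [simp]: "fps_nth (euler_prod k) 0 = 1"
  by (simp add: euler_prod_def)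

lemma euler_rescale:
  assumes "k > 0"
  shows "euler_prod k = rescale k (euler_prod 1)"
proof (rule ceq_all_eq)
  fix M :: nat
  have r: "rescale k (qfac fps_X n) = qfac (fps_X ^ k) n" for n
    by (induction n) (simp_all add: qfac_Suc rescale_hom assms power_mult)
  have "ceq M (euler_prod 1) (qfac fps_X M)"
    using ceq_euler[of 1 M M] by simp
  then have "ceq M (rescale k (euler_prod 1)) (rescale k (qfac fps_X M))"
    using assms by (auto simp: ceq_def rescale_nth div_less_dividend intro: le_less_trans[OF div_le_dividend])
  then show "ceq M (euler_prod k) (rescale k (euler_prod 1))"
    unfolding r using ceq_trans[OF ceq_euler[OF assms, of M M]] by (simp add: ceq_sym)
qed

text \<open>Gaussian binomial coefficients, defined by the Pascal rule to avoid division;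
  \<open>qbin_qfac\<close> is their quotient formula with denominators cleared.\<close>

fun qbin :: "'a::comm_ring_1 \<Rightarrow> nat \<Rightarrow> nat \<Rightarrow> 'a" where
  "qbin q n 0 = 1"
| "qbin q 0 (Suc k) = 0"
| "qbin q (Suc n) (Suc k) = qbin q n k + q ^ Suc k * qbin q n (Suc k)"

lemma qbin_eq_0: "n < k \<Longrightarrow> qbin q n k = 0"
  by (induction q n k rule: qbin.induct) auto

lemma qbin_qfac: "k \<le> n \<Longrightarrow> qbin q n k * qfac q k * qfac q (n - k) = qfac q n"
proof (induction q n k rule: qbin.induct)
  case (3 q n k)
  show ?case
  proof (cases "k = n")
    case True
    then show ?thesis using 3 by (simp add: qbin_eq_0 qfac_Suc flip: mult.assoc)
  next
    case False
    then have le: "Suc k \<le> n" using 3 by simp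
    have nk: "n - k = Suc (n - Suc k)" using le by simp
    have "qbin q (Suc n) (Suc k) * qfac q (Suc k) * qfac q (Suc n - Suc k)
      = (1 - q ^ Suc k) * (qbin q n k * qfac q k * qfac q (n - k))
        + q ^ Suc k * (1 - q ^ (n - k)) * (qbin q n (Suc k) * qfac q (Suc k) * qfac q (n - Suc k))"
      by (simp add: nk qfac_Suc algebra_simps)
    also have "\<dots> = (1 - q ^ Suc k) * qfac q n + q ^ Suc k * (1 - q ^ (n - k)) * qfac q n"
      using 3 le by (simp del: power_Suc)
    also have "\<dots> = qfac q n * (1 - q ^ Suc k * q ^ (n - k))"
      by (simp add: algebra_simps)
    also have "q ^ Suc k * q ^ (n - k) = q ^ Suc n"
      using le by (simp del: power_Suc flip: power_add)
    finally show ?thesis by (simp add: qfac_Suc)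
  qed
qed auto

text \<open>Rothe's q-binomial theorem in homogeneous form. With y a power of q it yields the finite
  triple product, whose usual form has negative exponents and makes no sense for power series. The
  induction splits off the factor i = 0 and replaces x by x q.\<close>

lemma q_binomial:
  fixes x y q :: "'a::comm_ring_1"
  shows "(\<Prod>i<n. y + x * q ^ i) = (\<Sum>k\<le>n. q ^ (k choose 2) * qbin q n k * x ^ k * y ^ (n - k))"
proof (induction n arbitrary: x)
  case (Suc n)
  let ?T = "\<lambda>k. q ^ ((k choose 2) + k) * qbin q n k * x ^ k"
  have c: "Suc k choose 2 = (k choose 2) + k" for k
    by (simp add: numeral_2_eq_2)
  have "(\<Prod>i<Suc n. y + x * q ^ i) = (y + x) * (\<Prod>i<n. y + (x * q) * q ^ i)"
    by (subst prod.lessThan_Suc_shift) (simp add: mult.assoc)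
  also have "\<dots> = y * (\<Sum>k\<le>n. ?T k * y ^ (n - k)) + x * (\<Sum>k\<le>n. ?T k * y ^ (n - k))"
    unfolding Suc.IH by (simp add: algebra_simps power_add power_mult_distrib)
  also have "y * (\<Sum>k\<le>n. ?T k * y ^ (n - k)) = (\<Sum>k\<le>n. ?T k * y ^ (Suc n - k))"
    unfolding sum_distrib_left by (intro sum.cong refl) (simp add: Suc_diff_le algebra_simps)
  also have "\<dots> = (\<Sum>k\<le>Suc n. ?T k * y ^ (Suc n - k))"
    by (simp add: qbin_eq_0)
  also have "\<dots> = y ^ Suc n + (\<Sum>k\<le>n. ?T (Suc k) * y ^ (n - k))"
    by (subst sum.atMost_Suc_shift) (simp add: binomial_eq_0)
  also have "\<dots> + x * (\<Sum>k\<le>n. ?T k * y ^ (n - k))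
      = y ^ Suc n + (\<Sum>k\<le>n. q ^ (Suc k choose 2) * qbin q (Suc n) (Suc k) * x ^ Suc k * y ^ (n - k))"
    unfolding sum_distrib_left add.assoc sum.distrib[symmetric]
    by (intro arg_cong2[where f = plus] sum.cong refl) (simp add: c power_add algebra_simps)
  also have "\<dots> = (\<Sum>k\<le>Suc n. q ^ (k choose 2) * qbin q (Suc n) k * x ^ k * y ^ (Suc n - k))"
    by (subst sum.atMost_Suc_shift) (simp add: binomial_eq_0)
  finally show ?case .
qed (simp add: binomial_eq_0)

section \<open>From the finite triple product to theta series\<close>

lemma gser_finite:
  assumes "finite S"
  shows "gser S e w = (\<Sum>i\<in>S. fps_const (w i) * fps_X ^ e i)"
proof (rule fps_ext)
  fix n
  have "(\<Sum>i\<in>S. fps_nth (fps_const (w i) * fps_X ^ e i) n) = (\<Sum>i\<in>S. if e i = n then w i else 0)"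
    by (intro sum.cong refl) auto
  then show "fps_nth (gser S e w) n = fps_nth (\<Sum>i\<in>S. fps_const (w i) * fps_X ^ e i) n"
    using assms by (simp add: gser_nth fib_def fps_sum_nth sum.inter_filter)
qed

text \<open>As k and n - k grow, (q; q)_n / ((q; q)_k (q; q)_(n-k)) tends to the inverse of the
  infinite product. A further factor \<open>euler_prod c\<close> on both sides clears the
  denominators.\<close>

lemma ceq_qbin:
  assumes "c > 0" "k \<le> n" "M \<le> Suc k" "M \<le> Suc (n - k)"
  shows "ceq M (euler_prod c * qbin (fps_X ^ c) n k) 1"
proof (rule ceq_cancel)
  let ?P = "euler_prod c" and ?q = "fps_X ^ c :: rat fps"
  have "ceq M (?P * qbin ?q n k * ?P) (qbin ?q n k * qfac ?q k * qfac ?q (n - k))"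
    using ceq_mult[OF ceq_mult[OF ceq_refl[of M "qbin ?q n k"] ceq_euler[OF assms(1,3)]]
        ceq_euler[OF assms(1,4)]] by (simp add: mult_ac)
  also have "\<dots> = qfac ?q n" by (rule qbin_qfac[OF assms(2)])
  also have "ceq M (qfac ?q n) (1 * ?P)"
    using ceq_euler[of c M n] assms by (simp add: ceq_sym)
  finally show "ceq M (?P * qbin ?q n k * ?P) (1 * ?P)" .
qed simp

text \<open>Summand k stands for the lattice point x = n - k. Either \<open>E x\<close> is at least
  M and the summand vanishes modulo q^M, or |x| is at most M; then n \<ge> 2 M leaves both k and 2 n
  - k at least M, and the Gaussian binomial has reached its limit.\<close>

lemma theta_limit:
  fixes E :: "int \<Rightarrow> nat" and w :: "int \<Rightarrow> rat"
  assumes c: "c > 0" and E: "\<And>x. \<bar>x\<bar> \<le> int (E x) + 1" and n: "2 * M \<le> n"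
  shows "ceq M (euler_prod c *
    (\<Sum>k\<le>2 * n. fps_const (w (int n - int k)) * fps_X ^ E (int n - int k) * qbin (fps_X ^ c) (2 * n) k))
    (gser UNIV E w)"
proof -
  let ?q = "fps_X ^ c :: rat fps"
  have summand: "ceq M (euler_prod c * (fps_const (w (int n - int k)) * fps_X ^ E (int n - int k) * qbin ?q (2 * n) k))
    (fps_const (w (int n - int k)) * fps_X ^ E (int n - int k))" if "k \<le> 2 * n" for k
  proof (cases "M \<le> E (int n - int k)")
    case True
    show ?thesis
      using ceq_X_power[OF True, of "fps_const (w (int n - int k)) * (euler_prod c * qbin ?q (2 * n) k)"
          "fps_const (w (int n - int k))"] by (simp add: mult_ac)
  next
    case False
    have "\<bar>int n - int k\<bar> \<le> int M" using E[of "int n - int k"] False by linarith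
    then have "M \<le> Suc k" "M \<le> Suc (2 * n - k)" using n that by linarith+
    from ceq_mult[OF ceq_refl[of M "fps_const (w (int n - int k)) * fps_X ^ E (int n - int k)"]
        ceq_qbin[OF c that this]]
    show ?thesis by (simp only: mult_ac mult_1_right mult_1_left)
  qed
  have "ceq M (euler_prod c *
    (\<Sum>k\<le>2 * n. fps_const (w (int n - int k)) * fps_X ^ E (int n - int k) * qbin ?q (2 * n) k))
    (\<Sum>k\<le>2 * n. fps_const (w (int n - int k)) * fps_X ^ E (int n - int k))"
    unfolding sum_distrib_left using summand by (intro ceq_sum) simp
  also have "(\<Sum>k\<le>2 * n. fps_const (w (int n - int k)) * fps_X ^ E (int n - int k))
      = gser {..2 * n} (\<lambda>k. E (int n - int k)) (\<lambda>k. w (int n - int k))"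
    by (simp add: gser_finite)
  also have "\<dots> = gser {- int n..int n} E w"
    by (rule gser_reindex[where h = "\<lambda>k. int n - int k"],
        rule bij_betw_byWitness[where f' = "\<lambda>x. nat (int n - x)"]) auto
  also have "ceq M \<dots> (gser UNIV E w)"
    unfolding ceq_def gser_nth
  proof (intro allI impI)
    fix i assume i: "i < M"
    have "x \<in> {- int n..int n}" if "E x = i" for x
      using E[of x] that i n by auto
    then have "fib {- int n..int n} E i = fib UNIV E i"
      by (auto simp: fib_def)
    then show "sum w (fib {- int n..int n} E i) = sum w (fib UNIV E i)" by simp
  qed
  finally show ?thesis .
qed

lemma choose_two_int: "2 * int (k choose 2) = int k * (int k - 1)"
  by (induction k) (simp_all add: numeral_2_eq_2 algebra_simps)

lemma prod_X_power: "(\<Prod>i<n. fps_X ^ i :: rat fps) = fps_X ^ (n choose 2)"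
  by (induction n) (simp_all add: numeral_2_eq_2 power_add)

lemma prod_lessThan_double:
  fixes f :: "nat \<Rightarrow> 'a::comm_monoid_mult"
  shows "(\<Prod>i<2 * n. f i) = (\<Prod>i<n. f i) * (\<Prod>i<n. f (n + i))"
proof -
  have "(\<Prod>i<n + m. f i) = (\<Prod>i<n. f i) * (\<Prod>i<m. f (n + i))" for m
    by (induction m) (simp_all add: mult.assoc)
  then show ?thesis by (simp add: mult_2)
qed

text \<open>The q-binomial theorem at base q^2 with x = -1 and y = q^(2n-1). Both halves of the 2n
  factors reduce to the same product over odd exponents, and k (k - 1) + (2n - 1)(2n - k) differs
  from (n - k)^2 by a number independent of k, so that a fixed power of q cancels.\<close>

lemma phi_finite:
  "(\<Sum>k\<le>2 * n. (- 1) ^ k * fps_X ^ nat ((int n - int k)\<^sup>2) * qbin (fps_X ^ 2) (2 * n) k)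
     = (- 1) ^ n * (\<Prod>j<n. 1 - fps_X ^ (2 * j + 1) :: rat fps)\<^sup>2"
\<comment> \<open>The exponent \<open>2 * n - 1\<close> would be truncated at n = 0.\<close>
proof (cases "n = 0")
  case False
  let ?m = "2 * n - 1" and ?Q = "\<Prod>j<n. 1 - fps_X ^ (2 * j + 1) :: rat fps"
  have m: "2 * n = Suc ?m" using False by simp
  let ?e = "2 * (n choose 2) + n * ?m"
  have "(\<Prod>i<2 * n. fps_X ^ ?m + (- 1) * (fps_X ^ 2) ^ i :: rat fps)
      = (\<Prod>i<n. fps_X ^ ?m - fps_X ^ (2 * i)) * (\<Prod>i<n. fps_X ^ ?m - fps_X ^ (2 * (n + i)))"
    by (simp add: prod_lessThan_double flip: power_mult)
  also have "(\<Prod>i<n. fps_X ^ ?m - fps_X ^ (2 * i) :: rat fps)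
      = (\<Prod>i<n. - ((fps_X ^ i)\<^sup>2 * (1 - fps_X ^ (2 * (n - Suc i) + 1))))"
  proof (intro prod.cong refl)
    fix i assume "i \<in> {..<n}"
    then have "?m = i * 2 + (2 * (n - Suc i) + 1)" by auto
    then have "fps_X ^ ?m = (fps_X ^ i)\<^sup>2 * (fps_X ^ (2 * (n - Suc i) + 1) :: rat fps)"
      by (simp only: power_add power_mult)
    then show "fps_X ^ ?m - fps_X ^ (2 * i)
        = - ((fps_X ^ i)\<^sup>2 * (1 - fps_X ^ (2 * (n - Suc i) + 1) :: rat fps))"
      by (simp only: right_diff_distrib mult_1_right minus_diff_eq power_mult[symmetric] mult.commute[of 2 i])
  qed
  also have "\<dots> = (- 1) ^ n * fps_X ^ (2 * (n choose 2)) * ?Q"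
  proof -
    have "(\<Prod>i<n. (fps_X ^ i)\<^sup>2 :: rat fps) = fps_X ^ (2 * (n choose 2))"
      unfolding prod_power_distrib[symmetric] prod_X_power
      by (simp only: power_mult[symmetric] mult.commute)
    then show ?thesis
      unfolding prod_uminus prod.distrib prod.nat_diff_reindex[of "\<lambda>j. 1 - fps_X ^ (2 * j + 1)"]
      by simp
  qed
  also have "(\<Prod>i<n. fps_X ^ ?m - fps_X ^ (2 * (n + i)) :: rat fps)
      = (\<Prod>i<n. fps_X ^ ?m * (1 - fps_X ^ (2 * i + 1)))"
  proof (intro prod.cong refl)
    fix i
    have "2 * (n + i) = ?m + (2 * i + 1)" using False by simp
    then have "fps_X ^ (2 * (n + i)) = (fps_X ^ ?m * fps_X ^ (2 * i + 1) :: rat fps)"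
      by (simp only: power_add)
    then show "fps_X ^ ?m - fps_X ^ (2 * (n + i)) = (fps_X ^ ?m * (1 - fps_X ^ (2 * i + 1)) :: rat fps)"
      by (simp only: right_diff_distrib mult_1_right)
  qed
  also have "\<dots> = fps_X ^ (n * ?m) * ?Q"
    by (simp add: prod.distrib power_mult[symmetric] mult.commute)
  finally have L: "(\<Prod>i<2 * n. fps_X ^ ?m + (- 1) * (fps_X ^ 2) ^ i :: rat fps)
      = fps_X ^ ?e * ((- 1) ^ n * ?Q\<^sup>2)"
    by (simp add: power_add power2_eq_square mult_ac)
  have "(fps_X ^ 2) ^ (k choose 2) * qbin (fps_X ^ 2) (2 * n) k * (- 1) ^ k * (fps_X ^ ?m) ^ (2 * n - k)
      = fps_X ^ ?e * ((- 1) ^ k * fps_X ^ nat ((int n - int k)\<^sup>2) * qbin (fps_X ^ 2 :: rat fps) (2 * n) k)"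
    if k: "k \<le> 2 * n" for k
  proof -
    have "int ?m = 2 * int n - 1" "int (2 * n - k) = 2 * int n - int k"
      using k False by auto
    then have "int (2 * (k choose 2) + ?m * (2 * n - k)) = int (?e + nat ((int n - int k)\<^sup>2))"
      using choose_two_int[of k] choose_two_int[of n]
      by (simp only: of_nat_add of_nat_mult int_nat_eq zero_le_power2 if_True)
         (simp add: power2_eq_square algebra_simps)
    then have "(fps_X ^ 2) ^ (k choose 2) * (fps_X ^ ?m) ^ (2 * n - k)
        = fps_X ^ ?e * (fps_X ^ nat ((int n - int k)\<^sup>2) :: rat fps)"
      by (simp only: of_nat_eq_iff power_mult[symmetric] power_add[symmetric])
    then show ?thesis by (simp add: mult_ac)
  qed
  then have R: "(\<Sum>k\<le>2 * n. (fps_X ^ 2) ^ (k choose 2) * qbin (fps_X ^ 2) (2 * n) k * (- 1) ^ k * (fps_X ^ ?m) ^ (2 * n - k))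
     = fps_X ^ ?e * (\<Sum>k\<le>2 * n. (- 1) ^ k * fps_X ^ nat ((int n - int k)\<^sup>2) * qbin (fps_X ^ 2 :: rat fps) (2 * n) k)"
    unfolding sum_distrib_left by (intro sum.cong) simp_all
  show ?thesis
    using q_binomial[of "fps_X ^ ?m" "- 1" "fps_X ^ 2 :: rat fps" "2 * n"]
    unfolding L R by simp
qed simp

text \<open>The choice x = 1, y = q^n turns the exponents into triangular numbers. For n > 0 the
  second product begins with the factor 2: over all integers each triangular number occurs
  twice.\<close>

lemma psi_finite:
  "(\<Sum>k\<le>2 * n. fps_X ^ nat ((int n - int k) * (int n - int k + 1) div 2) * qbin fps_X (2 * n) k)
     = (\<Prod>j<n. 1 + fps_X ^ Suc j) * (\<Prod>j<n. 1 + fps_X ^ j :: rat fps)"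
proof -
  let ?e = "(n choose 2) + n * n"
  have "(\<Prod>i<2 * n. fps_X ^ n + 1 * fps_X ^ i :: rat fps)
      = (\<Prod>i<n. fps_X ^ n + fps_X ^ i) * (\<Prod>i<n. fps_X ^ n + fps_X ^ (n + i))"
    by (simp add: prod_lessThan_double)
  also have "(\<Prod>i<n. fps_X ^ n + fps_X ^ i :: rat fps) = (\<Prod>i<n. fps_X ^ i * (1 + fps_X ^ Suc (n - Suc i)))"
  proof (intro prod.cong refl)
    fix i assume "i \<in> {..<n}"
    then have "n = i + Suc (n - Suc i)" by auto
    then have "fps_X ^ n = fps_X ^ i * (fps_X ^ Suc (n - Suc i) :: rat fps)"
      by (metis power_add)
    then show "fps_X ^ n + fps_X ^ i = fps_X ^ i * (1 + fps_X ^ Suc (n - Suc i) :: rat fps)"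
      by (simp only: distrib_left mult_1_right add.commute)
  qed
  also have "\<dots> = fps_X ^ (n choose 2) * (\<Prod>j<n. 1 + fps_X ^ Suc j)"
    unfolding prod.distrib prod.nat_diff_reindex[of "\<lambda>j. 1 + fps_X ^ Suc j"] prod_X_power ..
  also have "(\<Prod>i<n. fps_X ^ n + fps_X ^ (n + i) :: rat fps) = fps_X ^ (n * n) * (\<Prod>j<n. 1 + fps_X ^ j)"
  proof -
    have "(\<Prod>i<n. fps_X ^ n + fps_X ^ (n + i)) = (\<Prod>i<n. fps_X ^ n * (1 + fps_X ^ i :: rat fps))"
      by (simp only: power_add distrib_left mult_1_right)
    then show ?thesis by (simp add: prod.distrib power_mult)
  qed
  finally have L: "(\<Prod>i<2 * n. fps_X ^ n + 1 * fps_X ^ i :: rat fps)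
      = fps_X ^ ?e * ((\<Prod>j<n. 1 + fps_X ^ Suc j) * (\<Prod>j<n. 1 + fps_X ^ j))"
    by (simp add: power_add mult_ac)
  have "fps_X ^ (k choose 2) * qbin fps_X (2 * n) k * 1 ^ k * (fps_X ^ n) ^ (2 * n - k)
      = fps_X ^ ?e * (fps_X ^ nat ((int n - int k) * (int n - int k + 1) div 2) * qbin (fps_X :: rat fps) (2 * n) k)"
    if k: "k \<le> 2 * n" for k
  proof -
    let ?x = "int n - int k"
    define T where "T = nat (?x * (?x + 1) div 2)"
    have "2 * int T = ?x * (?x + 1)"
      using two_mult_triangle[of ?x] triangle_nonneg[of ?x] unfolding T_def by linarith
    moreover obtain m where m: "2 * n = k + m"
      using k by (auto simp: le_iff_add)
    moreover have "2 * int n = int k + int m" using m by linarith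
    then have "int m = 2 * int n - int k" by simp
    ultimately have "2 * int ((k choose 2) + n * m) = 2 * int (?e + T)"
      using choose_two_int[of k] choose_two_int[of n]
      by (simp only: of_nat_add of_nat_mult) (simp add: algebra_simps)
    then have "(k choose 2) + n * (2 * n - k) = ?e + nat (?x * (?x + 1) div 2)"
      unfolding m T_def by (simp del: of_nat_add flip: of_nat_eq_iff)
    then have "fps_X ^ (k choose 2) * (fps_X ^ n) ^ (2 * n - k)
        = fps_X ^ ?e * (fps_X ^ nat (?x * (?x + 1) div 2) :: rat fps)"
      by (simp only: power_mult[symmetric] power_add[symmetric])
    then show ?thesis by (simp add: mult_ac)
  qed
  then have R: "(\<Sum>k\<le>2 * n. fps_X ^ (k choose 2) * qbin fps_X (2 * n) k * 1 ^ k * (fps_X ^ n) ^ (2 * n - k))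
     = fps_X ^ ?e * (\<Sum>k\<le>2 * n. fps_X ^ nat ((int n - int k) * (int n - int k + 1) div 2) * qbin (fps_X :: rat fps) (2 * n) k)"
    unfolding sum_distrib_left by (intro sum.cong) simp_all
  show ?thesis
    using q_binomial[of "fps_X ^ n" 1 "fps_X :: rat fps" "2 * n"]
    unfolding L R by simp
qed

text \<open>Sorts the factors of (q; q)_(2n) by the parity of their exponents.\<close>

lemma qfac_odd: "qfac (q ^ 2) n * (\<Prod>j<n. 1 - q ^ (2 * j + 1)) = qfac q (2 * n)"
proof (induction n)
  case (Suc n)
  have n: "2 * Suc n = Suc (Suc (2 * n))" by simp
  have "qfac q (2 * Suc n) = qfac q (2 * n) * (1 - q ^ Suc (2 * n)) * (1 - q ^ (2 * Suc n))"
    unfolding n by (simp only: qfac_Suc)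
  moreover have "qfac (q ^ 2) (Suc n) * (\<Prod>j<Suc n. 1 - q ^ (2 * j + 1))
      = (qfac (q ^ 2) n * (\<Prod>j<n. 1 - q ^ (2 * j + 1))) * (1 - q ^ Suc (2 * n)) * (1 - (q ^ 2) ^ Suc n)"
    by (simp add: qfac_Suc mult_ac)
  ultimately show ?case
    by (simp only: Suc power_mult)
qed simp

lemma qfac_plus: "qfac q n * (\<Prod>j<n. 1 + q ^ Suc j) = qfac (q ^ 2) n"
proof (induction n)
  case (Suc n)
  have "(1 - q ^ Suc n) * (1 + q ^ Suc n) = 1 - (q ^ 2) ^ Suc n"
    by (simp only: power2_eq_square power_mult_distrib) (simp add: algebra_simps)
  moreover have "qfac q (Suc n) * (\<Prod>j<Suc n. 1 + q ^ Suc j)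
      = (qfac q n * (\<Prod>j<n. 1 + q ^ Suc j)) * ((1 - q ^ Suc n) * (1 + q ^ Suc n))"
    by (simp add: qfac_Suc mult_ac)
  ultimately show ?case by (simp only: Suc qfac_Suc)
qed simp

text \<open>Gauss' product phi(-q) = eta^2(z) / eta(2z), as the limit of \<open>phi_finite\<close>;
  each of the two products over odd exponents is completed to an Euler product by
  \<open>qfac_odd\<close>.\<close>

theorem euler_phi: "euler_prod 2 * negq phi = (euler_prod 1)\<^sup>2"
proof (rule ceq_all_eq)
  fix M :: nat
  \<comment> \<open>An even n removes the sign (-1)^n and gives n - k the parity of k.\<close>
  define n where "n = 2 * M"
  let ?P = "euler_prod 2"
  let ?w = "\<lambda>x::int. if even x then 1 else - 1 :: rat"
  let ?Q = "\<Prod>j<n. 1 - fps_X ^ (2 * j + 1) :: rat fps"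
  have w: "fps_const (?w (int n - int k)) = (- 1) ^ k" for k
    by (simp add: n_def minus_one_power_iff flip: fps_const_neg)
  have "negq phi = gser UNIV (\<lambda>x::int. nat (x\<^sup>2)) ?w"
    unfolding phi_def negq_gser by (auto intro!: gser_cong simp: minus_one_power_square)
  moreover have "\<bar>x\<bar> \<le> int (nat (x\<^sup>2)) + 1" for x :: int
    using abs_le_square[of x] by simp
  ultimately have "ceq M (?P * ((- 1) ^ n * ?Q\<^sup>2)) (negq phi)"
    using theta_limit[of 2 "\<lambda>x. nat (x\<^sup>2)" M n ?w] unfolding w phi_finite by (simp add: n_def)
  then have "ceq M (?P * ?Q\<^sup>2) (negq phi)"
    by (simp add: n_def)
  then have "ceq M (?P * negq phi) (?P * (?P * ?Q\<^sup>2))"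
    by (intro ceq_mult ceq_refl) (rule ceq_sym)
  also have "\<dots> = (?P * ?Q) * (?P * ?Q)" by (simp add: power2_eq_square mult_ac)
  also have "ceq M \<dots> (euler_prod 1 * euler_prod 1)"
  proof -
    have "ceq M (?P * ?Q) (qfac (fps_X ^ 2) n * ?Q)"
      by (intro ceq_mult ceq_refl ceq_euler) (auto simp: n_def)
    also have "\<dots> = qfac fps_X (2 * n)" by (rule qfac_odd)
    also have "ceq M \<dots> (euler_prod 1)"
      using ceq_euler[of 1 M "2 * n"] by (simp add: ceq_sym n_def)
    finally show ?thesis by (intro ceq_mult)
  qed
  finally show "ceq M (?P * negq phi) ((euler_prod 1)\<^sup>2)" by (simp add: power2_eq_square)
qed

theorem euler_Psi: "euler_prod 1 * Psi = 2 * (euler_prod 2)\<^sup>2"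
proof (rule ceq_all_eq)
  fix M :: nat
  \<comment> \<open>One more than the limit needs: splitting off the factor 2 at j = 0 still leaves
    2 M factors.\<close>
  define n where "n = Suc (2 * M)"
  let ?P = "euler_prod 1" and ?E = "\<lambda>x::int. nat (x * (x + 1) div 2)"
  let ?Q = "\<lambda>n. \<Prod>j<n. 1 + fps_X ^ Suc j :: rat fps"
  have "\<bar>x\<bar> \<le> int (?E x) + 1" for x
  proof -
    have "2 * int (?E x) = x * (x + 1)"
      using two_mult_triangle[of x] triangle_nonneg[of x] by linarith
    moreover have "\<bar>x + 1\<bar> \<le> (x + 1)\<^sup>2" "\<bar>x\<bar> \<le> x\<^sup>2" by (rule abs_le_square)+
    moreover have "(x + 1)\<^sup>2 = x * (x + 1) + x + 1" "x * (x + 1) = x\<^sup>2 + x"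
      by (simp_all add: power2_eq_square algebra_simps)
    ultimately show ?thesis by linarith
  qed
  then have "ceq M (?P * (?Q n * (\<Prod>j<n. 1 + fps_X ^ j))) Psi"
    using theta_limit[of 1 ?E M n "\<lambda>_. 1"] unfolding Psi_def psi_finite[symmetric]
    by (simp add: n_def del: sum.atMost_Suc of_nat_Suc mult_Suc_right)
  also have "(\<Prod>j<n. 1 + fps_X ^ j) = 2 * ?Q (2 * M)"
    by (simp add: n_def prod.lessThan_Suc_shift del: prod.lessThan_Suc)
  finally have "ceq M (?P * Psi) (?P * (?P * (?Q n * (2 * ?Q (2 * M)))))"
    by (intro ceq_mult ceq_refl) (rule ceq_sym)
  also have "\<dots> = 2 * (?P * ?Q n) * (?P * ?Q (2 * M))" by (simp only: mult_ac)
  also have "ceq M \<dots> (2 * euler_prod 2 * euler_prod 2)"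
  proof -
    have lim: "ceq M (?P * ?Q n) (euler_prod 2)" if "M \<le> n" for n
    proof -
      have "ceq M (?P * ?Q n) (qfac fps_X n * ?Q n)"
        using that ceq_euler[of 1 M n] by (intro ceq_mult ceq_refl) simp
      also have "\<dots> = qfac (fps_X ^ 2) n" by (rule qfac_plus)
      also have "ceq M \<dots> (euler_prod 2)"
        using that ceq_euler[of 2 M n] by (simp add: ceq_sym)
      finally show ?thesis .
    qed
    show ?thesis by (intro ceq_mult ceq_refl lim) (simp_all add: n_def)
  qed
  finally show "ceq M (?P * Psi) (2 * (euler_prod 2)\<^sup>2)" by (simp add: power2_eq_square mult.assoc)
qed

section \<open>Eisenstein series\<close>

definition sig :: "nat \<Rightarrow> nat \<Rightarrow> rat" where
  "sig j n = (\<Sum>d | d dvd n. of_nat d ^ j)"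

definition S1 :: "rat fps" where
  "S1 = Abs_fps (sig 1)"

definition E2 :: "rat fps" where
  "E2 = 1 - 24 * S1"

text \<open>The expansion of i q^i / (1 - q^i), which is minus the logarithmic derivative of 1 -
  q^i.\<close>

definition lam :: "nat \<Rightarrow> rat fps" where
  "lam i = Abs_fps (\<lambda>m. if 0 < m \<and> i dvd m then of_nat i else 0)"

lemma lam_mult:
  assumes "i > 0"
  shows "lam i * (1 - fps_X ^ i) = of_nat i * fps_X ^ i"
proof (rule fps_ext)
  fix m
  have "i dvd m \<longleftrightarrow> i dvd m - i" if "i \<le> m" using that by (simp add: dvd_diff_nat dvd_minus_self)
  then show "fps_nth (lam i * (1 - fps_X ^ i)) m = fps_nth (of_nat i * fps_X ^ i) m"
    using assms by (auto simp: lam_def right_diff_distrib fps_X_power_mult_right_nth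
        fps_of_nat[symmetric] dest: dvd_imp_le)
qed

lemma DD_X_power: "DD (fps_X ^ n) = of_nat n * fps_X ^ n"
  by (rule fps_ext) (simp add: DD_nth fps_of_nat[symmetric])

lemma DD_qfac: "DD (qfac fps_X n) = - (qfac fps_X n * (\<Sum>i=1..n. lam i))"
proof (induction n)
  case (Suc n)
  have "DD (qfac fps_X (Suc n)) = DD (qfac fps_X n) * (1 - fps_X ^ Suc n)
      - qfac fps_X n * (of_nat (Suc n) * fps_X ^ Suc n)"
    by (simp only: qfac_Suc DD_mult DD_diff DD_1 DD_X_power) (simp add: algebra_simps)
  also have "of_nat (Suc n) * fps_X ^ Suc n = lam (Suc n) * (1 - fps_X ^ Suc n)"
    by (rule lam_mult[symmetric]) simp
  also have "DD (qfac fps_X n) * (1 - fps_X ^ Suc n) - qfac fps_X n * (lam (Suc n) * (1 - fps_X ^ Suc n))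
      = - (qfac fps_X (Suc n) * (\<Sum>i=1..Suc n. lam i))"
    unfolding Suc.IH qfac_Suc by (simp add: algebra_simps)
  finally show ?case .
qed (simp add: DD_def)

lemma DD_euler_1: "DD (euler_prod 1) = - (euler_prod 1 * S1)"
proof (rule ceq_all_eq)
  fix M :: nat
  have P: "ceq M (euler_prod 1) (qfac fps_X M)"
    using ceq_euler[of 1 M M] by simp
  then have "ceq M (DD (euler_prod 1)) (DD (qfac fps_X M))"
    by (simp add: ceq_def DD_nth)
  also have "\<dots> = qfac fps_X M * (- (\<Sum>i=1..M. lam i))"
    by (simp add: DD_qfac)
  also have "ceq M \<dots> (euler_prod 1 * (- S1))"
  proof (intro ceq_mult ceq_sym[OF P])
    show "ceq M (- (\<Sum>i=1..M. lam i)) (- S1)"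
      unfolding ceq_def
    proof (intro allI impI)
      fix m assume m: "m < M"
      have "(\<Sum>i=1..M. fps_nth (lam i) m) = sig 1 m"
      proof (cases "m = 0")
        case True
        then show ?thesis by (simp add: lam_def sig_def)
      next
        case False
        then have "{i \<in> {1..M}. i dvd m} = {d. d dvd m}"
          using m by (auto dest: dvd_imp_le simp: Suc_le_eq intro: Nat.gr0I)
        then show ?thesis using False by (simp add: lam_def sig_def sum.inter_filter flip: sum.inter_filter)
      qed
      then show "fps_nth (- (\<Sum>i=1..M. lam i)) m = fps_nth (- S1) m"
        by (simp add: fps_sum_nth S1_def)
    qed
  qed
  finally show "ceq M (DD (euler_prod 1)) (- (euler_prod 1 * S1))" by simp
qed

text \<open>\<open>E2\<close> is the logarithmic derivative of eta^24; the -1 accounts for the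
  factor q^(k/24) of eta(kz) that \<open>euler_prod\<close> omits.\<close>

lemma DD_euler:
  assumes "k > 0"
  shows "24 * DD (euler_prod k) = of_nat k * (euler_prod k * (rescale k E2 - 1))"
proof -
  have "24 * DD (euler_prod 1) = euler_prod 1 * (E2 - 1)"
    unfolding DD_euler_1 E2_def by (simp add: algebra_simps)
  then have "24 * rescale k (DD (euler_prod 1)) = rescale k (euler_prod 1) * (rescale k E2 - 1)"
    using assms by (metis rescale_mult rescale_diff rescale_1 rescale_numeral)
  then show ?thesis
    unfolding euler_rescale[OF assms] DD_rescale by (metis mult.left_commute)
qed

section \<open>Convolution of divisor sums by Liouville's method\<close>

type_synonym quad = "(nat \<times> nat) \<times> (nat \<times> nat)"

text \<open>Indexes the terms of the Cauchy square of the divisor series: a and b are the divisors,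
  x and y the cofactors. Only a and b enter the weights of \<open>qsum\<close>, while the bijections
  also move x and y.\<close>

definition quads :: "nat \<Rightarrow> quad set" where
  "quads n = {((a, x), (b, y)). 0 < a \<and> 0 < x \<and> 0 < b \<and> 0 < y \<and> a * x + b * y = n}"

lemma quads_iff: "((a, x), (b, y)) \<in> quads n \<longleftrightarrow> 0 < a \<and> 0 < x \<and> 0 < b \<and> 0 < y \<and> a * x + b * y = n"
  by (simp add: quads_def)

lemma finite_quads: "finite (quads n)"
proof -
  have le: "a \<le> n \<and> x \<le> n" if "0 < a" "0 < x" "a * x + m = n" for a x m
  proof -
    have "a \<le> a * x" "x \<le> a * x" using that by simp_all
    then show ?thesis using that(3) by linarith
  qed
  have "quads n \<subseteq> ({0..n} \<times> {0..n}) \<times> ({0..n} \<times> {0..n})"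
    using le by (fastforce simp: quads_def add.commute)
  then show ?thesis by (rule finite_subset) simp
qed

definition qset :: "nat \<Rightarrow> (nat \<Rightarrow> nat \<Rightarrow> nat \<Rightarrow> nat \<Rightarrow> bool) \<Rightarrow> quad set" where
  "qset n P = {p \<in> quads n. P (fst (fst p)) (fst (snd p)) (snd (fst p)) (snd (snd p))}"

definition qsum :: "nat \<Rightarrow> (nat \<Rightarrow> nat \<Rightarrow> nat \<Rightarrow> nat \<Rightarrow> bool) \<Rightarrow> (nat \<Rightarrow> nat \<Rightarrow> rat) \<Rightarrow> rat" where
  "qsum n P f = (\<Sum>p\<in>qset n P. f (fst (fst p)) (fst (snd p)))"

lemma qset_iff: "((a, x), (b, y)) \<in> qset n P \<longleftrightarrow> ((a, x), (b, y)) \<in> quads n \<and> P a b x y"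
  by (simp add: qset_def)

lemma qsum_bij:
  assumes h: "\<And>a x b y. ((a, x), (b, y)) \<in> quads n \<Longrightarrow> P a b x y \<Longrightarrow>
        h ((a, x), (b, y)) \<in> qset n Q \<and> h' (h ((a, x), (b, y))) = ((a, x), (b, y))
        \<and> g (fst (fst (h ((a, x), (b, y))))) (fst (snd (h ((a, x), (b, y))))) = f a b"
    and h': "\<And>a x b y. ((a, x), (b, y)) \<in> quads n \<Longrightarrow> Q a b x y \<Longrightarrow>
        h' ((a, x), (b, y)) \<in> qset n P \<and> h (h' ((a, x), (b, y))) = ((a, x), (b, y))"
  shows "qsum n P f = qsum n Q g"
  unfolding qsum_def
proof (rule sum.reindex_bij_witness[where i = h' and j = h])
  fix p assume p: "p \<in> qset n P"
  obtain a x b y where e: "p = ((a, x), (b, y))" by (metis surj_pair)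
  note * = h[of a x b y]
  show "h' (h p) = p" "h p \<in> qset n Q" "g (fst (fst (h p))) (fst (snd (h p))) = f (fst (fst p)) (fst (snd p))"
    using p * unfolding e qset_iff by simp_all
next
  fix p assume p: "p \<in> qset n Q"
  obtain a x b y where e: "p = ((a, x), (b, y))" by (metis surj_pair)
  show "h (h' p) = p" "h' p \<in> qset n P"
    using p h'[of a x b y] unfolding e qset_iff by simp_all
qed

lemma qsum_swap: "qsum n P f = qsum n (\<lambda>a b x y. P b a y x) (\<lambda>a b. f b a)"
  by (rule qsum_bij[where h = prod.swap and h' = prod.swap]) (auto simp: quads_iff qset_iff)

lemma qsum_split: "qsum n P f = qsum n (\<lambda>a b x y. P a b x y \<and> R a b x y) f
    + qsum n (\<lambda>a b x y. P a b x y \<and> \<not> R a b x y) f"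
  unfolding qsum_def
  by (subst sum.union_disjoint[symmetric])
     (auto simp: qset_def finite_quads intro!: sum.cong)

lemma qsum_cong:
  assumes "\<And>a b x y. P a b x y = Q a b x y"
    and "\<And>a b x y. P a b x y \<Longrightarrow> f a b = g a b"
  shows "qsum n P f = qsum n Q g"
  unfolding qsum_def using assms by (intro sum.cong) (auto simp: qset_def)

lemma qsum_trichotomy_ab:
  "qsum n (\<lambda>_ _ _ _. True) f = qsum n (\<lambda>a b x y. b < a) f + qsum n (\<lambda>a b x y. a = b) f
     + qsum n (\<lambda>a b x y. a < b) f"
proof -
  have "qsum n (\<lambda>_ _ _ _. True) f = qsum n (\<lambda>a b x y. b < a) f + qsum n (\<lambda>a b x y. \<not> b < a) f"
    by (subst qsum_split[where R = "\<lambda>a b x y. b < a"]) simp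
  also have "qsum n (\<lambda>a b x y. \<not> b < a) f = qsum n (\<lambda>a b x y. a = b) f + qsum n (\<lambda>a b x y. a < b) f"
    by (subst qsum_split[where R = "\<lambda>a b x y. a = b"]) (auto intro!: arg_cong2[where f = plus] qsum_cong)
  finally show ?thesis by simp
qed

lemma qsum_trichotomy_xy:
  "qsum n (\<lambda>_ _ _ _. True) f = qsum n (\<lambda>a b x y. y < x) f + qsum n (\<lambda>a b x y. x = y) f
     + qsum n (\<lambda>a b x y. x < y) f"
proof -
  have "qsum n (\<lambda>_ _ _ _. True) f = qsum n (\<lambda>a b x y. y < x) f + qsum n (\<lambda>a b x y. \<not> y < x) f"
    by (subst qsum_split[where R = "\<lambda>a b x y. y < x"]) simp
  also have "qsum n (\<lambda>a b x y. \<not> y < x) f = qsum n (\<lambda>a b x y. x = y) f + qsum n (\<lambda>a b x y. x < y) f"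
    by (subst qsum_split[where R = "\<lambda>a b x y. x = y"]) (auto intro!: arg_cong2[where f = plus] qsum_cong)
  finally show ?thesis by simp
qed

text \<open>The two Euclidean steps \<open>ax + by = (a - b)x + b(x + y) = a(x + y) + (b - a)y\<close>.\<close>

lemma qsum_step1:
  "qsum n (\<lambda>a b x y. b < a) f = qsum n (\<lambda>a b x y. x < y) (\<lambda>a b. f (a + b) b)"
proof (rule sym, rule qsum_bij[where h = "\<lambda>((a, x), (b, y)). ((a + b, x), (b, y - x))"
      and h' = "\<lambda>((a, x), (b, y)). ((a - b, x), (b, x + y))"], goal_cases)
  case (1 a x b y)
  obtain k where "0 < k" "y = x + k" using less_imp_add_positive[OF 1(2)] by auto
  with 1 show ?case by (auto simp: quads_iff qset_iff algebra_simps)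
next
  case (2 a x b y)
  obtain k where "0 < k" "a = b + k" using less_imp_add_positive[OF 2(2)] by auto
  with 2 show ?case by (auto simp: quads_iff qset_iff algebra_simps)
qed

lemma qsum_step2:
  "qsum n (\<lambda>a b x y. a < b) (\<lambda>a b. g a) = qsum n (\<lambda>a b x y. y < x) (\<lambda>a b. g a)"
proof (rule qsum_bij[where h = "\<lambda>((a, x), (b, y)). ((a, x + y), (b - a, y))"
      and h' = "\<lambda>((a, x), (b, y)). ((a, x - y), (a + b, y))"], goal_cases)
  case (1 a x b y)
  obtain k where "0 < k" "b = a + k" using less_imp_add_positive[OF 1(2)] by auto
  with 1 show ?case by (auto simp: quads_iff qset_iff algebra_simps)
next
  case (2 a x b y)
  obtain k where "0 < k" "x = y + k" using less_imp_add_positive[OF 2(2)] by auto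
  with 2 show ?case by (auto simp: quads_iff qset_iff algebra_simps)
qed

lemma qsum_lin: "qsum n P (\<lambda>a b. c * f a b + d * g a b) = c * qsum n P f + d * qsum n P g"
  unfolding qsum_def sum_distrib_left sum.distrib[symmetric] by (intro sum.cong) auto

text \<open>Start from 4ab = (a + b)^2 - (a - b)^2. The first Euclidean step turns the off-diagonal
  parts of both sums into sums of a^2, over b < a and over x < y; the second step, which fixes a,
  compares these two regions. Only the diagonals a = b and x = y survive.\<close>

lemma qsum_product:
  "4 * qsum n (\<lambda>_ _ _ _. True) (\<lambda>a b. of_nat a * of_nat b)
     = qsum n (\<lambda>a b x y. x = y) (\<lambda>a b. 2 * (of_nat a)\<^sup>2 + (of_nat a + of_nat b)\<^sup>2)
       - 2 * qsum n (\<lambda>a b x y. a = b) (\<lambda>a b. (of_nat a)\<^sup>2)"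
proof -
  let ?T = "\<lambda>_ _ _ _ :: nat. True"
  let ?sq = "\<lambda>a b :: nat. (of_nat a)\<^sup>2 :: rat"
  let ?p = "\<lambda>a b :: nat. (of_nat a + of_nat b)\<^sup>2 :: rat" and ?m = "\<lambda>a b :: nat. (of_nat a - of_nat b)\<^sup>2 :: rat"
  have m: "qsum n ?T ?m = 2 * qsum n (\<lambda>a b x y. x < y) ?sq"
  proof -
    have "qsum n (\<lambda>a b x y. b < a) ?m = qsum n (\<lambda>a b x y. x < y) ?sq"
      by (subst qsum_step1) simp
    moreover have "qsum n (\<lambda>a b x y. a < b) ?m = qsum n (\<lambda>a b x y. b < a) ?m"
      by (subst qsum_swap) (simp add: power2_commute)
    moreover have "qsum n (\<lambda>a b x y. a = b) ?m = 0"
      unfolding qsum_def by (rule sum.neutral) (auto simp: qset_def)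
    ultimately show ?thesis by (simp add: qsum_trichotomy_ab[of n ?m])
  qed
  have p: "qsum n ?T ?p = 2 * qsum n (\<lambda>a b x y. b < a) ?sq + qsum n (\<lambda>a b x y. x = y) ?p"
  proof -
    have "qsum n (\<lambda>a b x y. x < y) ?p = qsum n (\<lambda>a b x y. b < a) ?sq"
      by (subst qsum_step1) simp
    moreover have "qsum n (\<lambda>a b x y. y < x) ?p = qsum n (\<lambda>a b x y. x < y) ?p"
      by (subst qsum_swap) (simp add: add.commute)
    ultimately show ?thesis by (simp add: qsum_trichotomy_xy[of n ?p])
  qed
  have s: "qsum n (\<lambda>a b x y. b < a) ?sq + qsum n (\<lambda>a b x y. a = b) ?sq
      = qsum n (\<lambda>a b x y. x = y) ?sq + qsum n (\<lambda>a b x y. x < y) ?sq"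
    using qsum_trichotomy_ab[of n ?sq] qsum_trichotomy_xy[of n ?sq] qsum_step2[of n "\<lambda>a. (of_nat a)\<^sup>2"]
    by simp
  have "qsum n ?T (\<lambda>a b. of_nat a * of_nat b) = qsum n ?T (\<lambda>a b. (1 / 4) * ?p a b + (- 1 / 4) * ?m a b)"
    by (rule qsum_cong) (auto simp: power2_eq_square algebra_simps)
  also have "\<dots> = (1 / 4) * qsum n ?T ?p + (- 1 / 4) * qsum n ?T ?m"
    by (rule qsum_lin)
  finally have "4 * qsum n ?T (\<lambda>a b. of_nat a * of_nat b) = qsum n ?T ?p - qsum n ?T ?m"
    by simp
  moreover have "qsum n (\<lambda>a b x y. x = y) (\<lambda>a b. 2 * ?sq a b + 1 * ?p a b)
     = 2 * qsum n (\<lambda>a b x y. x = y) ?sq + 1 * qsum n (\<lambda>a b x y. x = y) ?p"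
    by (rule qsum_lin)
  ultimately show ?thesis using m p s by simp
qed

text \<open>With d = a = b the equation reads d (x + y) = n and has n/d - 1 positive solutions (x,
  y).\<close>

lemma qsum_diag_ab:
  assumes "n > 0"
  shows "qsum n (\<lambda>a b x y. a = b) (\<lambda>a b. (of_nat a)\<^sup>2) = of_nat n * sig 1 n - sig 2 n"
proof -
  let ?S = "SIGMA d:{d. d dvd n}. {1..<n div d}"
  have "qsum n (\<lambda>a b x y. a = b) (\<lambda>a b. (of_nat a)\<^sup>2) = (\<Sum>(d, x)\<in>?S. (of_nat d)\<^sup>2)"
    unfolding qsum_def
  proof (rule sum.reindex_bij_witness[where j = fst and i = "\<lambda>(d, x). ((d, x), (d, n div d - x))"])
    fix p assume p: "p \<in> qset n (\<lambda>a b x y. a = b)"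
    obtain a x b y where e: "p = ((a, x), (b, y))" by (metis surj_pair)
    have *: "b = a" "0 < a" "0 < x" "0 < y" "n = a * (x + y)"
      using p by (auto simp: e qset_iff quads_iff algebra_simps)
    show "(case fst p of (d, x) \<Rightarrow> ((d, x), (d, n div d - x))) = p" "fst p \<in> ?S"
      "(case fst p of (d, x) \<Rightarrow> (of_nat d)\<^sup>2) = (of_nat (fst (fst p)))\<^sup>2"
      using * by (auto simp: e)
  next
    fix q assume q: "q \<in> ?S"
    obtain d x where e: "q = (d, x)" by fastforce
    obtain k where k: "n = d * k" using q by (auto simp: e)
    have "0 < d" "0 < x" "x < k" using q assms by (auto simp: e k)
    then obtain m where "0 < m" "k = x + m" using less_imp_add_positive by metis
    then show "(case q of (d, x) \<Rightarrow> ((d, x), (d, n div d - x))) \<in> qset n (\<lambda>a b x y. a = b)"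
      using \<open>0 < d\<close> \<open>0 < x\<close> by (auto simp: e k qset_iff quads_iff algebra_simps)
  qed auto
  also have "\<dots> = (\<Sum>d | d dvd n. \<Sum>x=1..<n div d. (of_nat d)\<^sup>2)"
    using assms by (subst sum.Sigma) auto
  also have "\<dots> = (\<Sum>d | d dvd n. of_nat n * of_nat d - (of_nat d)\<^sup>2)"
  proof (intro sum.cong refl)
    fix d assume "d \<in> {d. d dvd n}"
    then obtain k where k: "n = d * k" by auto
    then have "d > 0" "k > 0" using assms by auto
    then show "(\<Sum>x=1..<n div d. (of_nat d)\<^sup>2) = (of_nat n * of_nat d - (of_nat d)\<^sup>2 :: rat)"
      by (simp add: k of_nat_diff power2_eq_square algebra_simps)
  qed
  finally show ?thesis by (simp add: sig_def sum_subtractf sum_distrib_left)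
qed

lemma sum_squares_below:
  assumes "d > 0"
  shows "3 * (\<Sum>a=1..<d. 2 * (of_nat a)\<^sup>2 + (of_nat d)\<^sup>2) = (5 * of_nat d ^ 3 - 6 * of_nat d ^ 2 + of_nat d :: rat)"
proof -
  have "3 * (\<Sum>a=1..<d. 2 * (of_nat a)\<^sup>2) = (2 * of_nat d ^ 3 - 3 * of_nat d ^ 2 + of_nat d :: rat)"
    using assms by (induction d rule: nat_induct_non_zero) (simp_all add: power2_eq_square power3_eq_cube algebra_simps)
  moreover have "3 * (\<Sum>a=1..<d. (of_nat d)\<^sup>2) = (3 * of_nat d ^ 3 - 3 * of_nat d ^ 2 :: rat)"
    using assms by (simp add: of_nat_diff power2_eq_square power3_eq_cube algebra_simps)
  ultimately show ?thesis by (simp add: sum.distrib algebra_simps)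
qed

text \<open>Here (a + b) x = n. With d = a + b dividing n, a runs from 1 to d - 1, which leaves sums
  of squares in closed form.\<close>

lemma qsum_diag_xy:
  assumes "n > 0"
  shows "3 * qsum n (\<lambda>a b x y. x = y) (\<lambda>a b. 2 * (of_nat a)\<^sup>2 + (of_nat a + of_nat b)\<^sup>2)
    = 5 * sig 3 n - 6 * sig 2 n + sig 1 n"
proof -
  let ?S = "SIGMA d:{d. d dvd n}. {1..<d}"
  let ?f = "\<lambda>d a :: nat. 2 * (of_nat a)\<^sup>2 + (of_nat d)\<^sup>2 :: rat"
  have "qsum n (\<lambda>a b x y. x = y) (\<lambda>a b. 2 * (of_nat a)\<^sup>2 + (of_nat a + of_nat b)\<^sup>2) = (\<Sum>(d, a)\<in>?S. ?f d a)"
    unfolding qsum_def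
  proof (rule sum.reindex_bij_witness[where j = "\<lambda>p. (fst (fst p) + fst (snd p), fst (fst p))"
        and i = "\<lambda>(d, a). ((a, n div d), (d - a, n div d))"])
    fix p assume p: "p \<in> qset n (\<lambda>a b x y. x = y)"
    obtain a x b y where e: "p = ((a, x), (b, y))" by (metis surj_pair)
    have *: "y = x" "0 < a" "0 < x" "0 < b" "n = (a + b) * x"
      using p by (auto simp: e qset_iff quads_iff algebra_simps)
    show "(case (fst (fst p) + fst (snd p), fst (fst p)) of
        (d, a) \<Rightarrow> ((a, n div d), (d - a, n div d))) = p"
      "(fst (fst p) + fst (snd p), fst (fst p)) \<in> ?S"
      "(case (fst (fst p) + fst (snd p), fst (fst p)) of (d, a) \<Rightarrow> ?f d a)
        = 2 * (of_nat (fst (fst p)))\<^sup>2 + (of_nat (fst (fst p)) + of_nat (fst (snd p)))\<^sup>2"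
      using * by (auto simp: e simp del: distrib_right distrib_left)
  next
    fix q assume q: "q \<in> ?S"
    obtain d a where e: "q = (d, a)" by fastforce
    obtain k where k: "n = d * k" using q by (auto simp: e)
    have "0 < k" "0 < a" "a < d" using q assms by (auto simp: e k)
    then obtain m where m: "0 < m" "d = a + m" using less_imp_add_positive by metis
    have "n div d = k" using m k by simp
    then show "(case q of (d, a) \<Rightarrow> ((a, n div d), (d - a, n div d))) \<in> qset n (\<lambda>a b x y. x = y)"
      "(fst (fst (case q of (d, a) \<Rightarrow> ((a, n div d), (d - a, n div d)))) + fst (snd (case q of (d, a) \<Rightarrow> ((a, n div d), (d - a, n div d)))),
          fst (fst (case q of (d, a) \<Rightarrow> ((a, n div d), (d - a, n div d))))) = q"
      using \<open>0 < k\<close> \<open>0 < a\<close> m k by (auto simp: e qset_iff quads_iff algebra_simps)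
  qed
  also have "\<dots> = (\<Sum>d | d dvd n. \<Sum>a=1..<d. ?f d a)"
    using assms by (simp add: sum.Sigma)
  finally have "3 * qsum n (\<lambda>a b x y. x = y) (\<lambda>a b. 2 * (of_nat a)\<^sup>2 + (of_nat a + of_nat b)\<^sup>2)
      = (\<Sum>d | d dvd n. 3 * (\<Sum>a=1..<d. ?f d a))"
    by (simp only: sum_distrib_left)
  also have "\<dots> = (\<Sum>d | d dvd n. 5 * of_nat d ^ 3 - 6 * of_nat d ^ 2 + of_nat d)"
    using assms by (intro sum.cong refl sum_squares_below) (auto intro: Nat.gr0I)
  finally show ?thesis by (simp add: sig_def sum.distrib sum_subtractf sum_distrib_left)
qed

lemma S1_gser: "S1 = gser {(a, x). 0 < a \<and> 0 < x} (\<lambda>(a, x). a * x) (\<lambda>(a, x). of_nat a)"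
proof (rule fps_ext)
  fix n
  show "fps_nth S1 n = fps_nth (gser {(a, x). 0 < a \<and> 0 < x} (\<lambda>(a, x). a * x) (\<lambda>(a, x). of_nat a)) n"
  proof (cases "n = 0")
    case True
    have "fib {(a::nat, x::nat). 0 < a \<and> 0 < x} (\<lambda>(a, x). a * x) 0 = {}"
      by (auto simp: fib_def)
    then show ?thesis unfolding True gser_nth by (simp add: S1_def sig_def)
  next
    case False
    show ?thesis
      unfolding S1_def sig_def gser_nth fib_def fps_nth_Abs_fps
      by (rule sum.reindex_bij_witness[where i = "\<lambda>(a, x). a" and j = "\<lambda>d. (d, n div d)"])
         (use False in \<open>auto intro: Nat.gr0I dvd_imp_le simp: div_greater_zero_iff\<close>)
  qed
qed

lemma S1_square: "fps_nth (S1 * S1) n = qsum n (\<lambda>_ _ _ _. True) (\<lambda>a b. of_nat a * of_nat b)"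
proof -
  let ?U = "{(a::nat, x::nat). 0 < a \<and> 0 < x}"
  have f: "finfib ?U (\<lambda>(a, x). a * x)"
    unfolding finfib_def
  proof
    fix n
    have "fib ?U (\<lambda>(a, x). a * x) n \<subseteq> {0..n} \<times> {0..n}"
      by (auto simp: fib_def)
    then show "finite (fib ?U (\<lambda>(a, x). a * x) n)" by (rule finite_subset) simp
  qed
  show ?thesis
    unfolding S1_gser gser_mult[OF f f] gser_nth qsum_def
    by (intro sum.cong) (auto simp: fib_def quads_def qset_def)
qed

text \<open>The sigma_2 terms of the two diagonals cancel. What remains is Besge's formula: 12 times
  the convolution square of sigma_1 is 5 sigma_3(n) - (6n - 1) sigma_1(n).\<close>

theorem DD_E2: "12 * DD E2 = E2\<^sup>2 - E4"
proof (rule fps_ext)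
  fix n
  show "fps_nth (12 * DD E2) n = fps_nth (E2\<^sup>2 - E4) n"
  proof (cases "n = 0")
    case True
    then show ?thesis
      by (simp add: DD_nth E2_def E4_def power2_eq_square S1_def sig_def fps_numeral_fps_const)
  next
    case False
    have "E2\<^sup>2 = 1 - 48 * S1 + 576 * (S1 * S1)"
      by (simp add: E2_def power2_eq_square algebra_simps)
    moreover have "12 * fps_nth (S1 * S1) n = 5 * sig 3 n + sig 1 n - 6 * (of_nat n * sig 1 n)"
      using False qsum_product[of n] qsum_diag_ab[of n] qsum_diag_xy[of n]
      unfolding S1_square by linarith
    moreover have "fps_nth S1 n = sig 1 n" "fps_nth E4 n = 240 * sig 3 n"
      using False by (simp_all add: S1_def E4_def sig_def sigma3_def)
    moreover have "fps_nth (12 * DD E2) n = 12 * (of_nat n * (- 24 * fps_nth S1 n))"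
      using False by (simp add: DD_nth E2_def fps_numeral_fps_const)
    moreover have "fps_nth (1 - 48 * S1 + 576 * (S1 * S1)) n = - 48 * fps_nth S1 n + 576 * fps_nth (S1 * S1) n"
      using False by (simp add: fps_numeral_fps_const)
    ultimately show ?thesis
      by (simp only: fps_sub_nth)
  qed
qed

section \<open>The arithmetic-geometric mean and level 8\<close>

definition tX :: "rat fps" where "tX = phi\<^sup>2"
definition tY :: "rat fps" where "tY = (negq phi)\<^sup>2"

lemma rescale_1_left [simp]: "rescale 1 f = f" "rescale (Suc 0) f = f"
  by (auto intro!: fps_ext simp: rescale_nth)

lemma phi_nth_0 [simp]: "fps_nth phi 0 = 1"
proof -
  have "fib UNIV (\<lambda>x::int. nat (x\<^sup>2)) 0 = {0}" by (auto simp: fib_def)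
  then show ?thesis by (simp add: phi_def gser_nth)
qed

lemma phi_nth_1 [simp]: "fps_nth phi (Suc 0) = 2"
proof -
  have "fib UNIV (\<lambda>x::int. nat (x\<^sup>2)) (Suc 0) = {-1, 1}"
    by (auto simp: fib_def nat_eq_iff power2_eq_1_iff)
  then show ?thesis by (simp add: phi_def gser_nth)
qed

lemma negq_phi_nth [simp]: "fps_nth (negq phi) 0 = 1" "fps_nth (negq phi) (Suc 0) = - 2"
  by (simp_all add: negq_nth)

lemma tX_nth [simp]: "fps_nth tX 0 = 1" "fps_nth tX (Suc 0) = 4"
  and tY_nth [simp]: "fps_nth tY 0 = 1" "fps_nth tY (Suc 0) = - 4"
  by (simp_all add: tX_def tY_def power2_eq_square)

lemma nth_nonzero: "fps_nth f n \<noteq> 0 \<Longrightarrow> f \<noteq> 0" by auto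

lemma phi_nonzero [simp]: "phi \<noteq> 0" "negq phi \<noteq> 0" "tX \<noteq> 0" "tY \<noteq> 0" "euler_prod k \<noteq> 0"
  by (rule nth_nonzero[where n = 0]; simp)+

lemma rescale_nth_0 [simp]: "fps_nth (rescale k f) 0 = fps_nth f 0"
  by (simp add: rescale_nth)

lemma phi_negq_phi_tY: "phi * negq phi = rescale 2 tY"
  by (simp add: phi_negq_phi tY_def rescale_power)

lemma rescale_tY_square: "(rescale 2 tY)\<^sup>2 = tX * tY"
proof -
  have "(rescale 2 tY)\<^sup>2 = (phi * negq phi)\<^sup>2" by (simp only: phi_negq_phi_tY)
  then show ?thesis by (simp add: tX_def tY_def power_mult_distrib)
qed

text \<open>X and Y are \<open>Ev 1\<close> plus and minus \<open>Od 1\<close>. The sum is the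
  arithmetic mean step; the difference is 2q times a square, so that its product with the difference
  at q^3 is a perfect square, as \<open>tg_tr\<close> requires.\<close>

lemma tX_plus_tY: "tX + tY = 2 * rescale 2 tX"
  and tX_minus_tY: "tX - tY = 2 * fps_X * (rescale 4 Psi)\<^sup>2"
proof -
  have "tX = Ev 1 + Od 1"
    using phi_rescale_phi[OF zero_less_one] by (metis rescale_1_left(1) tX_def power2_eq_square)
  moreover have "tY = Ev 1 - Od 1"
    using negq_phi_rescale_phi[OF odd_one] by (metis rescale_1_left(1) tY_def power2_eq_square negq_mult)
  moreover have "rescale 2 tX = Ev 1"
    unfolding Ev_1 tX_def by (rule rescale_power) simp
  ultimately show "tX + tY = 2 * rescale 2 tX" "tX - tY = 2 * fps_X * (rescale 4 Psi)\<^sup>2"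
    using Od_1 by algebra+
qed

lemma rescale_euler:
  assumes "0 < k" "0 < l"
  shows "rescale k (euler_prod l) = euler_prod (k * l)"
proof -
  have "rescale k (euler_prod l) = rescale k (rescale l (euler_prod 1))"
    using euler_rescale[OF assms(2)] by simp
  also have "\<dots> = euler_prod (k * l)"
    using euler_rescale[of "k * l"] assms by (simp add: rescale_rescale)
  finally show ?thesis .
qed

lemma euler_negq_phi_rescale: "0 < k \<Longrightarrow> euler_prod (k * 2) * rescale k (negq phi) = (euler_prod k)\<^sup>2"
  using arg_cong[OF euler_phi, of "rescale k"] by (simp add: rescale_mult rescale_power rescale_euler)

lemma euler_Psi_rescale: "0 < k \<Longrightarrow> euler_prod k * rescale k Psi = 2 * (euler_prod (k * 2))\<^sup>2"
  using arg_cong[OF euler_Psi, of "rescale k"] by (simp add: rescale_mult rescale_power rescale_euler)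

text \<open>Gauss' formula covers phi(-q), not phi(q). Multiplication by phi(-q) brings in
  \<open>phi_negq_phi\<close>, after which both sides reduce to the same Euler products.\<close>

lemma phi_Psi: "2 * phi * rescale 2 Psi = Psi\<^sup>2"
proof -
  let ?P1 = "euler_prod 1" and ?P2 = "euler_prod 2" and ?P4 = "euler_prod 4" and ?B = "negq phi"
  have "(2 * phi * rescale 2 Psi) * (?B * ?P2 * ?P1\<^sup>2) = 2 * (phi * ?B) * (?P2 * rescale 2 Psi) * ?P1\<^sup>2"
    by (simp add: mult_ac)
  also have "\<dots> = 4 * (?P4 * rescale 2 ?B)\<^sup>2 * ?P1\<^sup>2"
    using euler_Psi_rescale[of 2] by (simp add: phi_negq_phi power2_eq_square mult_ac)
  also have "\<dots> = (2 * ?P2\<^sup>2)\<^sup>2 * ?P1\<^sup>2"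
    using euler_negq_phi_rescale[of 2] by (simp add: power2_eq_square mult_ac)
  also have "\<dots> = (?P1 * Psi)\<^sup>2 * (?P2 * ?B)"
    unfolding euler_Psi euler_phi ..
  also have "\<dots> = Psi\<^sup>2 * (?B * ?P2 * ?P1\<^sup>2)"
    by (simp add: power2_eq_square mult_ac)
  finally show ?thesis by simp
qed

text \<open>Jacobi's quartic identity; its usual factor 16 is absorbed in \<open>Psi\<close>, which
  is twice Ramanujan's series.\<close>

lemma tX_tY_Psi: "tX\<^sup>2 - tY\<^sup>2 = fps_X * (rescale 2 Psi) ^ 4"
proof -
  have "2 * rescale 2 phi * rescale 4 Psi = (rescale 2 Psi)\<^sup>2"
    using arg_cong[OF phi_Psi, of "rescale 2"] by (simp add: rescale_hom)
  then have "(rescale 2 Psi) ^ 4 = (2 * rescale 2 phi * rescale 4 Psi)\<^sup>2"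
    by (simp flip: power_mult)
  moreover have "tX\<^sup>2 - tY\<^sup>2 = (tX + tY) * (tX - tY)"
    by (simp add: power2_eq_square algebra_simps)
  moreover have "rescale 2 tX = (rescale 2 phi)\<^sup>2" by (simp add: tX_def rescale_power)
  ultimately show ?thesis
    unfolding tX_plus_tY tX_minus_tY by algebra
qed

lemma DD_negq_phi: "12 * DD (negq phi) = negq phi * (E2 - rescale 2 E2)"
proof -
  let ?P1 = "euler_prod 1" and ?P2 = "euler_prod 2" and ?B = "negq phi"
  have "DD ?P2 * ?B + ?P2 * DD ?B = 2 * ?P1 * DD ?P1"
    using arg_cong[OF euler_phi, of DD] by (simp only: DD_mult DD_power2)
  then have "(24 * DD ?P2) * ?B + ?P2 * (24 * DD ?B) = 2 * ?P1 * (24 * DD ?P1)"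
    by (metis (no_types, lifting) distrib_left mult.assoc mult.left_commute)
  moreover have "24 * DD ?P1 = ?P1 * (E2 - 1)" "24 * DD ?P2 = 2 * (?P2 * (rescale 2 E2 - 1))"
    using DD_euler[of 1] DD_euler[of 2] by simp_all
  ultimately have "2 * (?P2 * (rescale 2 E2 - 1)) * ?B + ?P2 * (24 * DD ?B) = 2 * ?P1 * (?P1 * (E2 - 1))"
    by (simp only:)
  also have "\<dots> = 2 * (?P2 * ?B) * (E2 - 1)"
    unfolding euler_phi by (simp add: power2_eq_square mult_ac)
  finally have "(2 * ?P2) * (12 * DD ?B) = (2 * ?P2) * (?B * (E2 - rescale 2 E2))"
    by (simp add: algebra_simps)
  moreover have "2 * ?P2 \<noteq> 0" by simp
  ultimately show ?thesis using mult_left_cancel by blast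
qed

text \<open>The coefficients 5, -1, -4 are those of phi = eta^5(2z) / (eta^2(z) eta^2(4z)), obtained
  here by differentiating \<open>phi_negq_phi\<close>.\<close>

lemma DD_phi: "12 * DD phi = phi * (5 * rescale 2 E2 - E2 - 4 * rescale 4 E2)"
proof -
  let ?B = "negq phi" and ?e2 = "rescale 2 E2" and ?e4 = "rescale 4 E2"
  have "12 * DD (rescale 2 ?B) = 2 * rescale 2 (12 * DD ?B)"
    by (simp add: DD_rescale rescale_mult)
  then have B2: "12 * DD (rescale 2 ?B) = 2 * rescale 2 ?B * (?e2 - ?e4)"
    by (simp add: DD_negq_phi rescale_hom)
  have "DD phi * ?B + phi * DD ?B = 2 * rescale 2 ?B * DD (rescale 2 ?B)"
    using arg_cong[OF phi_negq_phi, of DD] by (simp only: DD_mult DD_power2)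
  then have "(12 * DD phi) * ?B + phi * (12 * DD ?B) = 2 * rescale 2 ?B * (12 * DD (rescale 2 ?B))"
    by (metis (no_types, lifting) distrib_left mult.assoc mult.left_commute)
  also have "\<dots> = 4 * (phi * ?B) * (?e2 - ?e4)"
    unfolding B2 phi_negq_phi by (simp add: power2_eq_square algebra_simps)
  finally have "?B * (12 * DD phi) = ?B * (phi * (5 * ?e2 - E2 - 4 * ?e4))"
    unfolding DD_negq_phi by (simp add: algebra_simps)
  then show ?thesis by simp
qed

lemma DD_tX: "12 * DD tX = 2 * tX * (5 * rescale 2 E2 - E2 - 4 * rescale 4 E2)"
  unfolding tX_def DD_power2 using DD_phi by algebra

lemma DD_tY: "12 * DD tY = 2 * tY * (E2 - rescale 2 E2)"
  unfolding tY_def DD_power2 using DD_negq_phi by algebra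

text \<open>The quotient of the two sides is invariant under \<open>q \<mapsto> q\<^sup>2\<close>, because \<open>(tX, tY)\<close> is
  then replaced by its arithmetic and geometric means.\<close>

lemma DD_log_quotient: "2 * (DD tX * tY - tX * DD tY) = tX * tY * (tX\<^sup>2 - tY\<^sup>2)"
proof -
  define U where "U = 2 * (DD tX * tY - tX * DD tY) - tX * tY * (tX\<^sup>2 - tY\<^sup>2)"
  define X1 Y1 where "X1 = rescale 2 tX" and "Y1 = rescale 2 tY"
  have 1: "tX + tY = 2 * X1" "Y1\<^sup>2 = tX * tY"
    by (simp_all add: X1_def Y1_def tX_plus_tY rescale_tY_square)
  have 2: "DD tX + DD tY = 2 * DD X1" "2 * Y1 * DD Y1 = DD tX * tY + tX * DD tY"
    using arg_cong[OF 1(1), of DD] arg_cong[OF 1(2), of DD] by (simp_all add: DD_mult DD_power2)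
  have "rescale 2 U = DD X1 * Y1 - X1 * DD Y1 - X1 * Y1 * (X1\<^sup>2 - Y1\<^sup>2)"
    by (simp add: U_def X1_def Y1_def rescale_hom DD_rescale algebra_simps)
  then have U: "8 * Y1 * rescale 2 U = (tX - tY) * U"
    unfolding U_def using 1 2 by algebra
  \<comment> \<open>Compare lowest exponents in the functional equation: if U starts at q^d, its two
    sides start at q^(2d) and q^(d+1). This forces d = 1, but the coefficients of U at 0 and 1
    vanish.\<close>
  have "U = 0"
  proof (rule ccontr)
    assume "U \<noteq> 0"
    have U01: "fps_nth U 0 = 0" "fps_nth U 1 = 0"
      by (simp_all add: U_def DD_nth power2_eq_square fps_numeral_fps_const)
    then have "subdegree U \<ge> 2"
      by (metis One_nat_def Suc_1 \<open>U \<noteq> 0\<close> less_2_cases not_le nth_subdegree_nonzero)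
    moreover have "subdegree (8 * Y1) = 0"
      by (rule subdegreeI) (simp_all add: Y1_def fps_numeral_fps_const)
    moreover have "subdegree (rescale 2 U) = 2 * subdegree U"
      by (simp add: rescale_eq_compose)
    moreover have "subdegree (tX - tY) = 1"
      by (rule subdegreeI) auto
    moreover have "subdegree (8 * Y1 * rescale 2 U) = subdegree (8 * Y1) + subdegree (rescale 2 U)"
      using \<open>U \<noteq> 0\<close> by (intro subdegree_mult) (auto simp: Y1_def rescale_eq_compose fps_compose_eq_0_iff)
    moreover have "subdegree ((tX - tY) * U) = subdegree (tX - tY) + subdegree U"
      using \<open>U \<noteq> 0\<close> \<open>subdegree (tX - tY) = 1\<close> by (intro subdegree_mult) auto
    ultimately show False using U by simp
  qed
  then show ?thesis by (simp add: U_def)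
qed

lemma E2_level_4: "6 * rescale 2 E2 - 2 * E2 - 4 * rescale 4 E2 = 3 * (tX\<^sup>2 - tY\<^sup>2)"
proof -
  have "(2 * (tX * tY)) * (6 * rescale 2 E2 - 2 * E2 - 4 * rescale 4 E2)
      = (12 * DD tX) * tY - tX * (12 * DD tY)"
    unfolding DD_tX DD_tY by (simp add: algebra_simps)
  also have "\<dots> = 6 * (2 * (DD tX * tY - tX * DD tY))"
    by (simp add: algebra_simps)
  also have "\<dots> = (2 * (tX * tY)) * (3 * (tX\<^sup>2 - tY\<^sup>2))"
    unfolding DD_log_quotient by simp
  finally show ?thesis by simp
qed

lemma E2_nth_0 [simp]: "fps_nth E2 0 = 1"
  by (simp add: E2_def S1_def sig_def fps_numeral_fps_const)

text \<open>The level 4 relation says precisely that the defect k satisfies k(q) = k(q^2).\<close>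

lemma E2_level_2: "2 * rescale 2 E2 - E2 = 2 * tX\<^sup>2 - tY\<^sup>2"
proof -
  define k where "k = 2 * rescale 2 E2 - E2 - (2 * tX\<^sup>2 - tY\<^sup>2)"
  define X1 where "X1 = rescale 2 tX"
  have X1: "tX + tY = 2 * X1" by (simp add: X1_def tX_plus_tY)
  have r: "rescale 2 k = 2 * rescale 4 E2 - rescale 2 E2 - (2 * X1\<^sup>2 - tX * tY)"
    by (simp add: k_def X1_def rescale_hom rescale_tY_square)
  have "2 * k = 2 * rescale 2 k"
    unfolding r unfolding k_def using X1 E2_level_4 by algebra
  then have "k = fps_const 1 * rescale 2 k" by simp
  moreover have "fps_nth k 0 = 0"
    by (simp add: k_def power2_eq_square fps_numeral_fps_const)
  ultimately have "k = 0" by (metis rescale_invariant_eq_0)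
  then show ?thesis by (simp add: k_def)
qed

lemma E4_nth_0 [simp]: "fps_nth E4 0 = 1"
  by (simp add: E4_def)

lemma E4_poly_rescale:
  "rescale 2 (16 * tX ^ 4 - 16 * tX\<^sup>2 * tY\<^sup>2 + tY ^ 4) = tX ^ 4 - tX\<^sup>2 * tY\<^sup>2 + tY ^ 4"
proof -
  have "rescale 2 (tY ^ 4) = ((rescale 2 tY)\<^sup>2)\<^sup>2" by (simp add: rescale_power)
  then have "rescale 2 (16 * tX ^ 4 - 16 * tX\<^sup>2 * tY\<^sup>2 + tY ^ 4)
      = (2 * rescale 2 tX) ^ 4 - 4 * (2 * rescale 2 tX)\<^sup>2 * (tX * tY) + (tX * tY)\<^sup>2"
    by (simp add: rescale_hom rescale_tY_square power_mult_distrib)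
  also have "\<dots> = tX ^ 4 - tX\<^sup>2 * tY\<^sup>2 + tY ^ 4"
    unfolding tX_plus_tY[symmetric] by algebra
  finally show ?thesis .
qed

text \<open>Differentiating the level 2 relation and inserting Ramanujan's equation gives E4(q) - 4
  E4(q^2) as a quartic in X and Y. The proposed quartic satisfies the same relation, so descent with
  factor 4 applies to the difference.\<close>

theorem E4_eq: "E4 = 16 * tX ^ 4 - 16 * tX\<^sup>2 * tY\<^sup>2 + tY ^ 4"
proof -
  define k where "k = E4 - (16 * tX ^ 4 - 16 * tX\<^sup>2 * tY\<^sup>2 + tY ^ 4)"
  let ?e2 = "rescale 2 E2"
  have "12 * DD ?e2 = 2 * rescale 2 (12 * DD E2)"
    by (simp add: DD_rescale rescale_mult)
  then have e2: "12 * DD ?e2 = 2 * (?e2\<^sup>2 - rescale 2 E4)"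
    by (simp add: DD_E2 rescale_hom)
  have "2 * DD ?e2 - DD E2 = 4 * tX * DD tX - 2 * tY * DD tY"
    using arg_cong[OF E2_level_2, of DD] by (simp add: DD_mult DD_power2 algebra_simps)
  then have "E4 - 4 * rescale 2 E4 = 12 * tX ^ 4 - 12 * tX\<^sup>2 * tY\<^sup>2 - 3 * tY ^ 4"
    using e2 DD_E2 E2_level_4 E2_level_2 DD_tX DD_tY by algebra
  then have "k = fps_const 4 * rescale 2 k"
    unfolding k_def rescale_diff E4_poly_rescale fps_numeral_fps_const[symmetric] by algebra
  moreover have "fps_nth k 0 = 0"
    by (simp add: k_def power2_eq_square power4_eq_xxxx fps_numeral_fps_const)
  ultimately have "k = 0" by (metis rescale_invariant_eq_0)
  then show ?thesis by (simp add: k_def)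
qed

lemma E4_rescale_2: "rescale 2 E4 = tX ^ 4 - tX\<^sup>2 * tY\<^sup>2 + tY ^ 4"
  unfolding E4_eq by (rule E4_poly_rescale)

lemma E4_rescale_4: "16 * rescale 4 E4 = (tX + tY) ^ 4 - 4 * (tX + tY)\<^sup>2 * (tX * tY) + 16 * (tX * tY)\<^sup>2"
proof -
  have "rescale 2 (tY ^ 4) = ((rescale 2 tY)\<^sup>2)\<^sup>2" by (simp add: rescale_power)
  moreover have "rescale 4 E4 = rescale 2 (rescale 2 E4)" by (simp add: rescale_rescale)
  ultimately have "rescale 4 E4 = (rescale 2 tX) ^ 4 - (rescale 2 tX)\<^sup>2 * (tX * tY) + (tX * tY)\<^sup>2"
    by (simp add: E4_rescale_2 rescale_hom rescale_tY_square)
  then show ?thesis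
    using tX_plus_tY by algebra
qed

lemma E4_rescale_8: "256 * rescale 8 E4 = (tX + tY) ^ 4 + 56 * (tX + tY)\<^sup>2 * (tX * tY) + 16 * (tX * tY)\<^sup>2"
proof -
  let ?X = "rescale 2 tX" and ?Y = "rescale 2 tY"
  have "rescale 8 E4 = rescale 2 (rescale 4 E4)" by (simp add: rescale_rescale)
  then have "16 * rescale 8 E4 = rescale 2 (16 * rescale 4 E4)" by (simp add: rescale_mult)
  also have "\<dots> = (?X + ?Y) ^ 4 - 4 * (?X + ?Y)\<^sup>2 * (?X * ?Y) + 16 * (?X * ?Y)\<^sup>2"
    unfolding E4_rescale_4 by (simp add: rescale_hom)
  finally show ?thesis
    using tX_plus_tY rescale_tY_square by algebra
qed

section \<open>The modular equation of degree 3\<close>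

definition tZ :: "rat fps" where "tZ = rescale 3 tX"
definition tW :: "rat fps" where "tW = rescale 3 tY"
text \<open>Products of two among \<open>ts\<close>, \<open>tt\<close>, \<open>tr\<close>,
  \<open>tg\<close> become quadratics in X, Y, Z, W. These series are needed since the hexagonal
  theta series at q, q^2 and q^4 are linear in them.\<close>

definition ts :: "rat fps" where "ts = phi * rescale 3 phi"
definition tt :: "rat fps" where "tt = negq ts"
definition tr :: "rat fps" where "tr = rescale 2 tt"
definition tg :: "rat fps" where "tg = rescale 2 ts"

lemma tt_eq: "tt = negq phi * rescale 3 (negq phi)"
  by (simp add: tt_def ts_def negq_rescale_odd)

lemma rescale_nth_1 [simp]: "1 < k \<Longrightarrow> fps_nth (rescale k f) (Suc 0) = 0"
  by (auto simp: rescale_nth)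

lemma tZ_nth [simp]: "fps_nth tZ 0 = 1" "fps_nth tZ (Suc 0) = 0"
  and tW_nth [simp]: "fps_nth tW 0 = 1" "fps_nth tW (Suc 0) = 0"
  and ts_nth [simp]: "fps_nth ts 0 = 1" "fps_nth ts (Suc 0) = 2"
  and tt_nth [simp]: "fps_nth tt 0 = 1" "fps_nth tt (Suc 0) = - 2"
  and tr_nth [simp]: "fps_nth tr 0 = 1"
  by (simp_all add: tZ_def tW_def tt_eq ts_def tr_def)

lemma theta_nonzero [simp]: "tZ \<noteq> 0" "tW \<noteq> 0" "ts \<noteq> 0" "tt \<noteq> 0" "tr \<noteq> 0"
  by (rule nth_nonzero[where n = 0]; simp)+

lemma negq_theta [simp]: "negq tX = tY" "negq tY = tX" "negq tZ = tW" "negq tW = tZ"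
  "negq ts = tt" "negq tt = ts" "negq tr = tr" "negq tg = tg"
  by (simp_all add: tX_def tY_def tZ_def tW_def tt_def tr_def tg_def negq_rescale_odd negq_rescale_even)

lemma ts_square: "ts\<^sup>2 = tX * tZ" and tt_square: "tt\<^sup>2 = tY * tW"
  by (simp_all add: ts_def tt_eq tX_def tY_def tZ_def tW_def power_mult_distrib rescale_power)

lemma ts_minus_tt: "ts - tt = fps_X * rescale 2 Psi * rescale 6 Psi"
  unfolding Psi_Psi_eq tt_def ts_def
  using phi_rescale_phi[of 3] negq_phi_rescale_phi[of 3] by simp

lemma ts_plus_tt: "ts + tt = 2 * rescale 4 hex"
  unfolding Ev_3[symmetric] tt_def ts_def
  using phi_rescale_phi[of 3] negq_phi_rescale_phi[of 3] by simp

lemma hex_theta: "hex = 2 * ts - tt"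
  using hex_eq ts_minus_tt by (simp add: ts_def algebra_simps)

text \<open>Legendre's equation (\<alpha>\<beta>)^(1/4) + ((1-\<alpha>)(1-\<beta>))^(1/4) = 1 with 1
  - \<alpha> = Y^2/X^2 and 1 - \<beta> = W^2/Z^2, multiplied out. Both sides are the same product of
  \<open>Psi\<close> series.\<close>

lemma modular_equation: "(ts - tt) ^ 4 = (tX\<^sup>2 - tY\<^sup>2) * (tZ\<^sup>2 - tW\<^sup>2)"
proof -
  have "tZ\<^sup>2 - tW\<^sup>2 = rescale 3 (tX\<^sup>2 - tY\<^sup>2)"
    by (simp add: tZ_def tW_def rescale_power)
  also have "\<dots> = fps_X ^ 3 * rescale 6 Psi ^ 4"
    by (simp add: tX_tY_Psi rescale_hom)
  finally show ?thesis
    unfolding ts_minus_tt tX_tY_Psi by algebra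
qed

lemma ts_neq_tt: "ts - tt \<noteq> 0"
proof
  assume "ts - tt = 0"
  then have "fps_nth (ts - tt) 1 = 0" by simp
  then show False by simp
qed

text \<open>Logarithmic differentiation of the modular equation. Here b and c are 12 times the
  logarithmic derivatives of phi(-q) and phi(-q^3); \<open>E2\<close> enters only through them, and
  their sum is common to all terms and cancels.\<close>

lemma modular_equation_deriv: "tt * (tX\<^sup>2 + 3 * tZ\<^sup>2) = ts * (tY\<^sup>2 + 3 * tW\<^sup>2)"
proof -
  define b where "b = E2 - rescale 2 E2"
  define c where "c = 3 * rescale 3 b"
  have D3: "12 * DD (rescale 3 f) = 3 * rescale 3 (12 * DD f)" for f
    by (simp add: DD_rescale rescale_mult)
  have B: "12 * DD (negq phi) = negq phi * b"
    by (simp add: b_def DD_negq_phi)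
  have A: "12 * DD phi = phi * (b + 3 * (tX\<^sup>2 - tY\<^sup>2))"
    unfolding b_def using DD_phi E2_level_4 by algebra
  have D: "12 * DD (rescale 3 (negq phi)) = rescale 3 (negq phi) * c"
    unfolding D3 B by (simp add: c_def rescale_mult)
  have C: "12 * DD (rescale 3 phi) = rescale 3 phi * (c + 9 * (tZ\<^sup>2 - tW\<^sup>2))"
    unfolding D3 A by (simp add: c_def tZ_def tW_def rescale_hom algebra_simps)
  have t: "12 * DD tt = tt * (b + c)"
    unfolding tt_eq DD_mult using B D by algebra
  have s: "12 * DD ts = ts * (b + c + 3 * (tX\<^sup>2 - tY\<^sup>2) + 9 * (tZ\<^sup>2 - tW\<^sup>2))"
    unfolding ts_def DD_mult using A C by algebra
  have Y: "12 * DD tY = 2 * tY * b"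
    unfolding tY_def DD_power2 using B by algebra
  have X: "12 * DD tX = 2 * tX * (b + 3 * (tX\<^sup>2 - tY\<^sup>2))"
    using A DD_power2[of phi] tX_def by algebra
  have W: "12 * DD tW = 2 * tW * c"
    unfolding tW_def D3 Y by (simp add: c_def rescale_hom)
  have Z: "12 * DD tZ = 2 * tZ * (c + 9 * (tZ\<^sup>2 - tW\<^sup>2))"
    unfolding tZ_def D3 X by (simp add: c_def tW_def rescale_hom algebra_simps)
  have XY: "12 * DD (tX\<^sup>2 - tY\<^sup>2) = 4 * (tX\<^sup>2 - tY\<^sup>2) * (b + 3 * tX\<^sup>2)"
    unfolding DD_diff DD_power2 using X Y by algebra
  have ZW: "12 * DD (tZ\<^sup>2 - tW\<^sup>2) = 4 * (tZ\<^sup>2 - tW\<^sup>2) * (c + 9 * tZ\<^sup>2)"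
    unfolding DD_diff DD_power2 using Z W by algebra
  have "4 * (ts - tt) ^ 3 * (12 * DD (ts - tt))
      = (12 * DD (tX\<^sup>2 - tY\<^sup>2)) * (tZ\<^sup>2 - tW\<^sup>2) + (tX\<^sup>2 - tY\<^sup>2) * (12 * DD (tZ\<^sup>2 - tW\<^sup>2))"
    using arg_cong[OF modular_equation, of DD] unfolding DD_power4 DD_mult by algebra
  also have "\<dots> = 4 * (ts - tt) ^ 4 * (b + c + 3 * tX\<^sup>2 + 9 * tZ\<^sup>2)"
    unfolding XY ZW modular_equation by algebra
  finally have "(4 * (ts - tt) ^ 3) * (12 * DD (ts - tt))
      = (4 * (ts - tt) ^ 3) * ((ts - tt) * (b + c + 3 * tX\<^sup>2 + 9 * tZ\<^sup>2))"
    by algebra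
  moreover have "4 * (ts - tt) ^ 3 \<noteq> 0"
    using ts_neq_tt by simp
  ultimately have "12 * DD (ts - tt) = (ts - tt) * (b + c + 3 * tX\<^sup>2 + 9 * tZ\<^sup>2)"
    using mult_left_cancel by blast
  then have "3 * (tt * (tX\<^sup>2 + 3 * tZ\<^sup>2)) = 3 * (ts * (tY\<^sup>2 + 3 * tW\<^sup>2))"
    unfolding DD_diff using s t by algebra
  then show ?thesis by simp
qed

lemma nonzero_cancel: "c \<noteq> 0 \<Longrightarrow> c * a = c * b \<Longrightarrow> a = b" for a b c :: "rat fps"
  by simp

text \<open>Elimination of \<open>ts\<close> and \<open>tt\<close> between the modular equation and
  its derivative leads to J K = 4 e^2, a quartic relation that splits into two quadratic
  factors.\<close>

lemma quadric_1: "tY * (tX + tZ) = tW * (3 * tZ - tX)"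
proof -
  let ?J = "tX\<^sup>2 + 3 * tZ\<^sup>2" and ?K = "tY\<^sup>2 + 3 * tW\<^sup>2"
  let ?d = "tX * tW - tY * tZ" and ?e = "3 * tZ * tW - tX * tY"
  note m = modular_equation_deriv ts_square tt_square
  \<comment> \<open>Uses (X^2 - Y^2)(Z^2 - W^2) = (XZ - YW)^2 - d^2 together with XZ - YW = ts^2 -
    tt^2.\<close>
  have 1: "?d\<^sup>2 = 4 * ts * tt * (ts - tt)\<^sup>2"
    using modular_equation ts_square tt_square by algebra
  have 2: "(ts - tt) * (tY * tW * ?J) = tt * ?d * ?e"
    using m by algebra
  have "(?d\<^sup>2 * (tY * tW)) * (tY * tW * ?J\<^sup>2) = (?d\<^sup>2 * (tY * tW)) * (4 * ts * tt * ?e\<^sup>2)"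
    using 1 2 tt_square by algebra
  moreover have "?d \<noteq> 0" by (rule nth_nonzero[where n = 1]) simp
  then have "?d\<^sup>2 * (tY * tW) \<noteq> 0" by simp
  ultimately have 3: "tY * tW * ?J\<^sup>2 = 4 * ts * tt * ?e\<^sup>2"
    using nonzero_cancel by blast
  have "(ts * tt) * (?J * ?K) = (ts * tt) * (4 * ?e\<^sup>2)"
    using 3 m by algebra
  moreover have "ts * tt \<noteq> 0" by simp
  ultimately have 4: "?J * ?K = 4 * ?e\<^sup>2"
    using nonzero_cancel by blast
  \<comment> \<open>4 e^2 - J K is three times a difference of two squares. Its first factor has
    constant term -4, so the second one vanishes.\<close>
  have "3 * ((tX * tY - 3 * tZ * tW - tX * tW - tY * tZ) * (tX * tY - 3 * tZ * tW + tX * tW + tY * tZ)) = 0"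
    using 4 by algebra
  moreover have "tX * tY - 3 * tZ * tW - tX * tW - tY * tZ \<noteq> 0"
    by (rule nth_nonzero[where n = 0]) (simp add: fps_numeral_fps_const)
  ultimately have "tX * tY - 3 * tZ * tW + tX * tW + tY * tZ = 0" by simp
  then show ?thesis by algebra
qed

text \<open>The derived modular equation gives tt / ts = K / J, and the quadric gives K (X + Z)^2 =
  4 W^2 J. Eliminating K and cancelling J leaves both identities.\<close>

lemma four_ts_tt: "4 * (ts * tt) = (3 * tZ - tX) * (tX + tZ)"
  and sixteen_tX_tZ: "16 * (tX * tZ * tW\<^sup>2) = (3 * tZ - tX) * (tX + tZ) ^ 3"
proof -
  let ?J = "tX\<^sup>2 + 3 * tZ\<^sup>2" and ?K = "tY\<^sup>2 + 3 * tW\<^sup>2"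
  note m = modular_equation_deriv ts_square tt_square
  have nz: "?J \<noteq> 0" "tX + tZ \<noteq> 0"
    by (rule nth_nonzero[where n = 0], simp add: fps_numeral_fps_const power2_eq_square)+
  have 1: "?K * (tX + tZ)\<^sup>2 = 4 * tW\<^sup>2 * ?J"
    using quadric_1 by algebra
  have "tY * tW * ?J\<^sup>2 = tX * tZ * ?K\<^sup>2"
    using m by algebra
  then have "(tW\<^sup>2 * ?J\<^sup>2) * ((3 * tZ - tX) * (tX + tZ) ^ 3) = (tW\<^sup>2 * ?J\<^sup>2) * (16 * (tX * tZ * tW\<^sup>2))"
    using 1 quadric_1 by algebra
  moreover have "tW\<^sup>2 * ?J\<^sup>2 \<noteq> 0" using nz by simp
  ultimately show *: "16 * (tX * tZ * tW\<^sup>2) = (3 * tZ - tX) * (tX + tZ) ^ 3"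
    using nonzero_cancel by metis
  have "ts * tt * ?J = tX * tZ * ?K"
    using m by algebra
  then have "(?J * (tX + tZ)\<^sup>2) * (4 * (ts * tt)) = (?J * (tX + tZ)\<^sup>2) * ((3 * tZ - tX) * (tX + tZ))"
    using 1 * by algebra
  moreover have "?J * (tX + tZ)\<^sup>2 \<noteq> 0" using nz by simp
  ultimately show "4 * (ts * tt) = (3 * tZ - tX) * (tX + tZ)"
    using nonzero_cancel by blast
qed

text \<open>The product ts tt is fixed by q -> -q, so its expression in X and Z equals the conjugate
  one in Y and W.\<close>

lemma quadric_2: "(3 * tZ - tX) * (tX + tZ) = (3 * tW - tY) * (tY + tW)"
  using arg_cong[OF four_ts_tt, of negq] four_ts_tt by (simp add: mult.commute)

lemma quadric_1': "tX * (tY + tW) = tZ * (3 * tW - tY)"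
  using quadric_1 by algebra

lemma tr_square: "tr\<^sup>2 = ts * tt"
proof -
  have "tr\<^sup>2 = (rescale 2 (negq phi))\<^sup>2 * rescale 3 ((rescale 2 (negq phi))\<^sup>2)"
    by (simp add: tr_def tt_eq rescale_hom power_mult_distrib)
  also have "\<dots> = ts * tt"
    unfolding phi_negq_phi[symmetric] by (simp add: ts_def tt_eq rescale_mult mult_ac)
  finally show ?thesis .
qed

text \<open>Equal squares in an integral domain leave only a sign, and one nonzero coefficient fixes
  it.\<close>

lemma square_eq_nth_0:
  fixes f g :: "rat fps"
  assumes "f\<^sup>2 = g\<^sup>2" "fps_nth f n = fps_nth g n" "fps_nth g n \<noteq> 0"
  shows "f = g"
proof -
  have "f = g \<or> f = - g" using assms(1) by (simp add: power2_eq_iff)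
  then show ?thesis using assms(2,3) by auto
qed

text \<open>By the quadrics, 4 tr^2 ts^2 = XZ (3W - Y)(Y + W) = X^2 (Y + W)^2.\<close>

lemma tr_ts: "2 * (tr * ts) = (tY + tW) * tX"
proof (rule square_eq_nth_0[where n = 0])
  show "(2 * (tr * ts))\<^sup>2 = ((tY + tW) * tX)\<^sup>2"
    using tr_square ts_square four_ts_tt quadric_1' quadric_2 by algebra
qed (simp_all add: fps_numeral_fps_const)

lemma tr_tt: "2 * (tr * tt) = (tX + tZ) * tY"
  using arg_cong[OF tr_ts, of negq] by simp

lemma tg_square: "4 * tg\<^sup>2 = (tX + tY) * (tZ + tW)"
proof -
  have "tg\<^sup>2 = rescale 2 (tX * tZ)" by (simp add: tg_def rescale_power flip: ts_square)
  also have "\<dots> = rescale 2 tX * rescale 3 (rescale 2 tX)"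
    by (simp add: rescale_hom tZ_def)
  finally have "4 * tg\<^sup>2 = (2 * rescale 2 tX) * rescale 3 (2 * rescale 2 tX)"
    by (simp add: rescale_mult)
  then show ?thesis
    unfolding tX_plus_tY[symmetric] by (simp add: tZ_def tW_def)
qed

text \<open>Polarization: tg^2 and tr^2 are known, and 4 (tg - tr)^2 = (X - Y)(Z - W) because both
  sides are the same product of \<open>Psi\<close> series.\<close>

lemma tg_tr: "4 * (tg * tr) = 2 * (ts * tt) + tX * tW + tY * tZ"
proof -
  have "tg - tr = fps_X ^ 2 * rescale 4 Psi * rescale 12 Psi"
    using arg_cong[OF ts_minus_tt, of "rescale 2"] by (simp add: tg_def tr_def rescale_hom)
  moreover have "tZ - tW = 2 * fps_X ^ 3 * (rescale 12 Psi)\<^sup>2"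
    using arg_cong[OF tX_minus_tY, of "rescale 3"] by (simp add: tZ_def tW_def rescale_hom)
  ultimately have "4 * (tg - tr)\<^sup>2 = (tX - tY) * (tZ - tW)"
    unfolding tX_minus_tY by algebra
  then have "2 * (4 * (tg * tr)) = 2 * (2 * (ts * tt) + tX * tW + tY * tZ)"
    using tg_square tr_square by algebra
  moreover have "(2 :: rat fps) \<noteq> 0" by simp
  ultimately show ?thesis using nonzero_cancel by blast
qed

lemma hex_rescale_2: "rescale 2 hex = 2 * tg - tr"
  by (simp add: hex_theta tg_def tr_def rescale_hom)

section \<open>The forms as polynomials in the theta squares\<close>

text \<open>Dictionary from Euler products to theta series: squares at levels 1, 3, 4, 12 relative
  to levels 2 and 6, and then cubes at 2 and 6. A quotient with odd exponents at the former levels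
  must be squared before it can be translated.\<close>

lemma eta1_square: "(euler_prod 1)\<^sup>2 = euler_prod 2 * negq phi"
  and eta3_square: "(euler_prod 3)\<^sup>2 = euler_prod 6 * rescale 3 (negq phi)"
  and eta4_square: "2 * (euler_prod 4)\<^sup>2 = euler_prod 2 * rescale 2 Psi"
  and eta12_square: "2 * (euler_prod 12)\<^sup>2 = euler_prod 6 * rescale 6 Psi"
  using euler_phi euler_negq_phi_rescale[of 3] euler_Psi_rescale[of 2] euler_Psi_rescale[of 6]
  by simp_all

lemma eta2_cube: "2 * (euler_prod 2) ^ 3 = rescale 2 Psi * (phi * negq phi)"
proof -
  have "(euler_prod 4 * rescale 2 (negq phi))\<^sup>2 = (euler_prod 2) ^ 4"
    using euler_negq_phi_rescale[of 2] by (simp flip: power_mult)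
  then have "euler_prod 2 * (2 * (euler_prod 2) ^ 3) = euler_prod 2 * (rescale 2 Psi * (phi * negq phi))"
    using phi_negq_phi eta4_square by algebra
  then show ?thesis by (rule nonzero_cancel[rotated]) simp
qed

lemma eta6_cube: "2 * (euler_prod 6) ^ 3 = rescale 6 Psi * (rescale 3 phi * rescale 3 (negq phi))"
  using arg_cong[OF eta2_cube, of "rescale 3"] by (simp add: rescale_hom rescale_euler)

lemma f46_theta: "4 * f46 = ts * tt * (ts * tt - tY * tW)"
proof -
  have "f46 = fps_X * (euler_prod 1)\<^sup>2 * (euler_prod 2)\<^sup>2 * (euler_prod 3)\<^sup>2 * (euler_prod 6)\<^sup>2"
    by (simp add: f46_def eta_quot_def eta_part_def mult.assoc)
  then have "4 * f46 = negq phi * rescale 3 (negq phi) * fps_X * (2 * (euler_prod 2) ^ 3) * (2 * (euler_prod 6) ^ 3)"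
    unfolding eta1_square eta3_square by (simp add: power2_eq_square power3_eq_cube mult_ac)
  also have "\<dots> = tt * (ts - tt) * (ts * tt)"
    unfolding eta2_cube eta6_cube ts_minus_tt unfolding tt_eq ts_def by (simp add: mult_ac)
  finally show ?thesis
    using tt_square by algebra
qed

lemma f48_theta: "16 * f48 = tX * tY * (tX\<^sup>2 - tY\<^sup>2)"
proof -
  have "f48 = fps_X * (euler_prod 2) ^ 4 * (euler_prod 4) ^ 4"
    by (simp add: f48_def eta_quot_def eta_part_def mult.assoc)
  then have "16 * f48 = fps_X * (2 * (euler_prod 2) ^ 3)\<^sup>2 * (rescale 2 Psi)\<^sup>2"
    using eta4_square by algebra
  also have "\<dots> = tX * tY * (fps_X * (rescale 2 Psi) ^ 4)"
    unfolding eta2_cube unfolding tX_def tY_def by algebra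
  finally show ?thesis unfolding tX_tY_Psi .
qed

text \<open>Supplies the leading coefficient of an eta quotient, which settles the sign after
  squaring.\<close>

lemma eta_quotient_nth:
  fixes f g h :: "rat fps"
  assumes "f * g = fps_X ^ n * h" "fps_nth g 0 = 1" "fps_nth h 0 = 1"
  shows "fps_nth f n = 1"
proof -
  have "f = fps_X ^ n * (h * inverse g)"
    using assms(1,2) by (metis inverse_mult_eq_1' mult.assoc mult.right_neutral zero_neq_one)
  then show ?thesis using assms(2,3) by (simp add: fps_X_power_mult_nth)
qed

lemma euler_inverse: "inverse (euler_prod k) * euler_prod k = 1"
  by (simp add: inverse_mult_eq_1)

definition f412a :: "rat fps" where
  "f412a = eta_quot [(1,-1),(2,2),(3,3),(4,3),(6,2),(12,-1)]"

definition f412b :: "rat fps" where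
  "f412b = eta_quot [(1,3),(2,2),(3,-1),(4,-1),(6,2),(12,3)]"

lemma tW_eq: "tW = (rescale 3 (negq phi))\<^sup>2"
  by (simp add: tW_def tY_def rescale_power)

lemma tZ_tW_Psi: "tZ\<^sup>2 - tW\<^sup>2 = fps_X ^ 3 * rescale 6 Psi ^ 4"
  using arg_cong[OF tX_tY_Psi, of "rescale 3"] by (simp add: tZ_def tW_def rescale_hom)

lemma Psi_nonzero: "k > 0 \<Longrightarrow> rescale k Psi \<noteq> 0"
proof (rule nth_nonzero[where n = 0])
  have "fib UNIV (\<lambda>x::int. nat (x * (x + 1) div 2)) 0 = {- 1, 0}"
  proof -
    have "x = - 1 \<or> x = 0" if "nat (x * (x + 1) div 2) = 0" for x :: int
    proof -
      have "x * (x + 1) = 0" using that two_mult_triangle[of x] triangle_nonneg[of x] by linarith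
      then show ?thesis by auto
    qed
    then show ?thesis by (auto simp: fib_def)
  qed
  then show "fps_nth (rescale k Psi) 0 \<noteq> 0" by (simp add: Psi_def gser_nth)
qed

lemma rescale_phi_nonzero [simp]: "rescale 3 (negq phi) \<noteq> 0"
  by (rule nth_nonzero[where n = 0]) simp

text \<open>The odd exponents of the eta quotient force the computation of its square; the
  coefficient of q then fixes the sign.\<close>

lemma f412a_theta: "32 * f412a = (ts * tt - tY * tW) * (tX + tZ) * (tX + 3 * tZ)"
proof (rule square_eq_nth_0[where n = 1])
  let ?P = euler_prod
  let ?A = phi and ?C = "rescale 3 phi"
  let ?B = "negq phi" and ?D = "rescale 3 (negq phi)" and ?S = "rescale 2 Psi" and ?T = "rescale 6 Psi"
  have "f412a = fps_X * (inverse (?P 1) * (?P 2)\<^sup>2 * (?P 3) ^ 3 * (?P 4) ^ 3 * (?P 6)\<^sup>2 * inverse (?P 12))"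
    by (simp add: f412a_def eta_quot_def eta_part_def mult.assoc)
  then have q: "f412a * (?P 1 * ?P 12) = fps_X ^ 1 * ((?P 2)\<^sup>2 * (?P 3) ^ 3 * (?P 4) ^ 3 * (?P 6)\<^sup>2)"
    using euler_inverse[of 1] euler_inverse[of 12] by algebra
  show "fps_nth (32 * f412a) 1 = fps_nth ((ts * tt - tY * tW) * (tX + tZ) * (tX + 3 * tZ)) 1"
    using eta_quotient_nth[OF q] by (simp add: fps_numeral_fps_const fps_nth_power_0)
  have "16 * f412a\<^sup>2 * (2 * ((?P 1)\<^sup>2 * (?P 12)\<^sup>2))
      = 4 * fps_X\<^sup>2 * (?P 2) ^ 4 * (?P 3)\<^sup>2 ^ 3 * (2 * (?P 4)\<^sup>2) ^ 3 * (?P 6) ^ 4"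
  proof -
    have "16 * f412a\<^sup>2 * (2 * ((?P 1)\<^sup>2 * (?P 12)\<^sup>2)) = 32 * (f412a * (?P 1 * ?P 12))\<^sup>2"
      by algebra
    also have "\<dots> = 4 * fps_X\<^sup>2 * (?P 2) ^ 4 * (?P 3)\<^sup>2 ^ 3 * (2 * (?P 4)\<^sup>2) ^ 3 * (?P 6) ^ 4"
      unfolding q by algebra
    finally show ?thesis .
  qed
  then have "(?P 2 * ?P 6) * (16 * f412a\<^sup>2 * ?B * ?T)
      = (?P 2 * ?P 6) * (4 * fps_X\<^sup>2 * ?D ^ 3 * ?S ^ 3 * (?P 2 ^ 6) * (?P 6 ^ 6))"
    using eta1_square eta3_square eta4_square eta12_square by algebra
  then have "16 * f412a\<^sup>2 * ?B * ?T = 4 * fps_X\<^sup>2 * ?D ^ 3 * ?S ^ 3 * (?P 2 ^ 6) * (?P 6 ^ 6)"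
    by (rule nonzero_cancel[rotated]) simp
  then have "(4 * ?B * ?T) * (64 * f412a\<^sup>2) = (4 * ?B * ?T) * (fps_X\<^sup>2 * ?D ^ 5 * ?S ^ 5 * ?T * (?A\<^sup>2 * ?B * ?C\<^sup>2))"
    using eta2_cube eta6_cube by algebra
  then have "64 * f412a\<^sup>2 = fps_X\<^sup>2 * ?D ^ 5 * ?S ^ 5 * ?T * (?A\<^sup>2 * ?B * ?C\<^sup>2)"
    by (rule nonzero_cancel[rotated]) (simp add: Psi_nonzero)
  also have "\<dots> = (fps_X * ?S ^ 4) * (fps_X * ?S * ?T) * (?D\<^sup>2)\<^sup>2 * (?B * ?D) * (?A * ?C)\<^sup>2"
    by algebra
  also have "\<dots> = (tX\<^sup>2 - tY\<^sup>2) * (ts - tt) * tW\<^sup>2 * tt * ts\<^sup>2"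
    unfolding tX_tY_Psi ts_minus_tt tW_eq unfolding ts_def tt_eq ..
  finally have f: "64 * f412a\<^sup>2 = (tX\<^sup>2 - tY\<^sup>2) * (ts * tt - tY * tW) * tW\<^sup>2 * (tX * tZ)"
    using ts_square tt_square by algebra
  \<comment> \<open>Together with \<open>sixteen_tX_tZ\<close>, which replaces X Z W^2, this turns
    the right side of \<open>f\<close> into a perfect square.\<close>
  have "4 * ((3 * tZ - tX) * (tX + tZ) * (tX\<^sup>2 - tY\<^sup>2)) = 4 * ((ts * tt - tY * tW) * (tX + 3 * tZ)\<^sup>2)"
    using four_ts_tt quadric_1 quadric_2 by algebra
  then have "(3 * tZ - tX) * (tX + tZ) * (tX\<^sup>2 - tY\<^sup>2) = (ts * tt - tY * tW) * (tX + 3 * tZ)\<^sup>2"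
    by (rule nonzero_cancel[rotated]) simp
  then show "(32 * f412a)\<^sup>2 = ((ts * tt - tY * tW) * (tX + tZ) * (tX + 3 * tZ))\<^sup>2"
    using f sixteen_tX_tZ by algebra
qed (simp add: fps_numeral_fps_const)

lemma fps_mult_nth_2:
  fixes f g :: "rat fps"
  assumes "fps_nth f 0 = 0" "fps_nth g 0 = 0"
  shows "fps_nth (f * g) 2 = fps_nth f 1 * fps_nth g 1"
  using assms by (simp add: fps_mult_nth numeral_2_eq_2)

lemma f412b_theta: "32 * f412b = (ts * tt - tY * tW) * (3 * tZ - tX) * (tX - tZ)"
proof (rule square_eq_nth_0[where n = 2])
  let ?P = euler_prod
  let ?A = phi and ?C = "rescale 3 phi"
  let ?B = "negq phi" and ?D = "rescale 3 (negq phi)" and ?S = "rescale 2 Psi" and ?T = "rescale 6 Psi"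
  have "f412b = fps_X\<^sup>2 * ((?P 1) ^ 3 * (?P 2)\<^sup>2 * inverse (?P 3) * inverse (?P 4) * (?P 6)\<^sup>2 * (?P 12) ^ 3)"
    by (simp add: f412b_def eta_quot_def eta_part_def mult.assoc)
  then have q: "f412b * (?P 3 * ?P 4) = fps_X\<^sup>2 * ((?P 1) ^ 3 * (?P 2)\<^sup>2 * (?P 6)\<^sup>2 * (?P 12) ^ 3)"
    using euler_inverse[of 3] euler_inverse[of 4] by algebra
  \<comment> \<open>The first and the last factor start at 4q, and the middle one has constant term
    2.\<close>
  have 2: "fps_nth ((ts * tt - tY * tW) * (3 * tZ - tX) * (tX - tZ)) 2 = 32"
    by (subst fps_mult_nth_2) (simp_all add: fps_numeral_fps_const)
  then show "fps_nth ((ts * tt - tY * tW) * (3 * tZ - tX) * (tX - tZ)) 2 \<noteq> 0" by simp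
  show "fps_nth (32 * f412b) 2 = fps_nth ((ts * tt - tY * tW) * (3 * tZ - tX) * (tX - tZ)) 2"
    unfolding 2 using eta_quotient_nth[OF q] by (simp add: fps_numeral_fps_const fps_nth_power_0)
  have "16 * f412b\<^sup>2 * ((?P 3)\<^sup>2 * (2 * (?P 4)\<^sup>2))
      = 4 * fps_X ^ 4 * (?P 2) ^ 4 * (?P 1)\<^sup>2 ^ 3 * (2 * (?P 12)\<^sup>2) ^ 3 * (?P 6) ^ 4"
  proof -
    have "16 * f412b\<^sup>2 * ((?P 3)\<^sup>2 * (2 * (?P 4)\<^sup>2)) = 32 * (f412b * (?P 3 * ?P 4))\<^sup>2"
      by algebra
    also have "\<dots> = 4 * fps_X ^ 4 * (?P 2) ^ 4 * (?P 1)\<^sup>2 ^ 3 * (2 * (?P 12)\<^sup>2) ^ 3 * (?P 6) ^ 4"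
      unfolding q by algebra
    finally show ?thesis .
  qed
  then have "(?P 2 * ?P 6) * (16 * f412b\<^sup>2 * ?D * ?S)
      = (?P 2 * ?P 6) * (4 * fps_X ^ 4 * ?B ^ 3 * ?T ^ 3 * (?P 2 ^ 6) * (?P 6 ^ 6))"
    unfolding eta1_square eta3_square eta4_square eta12_square by algebra
  then have "16 * f412b\<^sup>2 * ?D * ?S = 4 * fps_X ^ 4 * ?B ^ 3 * ?T ^ 3 * (?P 2 ^ 6) * (?P 6 ^ 6)"
    by (rule nonzero_cancel[rotated]) simp
  then have "(4 * ?D * ?S) * (64 * f412b\<^sup>2) = 4 * fps_X ^ 4 * ?B ^ 3 * ?T ^ 3 * (2 * ?P 2 ^ 3)\<^sup>2 * (2 * ?P 6 ^ 3)\<^sup>2"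
    by algebra
  also have "\<dots> = (4 * ?D * ?S) * (fps_X ^ 4 * ?B ^ 5 * ?T ^ 5 * ?S * (?A\<^sup>2 * ?D * ?C\<^sup>2))"
    unfolding eta2_cube eta6_cube by algebra
  finally have "64 * f412b\<^sup>2 = fps_X ^ 4 * ?B ^ 5 * ?T ^ 5 * ?S * (?A\<^sup>2 * ?D * ?C\<^sup>2)"
    by (rule nonzero_cancel[rotated]) (simp add: Psi_nonzero)
  also have "\<dots> = (fps_X ^ 3 * ?T ^ 4) * (fps_X * ?S * ?T) * (?B\<^sup>2)\<^sup>2 * (?B * ?D) * (?A * ?C)\<^sup>2"
    by algebra
  also have "\<dots> = (tZ\<^sup>2 - tW\<^sup>2) * (ts - tt) * tY\<^sup>2 * tt * ts\<^sup>2"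
    unfolding tZ_tW_Psi ts_minus_tt unfolding tY_def ts_def tt_eq ..
  finally have f: "64 * f412b\<^sup>2 = (tZ\<^sup>2 - tW\<^sup>2) * (ts * tt - tY * tW) * tY\<^sup>2 * (tX * tZ)"
    using ts_square tt_square by algebra
  \<comment> \<open>The quadric trades W for Y in \<open>sixteen_tX_tZ\<close>.\<close>
  have "(tX + tZ)\<^sup>2 * (16 * (tX * tZ * tY\<^sup>2)) = 16 * (tX * tZ) * (tY * (tX + tZ))\<^sup>2"
    by algebra
  also have "\<dots> = (16 * (tX * tZ * tW\<^sup>2)) * (3 * tZ - tX)\<^sup>2"
    unfolding quadric_1 by algebra
  also have "\<dots> = (tX + tZ)\<^sup>2 * ((3 * tZ - tX) ^ 3 * (tX + tZ))"
    unfolding sixteen_tX_tZ by algebra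
  finally have "(tX + tZ)\<^sup>2 * (16 * (tX * tZ * tY\<^sup>2)) = (tX + tZ)\<^sup>2 * ((3 * tZ - tX) ^ 3 * (tX + tZ))" .
  moreover have "tX + tZ \<noteq> 0" by (rule nth_nonzero[where n = 0]) simp
  then have "(tX + tZ)\<^sup>2 \<noteq> 0" by (rule power_not_zero)
  ultimately have Y: "16 * (tX * tZ * tY\<^sup>2) = (3 * tZ - tX) ^ 3 * (tX + tZ)"
    using nonzero_cancel by blast
  have "4 * ((3 * tZ - tX) * (tX + tZ) * (tZ\<^sup>2 - tW\<^sup>2)) = 4 * ((ts * tt - tY * tW) * (tX - tZ)\<^sup>2)"
    using four_ts_tt quadric_1 quadric_2 by algebra
  then have "(3 * tZ - tX) * (tX + tZ) * (tZ\<^sup>2 - tW\<^sup>2) = (ts * tt - tY * tW) * (tX - tZ)\<^sup>2"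
    by (rule nonzero_cancel[rotated]) simp
  then show "(32 * f412b)\<^sup>2 = ((ts * tt - tY * tW) * (3 * tZ - tX) * (tX - tZ))\<^sup>2"
    using f Y by algebra
qed

lemma f412_theta: "16 * f412 = (ts * tt - tY * tW) * (tX\<^sup>2 + 3 * tZ\<^sup>2)"
proof -
  have "f412 = f412a - f412b" by (simp add: f412_def f412a_def f412b_def)
  then have "2 * (16 * f412) = 2 * ((ts * tt - tY * tW) * (tX\<^sup>2 + 3 * tZ\<^sup>2))"
    using f412a_theta f412b_theta by algebra
  then show ?thesis by (rule nonzero_cancel[rotated]) simp
qed

text \<open>The square of the eta quotient contains ts tt = tr^2 to an odd power, so its root
  involves \<open>tr\<close>; and 2 tr (ts - tt) = XW - YZ by \<open>tr_ts\<close> and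
  \<open>tr_tt\<close>.\<close>

lemma f424_theta: "8 * f424 = tX * tZ * (tX * tW - tY * tZ)"
proof -
  let ?P = euler_prod
  let ?A = phi and ?C = "rescale 3 phi"
  let ?B = "negq phi" and ?D = "rescale 3 (negq phi)" and ?S = "rescale 2 Psi" and ?T = "rescale 6 Psi"
  have "f424 = fps_X * (inverse (?P 1) ^ 4 * (?P 2) ^ 11 * inverse (?P 3) ^ 4 * inverse (?P 4) ^ 3 * (?P 6) ^ 11 * inverse (?P 12) ^ 3)"
    by (simp add: f424_def eta_quot_def eta_part_def mult.assoc)
  moreover have "inverse (?P k) ^ m * ?P k ^ m = 1" for k m
    by (simp add: euler_inverse flip: power_mult_distrib)
  note this[of 1 4] this[of 3 4] this[of 4 3] this[of 12 3]
  ultimately have q: "f424 * (?P 1 ^ 4 * ?P 3 ^ 4 * ?P 4 ^ 3 * ?P 12 ^ 3) = fps_X ^ 1 * (?P 2 ^ 11 * ?P 6 ^ 11)"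
    by algebra
  have "f424\<^sup>2 * ((?P 1)\<^sup>2 ^ 4 * (?P 3)\<^sup>2 ^ 4 * (2 * (?P 4)\<^sup>2) ^ 3 * (2 * (?P 12)\<^sup>2) ^ 3) = 64 * fps_X\<^sup>2 * (?P 2 ^ 22 * ?P 6 ^ 22)"
    using arg_cong[OF q, of "\<lambda>t. t\<^sup>2"] by (simp add: power_mult_distrib mult.assoc flip: power_mult)
  then have "(?P 2 ^ 7 * ?P 6 ^ 7) * (f424\<^sup>2 * (?B * ?D) ^ 4 * (?S * ?T) ^ 3)
      = (?P 2 ^ 7 * ?P 6 ^ 7) * (64 * fps_X\<^sup>2 * (?P 2 ^ 15 * ?P 6 ^ 15))"
    unfolding eta1_square eta3_square eta4_square eta12_square by algebra
  then have "f424\<^sup>2 * (?B * ?D) ^ 4 * (?S * ?T) ^ 3 = 64 * fps_X\<^sup>2 * (?P 2 ^ 15 * ?P 6 ^ 15)"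
    by (rule nonzero_cancel[rotated]) simp
  then have "16 * f424\<^sup>2 * ((?B * ?D) ^ 4 * (?S * ?T) ^ 3) = fps_X\<^sup>2 * ((2 * ?P 2 ^ 3) ^ 5 * (2 * ?P 6 ^ 3) ^ 5)"
    by (simp add: power_mult_distrib mult.assoc flip: power_mult)
  then have "((?B * ?D) ^ 4 * (?S * ?T) ^ 3) * (16 * f424\<^sup>2)
      = ((?B * ?D) ^ 4 * (?S * ?T) ^ 3) * (fps_X\<^sup>2 * (?S * ?T)\<^sup>2 * (?A * ?C) ^ 5 * (?B * ?D))"
    unfolding eta2_cube eta6_cube by algebra
  then have "16 * f424\<^sup>2 = fps_X\<^sup>2 * (?S * ?T)\<^sup>2 * (?A * ?C) ^ 5 * (?B * ?D)"
    by (rule nonzero_cancel[rotated]) (simp add: Psi_nonzero)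
  also have "\<dots> = (ts - tt)\<^sup>2 * ts ^ 5 * tt"
    unfolding ts_minus_tt unfolding ts_def tt_eq by algebra
  finally have "(4 * f424)\<^sup>2 = (ts\<^sup>2 * (tr * (ts - tt)))\<^sup>2"
    using tr_square by algebra
  then have "4 * f424 = ts\<^sup>2 * (tr * (ts - tt))"
    by (rule square_eq_nth_0[where n = 1])
       (use eta_quotient_nth[OF q] in \<open>simp_all add: fps_numeral_fps_const fps_nth_power_0 power2_eq_square\<close>)
  then show ?thesis
    using tr_ts tr_tt ts_square by algebra
qed

text \<open>XW - YZ changes sign under q -> -q while XZ becomes YW, so the odd part symmetrizes XZ
  to XZ + YW.\<close>

lemma odd_part_f424: "16 * odd_part f424 = (tX * tZ + tY * tW) * (tX * tW - tY * tZ)"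
proof -
  have "2 * odd_part f424 = f424 - negq f424"
    by (rule fps_ext) (auto simp: odd_part_def negq_nth fps_numeral_fps_const)
  moreover have "negq (8 * f424) = 8 * negq f424" by simp
  ultimately have "16 * odd_part f424 = 8 * f424 - negq (8 * f424)"
    by algebra
  also have "\<dots> = (tX * tZ + tY * tW) * (tX * tW - tY * tZ)"
    unfolding f424_theta by (simp add: algebra_simps)
  finally show ?thesis .
qed

text \<open>\<open>quartN\<close> is 4 ts tt, and \<open>quartS\<close> is 16 times the same product
  at q^2, written out with X(q^2) = (X + Y)/2 and Z(q^2) = (Z + W)/2. Both stay folded until the
  final eliminations.\<close>

definition quartN :: "rat fps" where "quartN = (3 * tZ - tX) * (tX + tZ)"
definition quartS :: "rat fps" where "quartS = (3 * (tZ + tW) - (tX + tY)) * (tX + tY + tZ + tW)"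

lemma tZ_plus_tW: "tZ + tW = 2 * rescale 2 tZ"
  using arg_cong[OF tX_plus_tY, of "rescale 3"] by (simp add: tZ_def tW_def rescale_hom)

lemma rescale_tW_square: "(rescale 2 tW)\<^sup>2 = tZ * tW"
  using arg_cong[OF rescale_tY_square, of "rescale 3"] by (simp add: tZ_def tW_def rescale_hom)

lemma rescale_tY_tW: "rescale 2 tY * rescale 2 tW = ts * tt"
  using arg_cong[OF tt_square, of "rescale 2"] tr_square
  by (simp add: tr_def rescale_power rescale_mult)

lemma quartN_eq: "quartN = 4 * (ts * tt)"
  by (simp add: quartN_def four_ts_tt)

lemma quartS_eq: "quartS = 16 * rescale 2 (ts * tt)"
proof -
  have "4 * rescale 2 (ts * tt) = (3 * rescale 2 tZ - rescale 2 tX) * (rescale 2 tX + rescale 2 tZ)"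
    using arg_cong[OF four_ts_tt, of "rescale 2"] by (simp add: rescale_mult)
  then show ?thesis
    unfolding quartS_def tX_plus_tY tZ_plus_tW
    using tX_plus_tY tZ_plus_tW by algebra
qed

lemma f46_poly: "64 * f46 = quartN * (quartN - 4 * (tY * tW))"
  unfolding quartN_eq using f46_theta by algebra

lemma f46_rescale_2: "4 * rescale 2 f46 = rescale 2 (ts * tt) * (rescale 2 (ts * tt) - ts * tt)"
  using arg_cong[OF f46_theta, of "rescale 2"] rescale_tY_tW by (simp add: rescale_mult)

lemma f46_rescale_2_poly: "1024 * rescale 2 f46 = quartS * (quartS - 4 * quartN)"
  unfolding quartN_eq quartS_eq using f46_rescale_2 by algebra

text \<open>With T = Y1 Z1 + X1 W1 the quadrics at q^2 give 4 S(q^2) = 2 S + T, hence 16 S(q^2)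
  (S(q^2) - S) = T^2 - 4 S^2. Squaring T removes the roots Y1 and W1, because Y1^2, W1^2 and Y1 W1
  are known.\<close>

lemma f46_rescale_4_poly:
  "4096 * rescale 4 f46 = 16 * (tX * tY * (tZ + tW)\<^sup>2 + (tX + tY)\<^sup>2 * (tZ * tW))
     + 8 * (tX + tY) * (tZ + tW) * quartN - quartS\<^sup>2"
proof -
  define S where "S = rescale 2 (ts * tt)"
  define X1 Y1 Z1 W1 where "X1 = rescale 2 tX" and "Y1 = rescale 2 tY"
    and "Z1 = rescale 2 tZ" and "W1 = rescale 2 tW"
  note d = S_def X1_def Y1_def Z1_def W1_def
  have 1: "4 * S = (3 * Z1 - X1) * (X1 + Z1)"
    using arg_cong[OF four_ts_tt, of "rescale 2"] by (simp add: d rescale_mult)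
  have 2: "(3 * Z1 - X1) * (X1 + Z1) = (3 * W1 - Y1) * (Y1 + W1)"
    using arg_cong[OF quadric_2, of "rescale 2"] by (simp add: d rescale_mult)
  have 3: "Y1 * (X1 + Z1) = W1 * (3 * Z1 - X1)"
    using arg_cong[OF quadric_1, of "rescale 2"] by (simp add: d rescale_mult)
  have "rescale 2 quartS = 16 * rescale 2 S"
    unfolding quartS_eq by (simp add: d rescale_mult)
  then have 4: "16 * rescale 2 S = (3 * (Z1 + W1) - (X1 + Y1)) * (X1 + Y1 + Z1 + W1)"
    by (simp add: quartS_def d rescale_mult)
  have "4 * (4 * rescale 2 S) = 4 * (2 * S + (Y1 * Z1 + X1 * W1))"
    using 1 2 3 4 by algebra
  then have 5: "4 * rescale 2 S = 2 * S + (Y1 * Z1 + X1 * W1)"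
    by (rule nonzero_cancel[rotated]) simp
  have "rescale 4 f46 = rescale 2 (rescale 2 f46)" by (simp add: rescale_rescale)
  then have "4 * rescale 4 f46 = rescale 2 (4 * rescale 2 f46)" by (simp add: rescale_mult)
  also have "\<dots> = rescale 2 S * (rescale 2 S - S)"
    unfolding f46_rescale_2 by (simp add: d rescale_mult)
  finally have "64 * rescale 4 f46 = (Y1 * Z1 + X1 * W1)\<^sup>2 - 4 * S\<^sup>2"
    using 5 by algebra
  moreover have "Y1\<^sup>2 = tX * tY" "W1\<^sup>2 = tZ * tW" "Y1 * W1 = ts * tt" "tX + tY = 2 * X1" "tZ + tW = 2 * Z1"
    by (simp_all add: d rescale_tY_square rescale_tW_square rescale_tY_tW tX_plus_tY tZ_plus_tW)
  moreover have "quartN = 4 * (ts * tt)" "quartS = 16 * S"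
    by (simp_all add: quartN_eq quartS_eq d)
  ultimately show ?thesis by algebra
qed

lemma f48_rescale_3: "16 * rescale 3 f48 = tZ * tW * (tZ\<^sup>2 - tW\<^sup>2)"
  using arg_cong[OF f48_theta, of "rescale 3"] by (simp add: tZ_def tW_def rescale_hom)

lemma f412_poly: "64 * f412 = (quartN - 4 * (tY * tW)) * (tX\<^sup>2 + 3 * tZ\<^sup>2)"
  unfolding quartN_eq using f412_theta by algebra

lemma f412_rescale_2_poly: "1024 * rescale 2 f412 = (quartS - 4 * quartN) * ((tX + tY)\<^sup>2 + 3 * (tZ + tW)\<^sup>2)"
proof -
  have "16 * rescale 2 f412 = (rescale 2 (ts * tt) - ts * tt) * ((rescale 2 tX)\<^sup>2 + 3 * (rescale 2 tZ)\<^sup>2)"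
    using arg_cong[OF f412_theta, of "rescale 2"] rescale_tY_tW by (simp add: rescale_mult rescale_power)
  then show ?thesis
    unfolding tX_plus_tY tZ_plus_tW quartN_eq quartS_eq by algebra
qed

lemma E4_rescale_3: "rescale 3 E4 = 16 * tZ ^ 4 - 16 * tZ\<^sup>2 * tW\<^sup>2 + tW ^ 4"
  using arg_cong[OF E4_eq, of "rescale 3"] by (simp add: tZ_def tW_def rescale_hom)

lemma E4_rescale_6: "rescale 6 E4 = tZ ^ 4 - tZ\<^sup>2 * tW\<^sup>2 + tW ^ 4"
  using arg_cong[OF E4_rescale_2, of "rescale 3"] by (simp add: tZ_def tW_def rescale_hom)

lemma E4_rescale_12: "16 * rescale 12 E4 = (tZ + tW) ^ 4 - 4 * (tZ + tW)\<^sup>2 * (tZ * tW) + 16 * (tZ * tW)\<^sup>2"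
  using arg_cong[OF E4_rescale_4, of "rescale 3"] by (simp add: tZ_def tW_def rescale_hom)

lemma E4_rescale_24: "256 * rescale 24 E4 = (tZ + tW) ^ 4 + 56 * (tZ + tW)\<^sup>2 * (tZ * tW) + 16 * (tZ * tW)\<^sup>2"
  using arg_cong[OF E4_rescale_8, of "rescale 3"] by (simp add: tZ_def tW_def rescale_hom)

text \<open>The known products tr ts and tr tg are multiplied, and tr^2 = ts tt is divided out. The
  quadratic on the right is one choice modulo the two quadrics.\<close>

lemma ts_tg: "8 * (ts * tg) = - 3 * tW\<^sup>2 + 6 * tZ * tW + 6 * tZ\<^sup>2 - 2 * tY * tW - 2 * tY * tZ + tY\<^sup>2 + 2 * tX * tZ"
proof -
  have "(4 * (ts * tt)) * (8 * (ts * tg)) = 4 * ((tY + tW) * tX) * (2 * (ts * tt) + tX * tW + tY * tZ)"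
    using tr_ts tg_tr tr_square by algebra
  then have "(8 * (ts * tt)) * (8 * (ts * tg)) = (8 * (ts * tt)) *
      (- 3 * tW\<^sup>2 + 6 * tZ * tW + 6 * tZ\<^sup>2 - 2 * tY * tW - 2 * tY * tZ + tY\<^sup>2 + 2 * tX * tZ)"
    using four_ts_tt quadric_1 quadric_2 by algebra
  then show ?thesis by (rule nonzero_cancel[rotated]) simp
qed

lemma tt_tg: "8 * (tt * tg) = - 3 * tZ\<^sup>2 + 6 * tZ * tW + 6 * tW\<^sup>2 - 2 * tX * tZ - 2 * tX * tW + tX\<^sup>2 + 2 * tY * tW"
  using arg_cong[OF ts_tg, of negq] by (simp add: mult_ac)

section \<open>Products of two hexagonal theta series\<close>

abbreviation "hex2 \<equiv> rescale 2 hex"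
abbreviation "hex4 \<equiv> rescale 4 hex"

lemma hex4_theta: "2 * hex4 = ts + tt"
  by (simp add: ts_plus_tt)

text \<open>In these four cases the linear expressions for the hexagonal series produce only squares
  and the products ts tt and tg tr.\<close>

lemma hex_11: "hex * hex = 4 * tX * tZ - quartN + tY * tW"
  and hex_14: "8 * (hex * hex4) = 8 * tX * tZ + quartN - 4 * tY * tW"
  and hex_44: "8 * (hex4 * hex4) = 2 * tX * tZ + quartN + 2 * tY * tW"
  and hex_22: "4 * (hex2 * hex2) = 4 * tX * tZ + 4 * tY * tW - quartN"
  unfolding quartN_eq using hex_theta hex4_theta hex_rescale_2 ts_square tt_square tr_square tg_square tg_tr
  by algebra+

text \<open>A level of 2 against 1 or 4 mixes \<open>ts\<close>, \<open>tt\<close> with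
  \<open>tg\<close>, \<open>tr\<close>, so all four cross products occur; the quadrics then shorten
  the result.\<close>

lemma hex_12: "4 * (hex * hex2) = 12 * tZ\<^sup>2 + 4 * tX * tZ - 9 * tW\<^sup>2 - 4 * tY * tW + tY\<^sup>2"
  and hex_24: "4 * (hex2 * hex4) = 3 * tZ\<^sup>2 - tY * tW + tY\<^sup>2 + tX * tZ"
proof -
  have "4 * (hex * hex2) = 2 * (8 * (ts * tg)) - 8 * (tt * tg) - 4 * ((tY + tW) * tX) + 2 * ((tX + tZ) * tY)"
    unfolding hex_rescale_2 using hex_theta tr_ts tr_tt by algebra
  then show "4 * (hex * hex2) = 12 * tZ\<^sup>2 + 4 * tX * tZ - 9 * tW\<^sup>2 - 4 * tY * tW + tY\<^sup>2"
    unfolding ts_tg tt_tg using quadric_1 quadric_2 by algebra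
  have "4 * (4 * (hex2 * hex4)) = 2 * (8 * (ts * tg)) + 2 * (8 * (tt * tg)) - 4 * ((tY + tW) * tX) - 4 * ((tX + tZ) * tY)"
    unfolding hex_rescale_2 using hex4_theta tr_ts tr_tt by algebra
  then have "4 * (4 * (hex2 * hex4)) = 4 * (3 * tZ\<^sup>2 - tY * tW + tY\<^sup>2 + tX * tZ)"
    unfolding ts_tg tt_tg using quadric_1 quadric_2 by algebra
  then show "4 * (hex2 * hex4) = 3 * tZ\<^sup>2 - tY * tW + tY\<^sup>2 + tX * tZ"
    by (rule nonzero_cancel[rotated]) simp
qed

section \<open>Representation numbers as coefficients\<close>

lemma gser_mult_1:
  assumes "finfib S e" "finfib T f"
  shows "gser S e (\<lambda>_. 1) * gser T f (\<lambda>_. 1) = gser (S \<times> T) (\<lambda>(i, j). e i + f j) (\<lambda>_. 1)"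
  unfolding gser_mult[OF assms] by (rule gser_cong) auto

text \<open>Positive coefficients keep the exponents natural and the fibres finite. The theta
  factors are bracketed in pairs so that each pair collapses to a single theta square.\<close>

lemma N_eq_nth:
  assumes "0 < a1" "0 < a2" "0 < a3" "0 < a4" "0 < b1" "0 < b2"
  shows "rat_of_nat (N a1 a2 a3 a4 b1 b2 n) =
    fps_nth (rescale (nat a1) phi * rescale (nat a2) phi * (rescale (nat a3) phi * rescale (nat a4) phi)
      * (rescale (nat b1) hex * rescale (nat b2) hex)) n"
proof -
  let ?f = "\<lambda>k (x::int). nat k * nat (x\<^sup>2)" and ?h = "\<lambda>k p. nat k * hexn p"
  have f: "finfib UNIV (?f k)" and h: "finfib UNIV (?h k)" if "0 < k" for k
    using that by (auto intro!: finfib_mult finfib_square finfib_hex)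
  have phi: "rescale (nat k) phi = gser UNIV (?f k) (\<lambda>_. 1)"
    and hex: "rescale (nat k) hex = gser UNIV (?h k) (\<lambda>_. 1)" if "0 < k" for k
    using that unfolding phi_def hex_def by (simp_all add: rescale_gser)
  let ?E = "\<lambda>(((x1, x2), (x3, x4)), (p, q)). ?f a1 x1 + ?f a2 x2 + (?f a3 x3 + ?f a4 x4) + (?h b1 p + ?h b2 q)"
  have "rescale (nat a1) phi * rescale (nat a2) phi * (rescale (nat a3) phi * rescale (nat a4) phi)
      * (rescale (nat b1) hex * rescale (nat b2) hex)
    = gser (((UNIV \<times> UNIV) \<times> (UNIV \<times> UNIV)) \<times> (UNIV \<times> UNIV)) ?E (\<lambda>_. 1)"
    unfolding phi[OF assms(1)] phi[OF assms(2)] phi[OF assms(3)] phi[OF assms(4)] hex[OF assms(5)] hex[OF assms(6)]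
    using assms by (simp only: gser_mult_1 finfib_Times f h) (rule gser_cong; auto)
  moreover have "card (fib (((UNIV \<times> UNIV) \<times> (UNIV \<times> UNIV)) \<times> (UNIV \<times> UNIV)) ?E n) = N a1 a2 a3 a4 b1 b2 n"
    unfolding N_def
  proof (rule bij_betw_same_card[where f = "\<lambda>(((x1, x2), (x3, x4)), ((x5, x6), (x7, x8))). (x1, x2, x3, x4, x5, x6, x7, x8)"],
      rule bij_betw_byWitness[where f' = "\<lambda>(x1, x2, x3, x4, x5, x6, x7, x8). (((x1, x2), (x3, x4)), ((x5, x6), (x7, x8)))"])
    have e: "?E (((x1, x2), (x3, x4)), ((x5, x6), (x7, x8))) = n \<longleftrightarrow>
        int n = a1 * x1^2 + a2 * x2^2 + a3 * x3^2 + a4 * x4^2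
              + b1 * (x5^2 + x5 * x6 + x6^2) + b2 * (x7^2 + x7 * x8 + x8^2)" for x1 x2 x3 x4 x5 x6 x7 x8
    proof -
      have "int (?E (((x1, x2), (x3, x4)), ((x5, x6), (x7, x8)))) = a1 * x1^2 + a2 * x2^2 + a3 * x3^2 + a4 * x4^2
              + b1 * (x5^2 + x5 * x6 + x6^2) + b2 * (x7^2 + x7 * x8 + x8^2)"
        using assms hex_nonneg[of x5 x6] hex_nonneg[of x7 x8] by simp
      then show ?thesis by linarith
    qed
    let ?F = "fib (((UNIV \<times> UNIV) \<times> (UNIV \<times> UNIV)) \<times> (UNIV \<times> UNIV)) ?E n"
    have F: "(((x1, x2), (x3, x4)), ((x5, x6), (x7, x8))) \<in> ?F \<longleftrightarrow>
        int n = a1 * x1^2 + a2 * x2^2 + a3 * x3^2 + a4 * x4^2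
              + b1 * (x5^2 + x5 * x6 + x6^2) + b2 * (x7^2 + x7 * x8 + x8^2)" for x1 x2 x3 x4 x5 x6 x7 x8
      using e unfolding fib_def by blast
    let ?G = "{(x1, x2, x3, x4, x5, x6, x7, x8). int n = a1 * x1^2 + a2 * x2^2 + a3 * x3^2 + a4 * x4^2
              + b1 * (x5^2 + x5 * x6 + x6^2) + b2 * (x7^2 + x7 * x8 + x8^2)}"
    show "(\<lambda>(((x1, x2), (x3, x4)), ((x5, x6), (x7, x8))). (x1, x2, x3, x4, x5, x6, x7, x8)) ` ?F \<subseteq> ?G"
      using F by (auto simp del: F)
    show "(\<lambda>(x1, x2, x3, x4, x5, x6, x7, x8). (((x1, x2), (x3, x4)), ((x5, x6), (x7, x8)))) ` ?G \<subseteq> ?F"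
      using F by auto
  qed auto
  ultimately show ?thesis by (simp add: gser_nth)
qed

section \<open>The thirty-six representation numbers\<close>

abbreviation tU :: "rat fps" where "tU \<equiv> rescale 2 tX"

lemmas form_polys = E4_eq E4_rescale_2 E4_rescale_4 E4_rescale_8
  E4_rescale_3 E4_rescale_6 E4_rescale_12 E4_rescale_24
  f46_poly f46_rescale_2_poly f46_rescale_4_poly f48_theta f48_rescale_3
  f412_poly f412_rescale_2_poly odd_part_f424

text \<open>The left multipliers, here and for the other five forms, clear the denominators of the
  table row, of \<open>form_polys\<close> and of the hexagonal products at once. What remains is
  membership in the ideal of the two quadrics with integer coefficients.\<close>

lemma rep_1111:
  "2400 * (tX * tX * (hex * hex)) = 224 * E4 - 168 * rescale 2 E4 - 864 * rescale 3 E4 - 896 *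
    rescale 4 E4 + 648 * rescale 6 E4 + 3456 * rescale 12 E4 - 34560 * f46 - 138240 * rescale 2 f46
    + 28800 * f412"
  "2400 * (tX * tX * (hex * hex2)) = 104 * E4 - 156 * rescale 2 E4 + 216 * rescale 3 E4 + 832 *
    rescale 4 E4 - 324 * rescale 6 E4 + 1728 * rescale 12 E4 + 23040 * f46 + 46080 * rescale 2 f46 -
    14400 * f412"
  "9600 * (tX * tX * (hex * hex4)) = 224 * E4 - 864 * rescale 3 E4 - 3584 * rescale 4 E4 + 13824 *
    rescale 12 E4 - 34560 * f46 + 138240 * rescale 2 f46 + 115200 * f412"
  "4800 * (tX * tX * (hex2 * hex2)) = 112 * E4 - 432 * rescale 3 E4 - 1792 * rescale 4 E4 + 6912 *
    rescale 12 E4 + 11520 * f46 - 46080 * rescale 2 f46"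
  "4800 * (tX * tX * (hex2 * hex4)) = 52 * E4 - 156 * rescale 2 E4 + 108 * rescale 3 E4 + 1664 *
    rescale 4 E4 - 324 * rescale 6 E4 + 3456 * rescale 12 E4 + 11520 * f46 + 92160 * rescale 2 f46 +
    14400 * f412"
  "9600 * (tX * tX * (hex4 * hex4)) = 56 * E4 + 168 * rescale 2 E4 - 216 * rescale 3 E4 - 3584 *
    rescale 4 E4 - 648 * rescale 6 E4 + 13824 * rescale 12 E4 + 34560 * f46 + 138240 * rescale 2 f46
    + 28800 * f412"
  using tX_plus_tY hex_11 hex_12 hex_14 hex_22 hex_24 hex_44 quadric_1 quadric_2
    form_polys
  unfolding quartN_def quartS_def by algebra+

lemma rep_1122:
  "19200 * (tX * tU * (hex * hex)) = 896 * E4 - 896 * rescale 2 E4 - 3456 * rescale 3 E4 + 448 *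
    rescale 4 E4 + 3456 * rescale 6 E4 - 7168 * rescale 8 E4 - 1728 * rescale 12 E4 + 27648 *
    rescale 24 E4 - 138240 * f46 - 921600 * rescale 2 f46 - 2949120 * rescale 4 f46 - 57600 * f48 -
    1555200 * rescale 3 f48 + 115200 * f412 + 691200 * rescale 2 f412 + 172800 * odd_part f424"
  "38400 * (tX * tU * (hex * hex2)) = 832 * E4 - 832 * rescale 2 E4 + 1728 * rescale 3 E4 - 832 *
    rescale 4 E4 - 1728 * rescale 6 E4 + 13312 * rescale 8 E4 - 1728 * rescale 12 E4 + 27648 *
    rescale 24 E4 + 184320 * f46 + 460800 * rescale 2 f46 + 737280 * rescale 4 f46 + 288000 * f48 +
    1555200 * rescale 3 f48 - 115200 * f412 - 230400 * rescale 2 f412 - 172800 * odd_part f424"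
  "38400 * (tX * tU * (hex * hex4)) = 448 * E4 - 448 * rescale 2 E4 - 1728 * rescale 3 E4 + 896 *
    rescale 4 E4 + 1728 * rescale 6 E4 - 14336 * rescale 8 E4 - 3456 * rescale 12 E4 + 55296 *
    rescale 24 E4 - 69120 * f46 + 230400 * rescale 2 f46 - 368640 * rescale 4 f46 - 57600 * f48 -
    1555200 * rescale 3 f48 + 230400 * f412 + 172800 * odd_part f424"
  "19200 * (tX * tU * (hex2 * hex2)) = 224 * E4 - 224 * rescale 2 E4 - 864 * rescale 3 E4 + 448 *
    rescale 4 E4 + 864 * rescale 6 E4 - 7168 * rescale 8 E4 - 1728 * rescale 12 E4 + 27648 * rescale
    24 E4 + 23040 * f46 - 230400 * rescale 2 f46 - 1105920 * rescale 4 f46 + 230400 * rescale 2 f412"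
  "38400 * (tX * tU * (hex2 * hex4)) = 208 * E4 - 208 * rescale 2 E4 + 432 * rescale 3 E4 - 832 *
    rescale 4 E4 - 432 * rescale 6 E4 + 13312 * rescale 8 E4 - 1728 * rescale 12 E4 + 27648 *
    rescale 24 E4 + 46080 * f46 + 460800 * rescale 2 f46 + 737280 * rescale 4 f46 + 57600 * f412 -
    230400 * rescale 2 f412"
  "38400 * (tX * tU * (hex4 * hex4)) = 112 * E4 - 112 * rescale 2 E4 - 432 * rescale 3 E4 + 896 *
    rescale 4 E4 + 432 * rescale 6 E4 - 14336 * rescale 8 E4 - 3456 * rescale 12 E4 + 55296 *
    rescale 24 E4 + 69120 * f46 + 230400 * rescale 2 f46 - 368640 * rescale 4 f46 + 57600 * f412"
  using tX_plus_tY hex_11 hex_12 hex_14 hex_22 hex_24 hex_44 quadric_1 quadric_2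
    form_polys
  unfolding quartN_def quartS_def by algebra+

lemma rep_1133:
  "2400 * (tX * tZ * (hex * hex)) = 64 * E4 - 80 * rescale 2 E4 + 576 * rescale 3 E4 + 256 *
    rescale 4 E4 - 720 * rescale 6 E4 + 2304 * rescale 12 E4 + 23040 * f46 + 138240 * rescale 2 f46"
  "480 * (tX * tZ * (hex * hex2)) = 8 * E4 - 4 * rescale 2 E4 - 72 * rescale 3 E4 - 64 * rescale 4
    E4 + 36 * rescale 6 E4 + 576 * rescale 12 E4 + 2880 * f412"
  "9600 * (tX * tZ * (hex * hex4)) = 64 * E4 - 128 * rescale 2 E4 + 576 * rescale 3 E4 + 1024 *
    rescale 4 E4 - 1152 * rescale 6 E4 + 9216 * rescale 12 E4 + 80640 * f46 + 322560 * rescale 2 f46"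
  "4800 * (tX * tZ * (hex2 * hex2)) = 32 * E4 - 64 * rescale 2 E4 + 288 * rescale 3 E4 + 512 *
    rescale 4 E4 - 576 * rescale 6 E4 + 4608 * rescale 12 E4 + 11520 * f46 + 46080 * rescale 2 f46"
  "960 * (tX * tZ * (hex2 * hex4)) = 4 * E4 + 4 * rescale 2 E4 - 36 * rescale 3 E4 - 128 * rescale
    4 E4 - 36 * rescale 6 E4 + 1152 * rescale 12 E4 + 2880 * f412"
  "4800 * (tX * tZ * (hex4 * hex4)) = 8 * E4 - 40 * rescale 2 E4 + 72 * rescale 3 E4 + 512 *
    rescale 4 E4 - 360 * rescale 6 E4 + 4608 * rescale 12 E4 + 17280 * f46 + 46080 * rescale 2 f46"
  using tX_plus_tY hex_11 hex_12 hex_14 hex_22 hex_24 hex_44 quadric_1 quadric_2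
    form_polys
  unfolding quartN_def quartS_def by algebra+

lemma rep_2222:
  "19200 * (tU * tU * (hex * hex)) = 336 * E4 + 1456 * rescale 2 E4 - 1296 * rescale 3 E4 - 1344 *
    rescale 4 E4 - 5616 * rescale 6 E4 - 7168 * rescale 8 E4 + 5184 * rescale 12 E4 + 27648 *
    rescale 24 E4 - 138240 * f46 - 1198080 * rescale 2 f46 - 2949120 * rescale 4 f46 - 57600 * f48 -
    1555200 * rescale 3 f48 + 172800 * f412 + 691200 * rescale 2 f412 + 172800 * odd_part f424"
  "38400 * (tU * tU * (hex * hex2)) = 624 * E4 - 3952 * rescale 2 E4 + 1296 * rescale 3 E4 + 2496 *
    rescale 4 E4 - 8208 * rescale 6 E4 + 13312 * rescale 8 E4 + 5184 * rescale 12 E4 + 27648 *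
    rescale 24 E4 + 138240 * f46 + 645120 * rescale 2 f46 + 737280 * rescale 4 f46 + 288000 * f48 +
    1555200 * rescale 3 f48 - 172800 * f412 - 230400 * rescale 2 f412 - 172800 * odd_part f424"
  "19200 * (tU * tU * (hex * hex4)) = 168 * E4 - 1064 * rescale 2 E4 - 648 * rescale 3 E4 + 1344 *
    rescale 4 E4 + 4104 * rescale 6 E4 - 7168 * rescale 8 E4 - 5184 * rescale 12 E4 + 27648 *
    rescale 24 E4 - 69120 * f46 - 92160 * rescale 2 f46 - 184320 * rescale 4 f46 - 28800 * f48 -
    777600 * rescale 3 f48 + 86400 * f412 + 86400 * odd_part f424"
  "19200 * (tU * tU * (hex2 * hex2)) = 1792 * rescale 2 E4 - 1344 * rescale 4 E4 - 6912 * rescale 6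
    E4 - 7168 * rescale 8 E4 + 5184 * rescale 12 E4 + 27648 * rescale 24 E4 - 276480 * rescale 2 f46
    - 1105920 * rescale 4 f46 + 230400 * rescale 2 f412"
  "38400 * (tU * tU * (hex2 * hex4)) = 1664 * rescale 2 E4 - 2496 * rescale 4 E4 + 3456 * rescale 6
    E4 + 13312 * rescale 8 E4 - 5184 * rescale 12 E4 + 27648 * rescale 24 E4 + 368640 * rescale 2
    f46 + 737280 * rescale 4 f46 - 230400 * rescale 2 f412"
  "19200 * (tU * tU * (hex4 * hex4)) = 448 * rescale 2 E4 - 1728 * rescale 6 E4 - 7168 * rescale 8
    E4 + 27648 * rescale 24 E4 + 46080 * rescale 2 f46 - 184320 * rescale 4 f46"
  using tX_plus_tY hex_11 hex_12 hex_14 hex_22 hex_24 hex_44 quadric_1 quadric_2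
    form_polys
  unfolding quartN_def quartS_def by algebra+

lemma rep_2233:
  "9600 * (tU * tZ * (hex * hex)) = 128 * E4 - 128 * rescale 2 E4 + 1152 * rescale 3 E4 - 64 *
    rescale 4 E4 - 1152 * rescale 6 E4 + 1024 * rescale 8 E4 - 576 * rescale 12 E4 + 9216 * rescale
    24 E4 + 46080 * f46 + 460800 * rescale 2 f46 + 1474560 * rescale 4 f46 + 96000 * f48 + 172800 *
    rescale 3 f48 - 230400 * rescale 2 f412 - 57600 * odd_part f424"
  "7680 * (tU * tZ * (hex * hex2)) = 64 * E4 - 64 * rescale 2 E4 - 576 * rescale 3 E4 + 64 *
    rescale 4 E4 + 576 * rescale 6 E4 - 1024 * rescale 8 E4 - 576 * rescale 12 E4 + 9216 * rescale
    24 E4 - 92160 * rescale 2 f46 - 737280 * rescale 4 f46 - 26880 * f48 - 34560 * rescale 3 f48 +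
    23040 * f412 + 46080 * rescale 2 f412 + 34560 * odd_part f424"
  "38400 * (tU * tZ * (hex * hex4)) = 128 * E4 - 128 * rescale 2 E4 + 1152 * rescale 3 E4 - 256 *
    rescale 4 E4 - 1152 * rescale 6 E4 + 4096 * rescale 8 E4 - 2304 * rescale 12 E4 + 36864 *
    rescale 24 E4 + 161280 * f46 + 691200 * rescale 2 f46 + 368640 * rescale 4 f46 + 96000 * f48 +
    1209600 * rescale 3 f48 - 460800 * rescale 2 f412 - 57600 * odd_part f424"
  "19200 * (tU * tZ * (hex2 * hex2)) = 64 * E4 - 64 * rescale 2 E4 + 576 * rescale 3 E4 - 128 *
    rescale 4 E4 - 576 * rescale 6 E4 + 2048 * rescale 8 E4 - 1152 * rescale 12 E4 + 18432 * rescale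
    24 E4 + 23040 * f46 + 230400 * rescale 2 f46 + 1105920 * rescale 4 f46 + 19200 * f48 - 172800 *
    rescale 3 f48 - 57600 * odd_part f424"
  "7680 * (tU * tZ * (hex2 * hex4)) = 16 * E4 - 16 * rescale 2 E4 - 144 * rescale 3 E4 + 64 *
    rescale 4 E4 + 144 * rescale 6 E4 - 1024 * rescale 8 E4 - 576 * rescale 12 E4 + 9216 * rescale
    24 E4 - 15360 * f48 - 138240 * rescale 3 f48 + 11520 * f412 + 46080 * rescale 2 f412"
  "38400 * (tU * tZ * (hex4 * hex4)) = 32 * E4 - 32 * rescale 2 E4 + 288 * rescale 3 E4 - 256 *
    rescale 4 E4 - 288 * rescale 6 E4 + 4096 * rescale 8 E4 - 2304 * rescale 12 E4 + 36864 * rescale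
    24 E4 + 69120 * f46 + 230400 * rescale 2 f46 + 368640 * rescale 4 f46 - 19200 * f48 + 172800 *
    rescale 3 f48 - 57600 * odd_part f424"
  using tX_plus_tY hex_11 hex_12 hex_14 hex_22 hex_24 hex_44 quadric_1 quadric_2
    form_polys
  unfolding quartN_def quartS_def by algebra+

lemma rep_3333:
  "2400 * (tZ * tZ * (hex * hex)) = 32 * E4 - 24 * rescale 2 E4 - 672 * rescale 3 E4 - 128 *
    rescale 4 E4 + 504 * rescale 6 E4 + 2688 * rescale 12 E4 + 11520 * f46 + 46080 * rescale 2 f46 +
    9600 * f412"
  "2400 * (tZ * tZ * (hex * hex2)) = 8 * E4 - 12 * rescale 2 E4 + 312 * rescale 3 E4 + 64 * rescale
    4 E4 - 468 * rescale 6 E4 + 2496 * rescale 12 E4 + 7680 * f46 + 15360 * rescale 2 f46 + 4800 *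
    f412"
  "9600 * (tZ * tZ * (hex * hex4)) = 32 * E4 - 672 * rescale 3 E4 - 512 * rescale 4 E4 + 10752 *
    rescale 12 E4 + 11520 * f46 - 46080 * rescale 2 f46 + 38400 * f412"
  "4800 * (tZ * tZ * (hex2 * hex2)) = 16 * E4 - 336 * rescale 3 E4 - 256 * rescale 4 E4 + 5376 *
    rescale 12 E4 - 3840 * f46 + 15360 * rescale 2 f46"
  "4800 * (tZ * tZ * (hex2 * hex4)) = 4 * E4 - 12 * rescale 2 E4 + 156 * rescale 3 E4 + 128 *
    rescale 4 E4 - 468 * rescale 6 E4 + 4992 * rescale 12 E4 + 3840 * f46 + 30720 * rescale 2 f46 -
    4800 * f412"
  "9600 * (tZ * tZ * (hex4 * hex4)) = 8 * E4 + 24 * rescale 2 E4 - 168 * rescale 3 E4 - 512 *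
    rescale 4 E4 - 504 * rescale 6 E4 + 10752 * rescale 12 E4 - 11520 * f46 - 46080 * rescale 2 f46
    + 9600 * f412"
  using tX_plus_tY hex_11 hex_12 hex_14 hex_22 hex_24 hex_44 quadric_1 quadric_2
    form_polys
  unfolding quartN_def quartS_def by algebra+

lemma phi_products: "phi * phi = tX" "rescale 2 phi * rescale 2 phi = tU" "rescale 3 phi * rescale 3 phi = tZ"
  by (simp_all add: tX_def tZ_def rescale_power power2_eq_square rescale_mult)

text \<open>Restores, coefficient by coefficient, the rational numbers of the table.\<close>

lemma nth_solve:
  fixes f g :: "rat fps"
  assumes "numeral m * f = g"
  shows "fps_nth f n = fps_nth g n / numeral m"
  unfolding assms[symmetric] by (simp add: fps_numeral_fps_const)

lemmas rep_nth = rep_1111[THEN nth_solve] rep_1122[THEN nth_solve] rep_1133[THEN nth_solve]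
  rep_2222[THEN nth_solve] rep_2233[THEN nth_solve] rep_3333[THEN nth_solve]

definition theta_product :: "(int \<times> int \<times> int \<times> int) \<times> (int \<times> int) \<Rightarrow> rat fps" where
  "theta_product = (\<lambda>((a1, a2, a3, a4), (b1, b2)).
    rescale (nat a1) phi * rescale (nat a2) phi * (rescale (nat a3) phi * rescale (nat a4) phi)
      * (rescale (nat b1) hex * rescale (nat b2) hex))"

text \<open>One statement over the whole table spares the final theorem its 36 cases; the length is
  recorded because \<open>zip\<close> would silently drop surplus entries.\<close>

lemma table_rows:
  "list_all (\<lambda>(k, r). length r = 16 \<and>
     fps_nth (theta_product k) n = (\<Sum>(c, f)\<leftarrow>zip r fs. c * fps_nth f n)) alpha_table"
  unfolding alpha_table_def list.pred_inject theta_product_def fs_def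
  by (intro conjI TrueI; simp add: phi_products rep_nth fps_numeral_fps_const; simp add: field_simps)

theorem theorem2p1:
  fixes a1 a2 a3 a4 b1 b2 :: int and n :: nat
  assumes "(a1, a2, a3, a4) \<in> {(1,1,1,1), (1,1,2,2), (1,1,3,3), (2,2,2,2), (2,2,3,3), (3,3,3,3)}"
      and "(b1, b2) \<in> {(1,1), (1,2), (1,4), (2,2), (2,4), (4,4)}"
  shows "rat_of_nat (N a1 a2 a3 a4 b1 b2 n)
           = (\<Sum>i = 1..16. alpha (a1, a2, a3, a4) (b1, b2) i * A i n)"
proof -
  let ?k = "((a1, a2, a3, a4), (b1, b2))"
  have "?k \<in> {(1,1,1,1), (1,1,2,2), (1,1,3,3), (2,2,2,2), (2,2,3,3), (3,3,3,3)}
      \<times> {(1,1), (1,2), (1,4), (2,2), (2,4), (4,4)}"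
    using assms by blast
  \<comment> \<open>Completeness of the table, without which \<open>the\<close> in
    \<open>alpha\<close> would be unspecified.\<close>
  also have "\<dots> \<subseteq> fst ` set alpha_table"
    unfolding alpha_table_def by (auto simp del: One_nat_def)
  finally have "map_of alpha_table ?k \<noteq> None"
    by (simp add: map_of_eq_None_iff)
  then obtain r where r: "map_of alpha_table ?k = Some r" by blast
  then have "(?k, r) \<in> set alpha_table" by (rule map_of_SomeD)
  with table_rows[of n] have *: "length r = 16"
      "fps_nth (theta_product ?k) n = (\<Sum>(c, f)\<leftarrow>zip r fs. c * fps_nth f n)"
    by (auto simp: list_all_iff)
  have "0 < a1" "0 < a2" "0 < a3" "0 < a4" "0 < b1" "0 < b2"
    using assms by auto
  from N_eq_nth[OF this, of n]
  have "rat_of_nat (N a1 a2 a3 a4 b1 b2 n) = (\<Sum>(c, f)\<leftarrow>zip r fs. c * fps_nth f n)"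
    using *(2) by (simp add: theta_product_def)
  also have "length fs = 16" by (simp add: fs_def)
  then have "(\<Sum>(c, f)\<leftarrow>zip r fs. c * fps_nth f n) = (\<Sum>i<16. r ! i * fps_nth (fs ! i) n)"
    using *(1) by (simp add: sum_list_sum_nth atLeast0LessThan)
  \<comment> \<open>\<open>alpha\<close> and \<open>A\<close> count from 1, list positions from
    0.\<close>
  also have "\<dots> = (\<Sum>i = 1..16. r ! (i - 1) * fps_nth (fs ! (i - 1)) n)"
    by (rule sum.reindex_bij_witness[where i = "\<lambda>i. i - 1" and j = Suc]) auto
  finally show ?thesis
    by (simp add: alpha_def A_def r)
qed

end
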